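(* Let $d\ge 2$ be an integer, $W=\mathbb{R}^{d+1}$, $D=\binom{d+1}{2}$, and let $G=(V,E)$ be a finite graph (parallel edges allowed, no loops) with a bipartition $\{B,R\}$ of $V$. Then, for almost all rod-configurations $\mathbf{r}$ and bar-configurations $\mathbf{q}$, $\mathcal{BR}(G,\mathbf{q},\mathbf{r})=\mathcal{M}(\mathcal{A}(\mathbf{r}))$.
   Context: Exterior algebra: $\bigwedge^kW$ identified with $\mathbb{R}^{\binom{d+1}{k}}$ via the standard basis; $\bigwedge^2W\cong\bigwedge^{d-1}W\cong\mathbb{R}^D$. $Gr(k,W)\subseteq\mathbb{P}(\bigwedge^kW)$ via the Plücker embedding. For $\mathbf{p}\in\bigwedge^2W$, $\mathbf{s}\in\bigwedge^{d-1}W$ define $\mathbf{p}\cdot\mathbf{s}$ by $\mathbf{p}\wedge\mathbf{s}=(\mathbf{p}\cdot\mathbf{s})e_1\wedge\dots\wedge e_{d+1}$. A rod-configuration is $\mathbf{r}:R\to Gr(d-1,W)$, $v\mapsto[\mathbf{r}_v]$, with distinct rods. A bar-configuration is $\mathbf{q}:E\to Gr(2,W)$, $e\mapsto[\mathbf{q}_e]$, with $\mathbf{q}_e\cdot\mathbf{r}_v=0$ whenever $e$ is incident to $v\in R$. $\mathcal{BR}(G,\mathbf{q},\mathbf{r})$ is the linear matroid on $E$ where $e=uv$ is represented by the vector in $V_V:=(\mathbb{R}^D)^V$ with $\mathbf{q}_e$ in block $u$, $-\mathbf{q}_e$ in block $v$, zeros elsewhere. For $v\in R$ let $H_{\mathbf{r}}(v)=\{[\mathbf{p}]\in\mathbb{P}(\bigwedge^2W):\mathbf{p}\cdot\mathbf{r}_v=0\}$,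 and for $v\in B$ let $H_{\mathbf{r}}(v)=\mathbb{P}(\bigwedge^2W)$. For $e=uv\in E$ let $A_e(\mathbf{r})\subseteq\mathbb{P}(V_V)$ be the flat of points whose $u$-block is $\boldsymbol\alpha$, $v$-block is $-\boldsymbol\alpha$ and other blocks are $0$, where $[\boldsymbol\alpha]$ ranges over $H_{\mathbf{r}}(u)\cap H_{\mathbf{r}}(v)$; $\mathcal{A}(\mathbf{r})=\{A_e(\mathbf{r}):e\in E\}$ (indexed by $E$). Generic matroid: for a family $\mathcal{A}=\{A_e:e\in E\}$ of flats in a projective space, a choice of points $x_e\in A_e$ ($X=\{x_e\}$) is in generic position if for every $X'\subseteq X$ and $x_e\in X'$, $x_e\in\overline{X'-x_e}$ implies $A_e\subseteq\overline{X'-x_e}$ (overline = projective span). $\mathcal{M}(\mathcal{A})$ is the matroid on $E$ whose rank of $F$ is the rank (dimension of the associated linear subspace) of $\overline{\{x_e:e\in F\}}$ for $X$ in generic position; this is independent of the choice. *)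

theory Defs
  imports "HOL-Analysis.Analysis" "Graph_Theory.Digraph"
begin

section \<open>Exterior algebra of \<open>W = real ^ 'n\<close>\<close>

text \<open>
  The coordinate of \<open>x :: 'n ext\<close> at \<open>I = {i\<^sub>1 < \<dots> < i\<^sub>k}\<close> is the coefficient of
  \<open>e\<^bsub>i\<^sub>1\<^esub> \<and> \<dots> \<and> e\<^bsub>i\<^sub>k\<^esub>\<close>. Thus \<open>'n ext\<close> is the whole exterior algebra, and the \<open>k\<close>-th
  exterior power is the coordinate subspace carried by the \<open>k\<close>-element index sets.
\<close>

type_synonym 'n ext = "real ^ ('n set)"

definition ext_power :: "nat \<Rightarrow> 'n::finite ext set" where
  "ext_power k = {x. \<forall>I. card I \<noteq> k \<longrightarrow> x $ I = 0}"

text \<open>The sign of the permutation sorting the concatenation of \<open>I\<close> and \<open>J\<close>.\<close>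

definition shuffle_sign :: "'n::linorder set \<Rightarrow> 'n set \<Rightarrow> real" where
  "shuffle_sign I J = (-1) ^ card {(i, j). i \<in> I \<and> j \<in> J \<and> j < i}"

definition wedge :: "'n::{finite,linorder} ext \<Rightarrow> 'n ext \<Rightarrow> 'n ext" where
  "wedge x y = (\<chi> K. \<Sum>I\<in>Pow K. shuffle_sign I (K - I) * x $ I * y $ (K - I))"

definition ext_of_vec :: "real ^ ('n::finite) \<Rightarrow> 'n ext" where
  "ext_of_vec a = (\<Sum>i\<in>UNIV. a $ i *\<^sub>R axis {i} 1)"

definition wedge_list :: "(real ^ ('n::{finite,linorder})) list \<Rightarrow> 'n ext" where
  "wedge_list as = foldr (\<lambda>a. wedge (ext_of_vec a)) as (axis {} 1)"

text \<open>The coefficient of \<open>p \<and> s\<close> at the product of all basis vectors.\<close>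

definition ext_dot :: "'n::{finite,linorder} ext \<Rightarrow> 'n ext \<Rightarrow> real" where
  "ext_dot p s = wedge p s $ UNIV"

text \<open>
  Projective points are handled through nonzero representative vectors, and projective flats
  through linear subspaces. So this is the set of representatives of the points of the
  Grassmannian \<open>Gr(k, W)\<close> in its Pluecker embedding, i.e. the affine cone over \<open>Gr(k, W)\<close>
  without its apex. The wedge of \<open>k\<close> vectors is nonzero iff they span a \<open>k\<close>-dimensional space.
\<close>

definition grassmann :: "nat \<Rightarrow> 'n::{finite,linorder} ext set" where
  "grassmann k = {p. p \<noteq> 0 \<and> (\<exists>as. length as = k \<and> p = wedge_list as)}"

section \<open>Matroids\<close>

text \<open>A matroid on \<open>E\<close> is represented by its rank function on the subsets of \<open>E\<close>.\<close>

definition linear_matroid :: "'e set \<Rightarrow> ('e \<Rightarrow> 'a::euclidean_space) \<Rightarrow> 'e set \<Rightarrow> nat" where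
  "linear_matroid E x = restrict (\<lambda>F. dim (span (x ` F))) (Pow E)"

text \<open>
  The points form a family indexed by \<open>E\<close>: if \<open>x e = x f\<close> with \<open>e \<noteq> f\<close>, removing \<open>x e\<close>
  from the family leaves \<open>x f\<close> in it.
\<close>

definition generic_position ::
    "'e set \<Rightarrow> ('e \<Rightarrow> 'a::euclidean_space set) \<Rightarrow> ('e \<Rightarrow> 'a) \<Rightarrow> bool" where
  "generic_position E A x \<longleftrightarrow>
     (\<forall>e\<in>E. x e \<in> A e \<and> x e \<noteq> 0) \<and>
     (\<forall>F e. F \<subseteq> E \<longrightarrow> e \<in> F \<longrightarrow> x e \<in> span (x ` (F - {e})) \<longrightarrow> A e \<subseteq> span (x ` (F - {e})))"

definition generic_matroid ::
    "'e set \<Rightarrow> ('e \<Rightarrow> 'a::euclidean_space set) \<Rightarrow> 'e set \<Rightarrow> nat" where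
  "generic_matroid E A = (THE \<rho>. \<exists>x. generic_position E A x \<and> \<rho> = linear_matroid E x)"

section \<open>Rods and bars\<close>

text \<open>
  The multigraph is a loop-free \<open>pre_digraph\<close>: the arc \<open>e\<close> is the undirected edge joining
  \<open>tail G e\<close> and \<open>head G e\<close>, its direction being an arbitrary choice of which end
  receives the sign \<open>-1\<close>. Elements of \<open>V\<^sub>V\<close> are vectors of blocks in the second exterior
  power. Configurations are families of representative vectors, with the value \<open>0\<close> at indices
  that are not rods (or not edges).
\<close>

definition edge_vector :: "('v, 'e) pre_digraph \<Rightarrow> 'e \<Rightarrow> 'n::finite ext \<Rightarrow> 'n ext ^ 'v::finite" where
  "edge_vector G e \<alpha> = (\<chi> w. if w = tail G e then \<alpha> else if w = head G e then - \<alpha> else 0)"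

definition bar_rod_matroid ::
    "('v::finite, 'e::finite) pre_digraph \<Rightarrow> 'n::finite ext ^ 'e \<Rightarrow> 'e set \<Rightarrow> nat" where
  "bar_rod_matroid G q = linear_matroid (arcs G) (\<lambda>e. edge_vector G e (q $ e))"

definition rod_hyperplane ::
    "'v::finite set \<Rightarrow> 'n::{finite,linorder} ext ^ 'v \<Rightarrow> 'v \<Rightarrow> 'n ext set" where
  "rod_hyperplane R r v =
     (if v \<in> R then {p \<in> ext_power 2. ext_dot p (r $ v) = 0} else ext_power 2)"

definition edge_flat ::
    "('v::finite, 'e) pre_digraph \<Rightarrow> 'v set \<Rightarrow> 'n::{finite,linorder} ext ^ 'v \<Rightarrow> 'e \<Rightarrow> ('n ext ^ 'v) set"
  where
  "edge_flat G R r e =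
     edge_vector G e ` (rod_hyperplane R r (tail G e) \<inter> rod_hyperplane R r (head G e))"

definition rod_configurations ::
    "nat \<Rightarrow> 'v::finite set \<Rightarrow> ('n::{finite,linorder} ext ^ 'v) set" where
  "rod_configurations d R =
     {r. (\<forall>v\<in>R. r $ v \<in> grassmann (d - 1)) \<and> (\<forall>v. v \<notin> R \<longrightarrow> r $ v = 0) \<and>
         (\<forall>u\<in>R. \<forall>v\<in>R. u \<noteq> v \<longrightarrow> span {r $ u} \<noteq> span {r $ v})}"

definition bar_configurations ::
    "('v::finite, 'e::finite) pre_digraph \<Rightarrow> 'v set \<Rightarrow> 'n::{finite,linorder} ext ^ 'v \<Rightarrow>
     ('n ext ^ 'e) set" where
  "bar_configurations G R r =
     {q. (\<forall>e\<in>arcs G. q $ e \<in> grassmann 2 \<and>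
                       (\<forall>v \<in> R \<inter> {tail G e, head G e}. ext_dot (q $ e) (r $ v) = 0)) \<and>
         (\<forall>e. e \<notin> arcs G \<longrightarrow> q $ e = 0)}"

section \<open>Almost all configurations\<close>

text \<open>
  Configuration spaces are real algebraic sets, so null sets are those of Hausdorff measure in the
  dimension of the space. The Hausdorff measure is taken without a normalising constant; the
  case distinction makes empty covering sets free of charge in dimension 0 too.
\<close>

definition hausdorff_delta :: "real \<Rightarrow> nat \<Rightarrow> 'a::metric_space set \<Rightarrow> ennreal" where
  "hausdorff_delta \<delta> s S =
     (INF U \<in> {U :: nat \<Rightarrow> 'a set. S \<subseteq> (\<Union>i. U i) \<and> (\<forall>i. bounded (U i) \<and> diameter (U i) \<le> \<delta>)}.
        \<Sum>i. if U i = {} then 0 else ennreal (diameter (U i) ^ s))"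

definition hausdorff_measure :: "nat \<Rightarrow> 'a::metric_space set \<Rightarrow> ennreal" where
  "hausdorff_measure s S = (SUP \<delta>\<in>{0<..}. hausdorff_delta \<delta> s S)"

definition almost_all :: "nat \<Rightarrow> 'a::metric_space set \<Rightarrow> ('a \<Rightarrow> bool) \<Rightarrow> bool" where
  "almost_all s S P \<longleftrightarrow> hausdorff_measure s {x \<in> S. \<not> P x} = 0"

text \<open>
  The dimensions below count representative vectors, hence one more per rod or bar than the
  dimension of the projective variety: \<open>dim Gr(d - 1, d + 1) = dim Gr(2, d + 1) = 2 (d - 1)\<close>,
  and each rod at \<open>e\<close> imposes one condition on the bar \<open>q\<^sub>e\<close> (independent
  conditions, as the rods are distinct). A set of projective configurations that is null in the
  product of the varieties corresponds to a null set of representatives and conversely.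
\<close>

definition rod_dim :: "nat \<Rightarrow> 'v set \<Rightarrow> nat" where
  "rod_dim d R = (\<Sum>v\<in>R. 2 * (d - 1) + 1)"

definition bar_dim :: "nat \<Rightarrow> ('v, 'e) pre_digraph \<Rightarrow> 'v set \<Rightarrow> nat" where
  "bar_dim d G R = (\<Sum>e\<in>arcs G. 2 * (d - 1) - card (R \<inter> {tail G e, head G e}) + 1)"

end

theory Submission
  imports Defs
begin

text \<open>
  If the vectors \<open>edge_vector G e (q\<^sub>e)\<close> are in generic position, the two matroids agree, since
  generic positions maximise all ranks. So the exceptional \<open>q\<close> satisfy, for some edge \<open>e\<close>, a linear
  equation on \<open>q\<^sub>e\<close> whose coefficients depend on the other bars, and which does not vanish on the
  whole flat \<open>H\<^sub>e\<close> of bars at \<open>e\<close>. A bar at \<open>e\<close> is \<open>x \<and> y\<close> where \<open>x\<close> (and \<open>y\<close>, if both ends are rods)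
  runs through a codimension 2 subspace of \<open>W\<close>. Normalising one coordinate of \<open>x\<close> (and of \<open>y\<close>) gives
  finitely many charts with as many parameters as the dimension requires. They are affine in \<open>x\<close> and
  in \<open>y\<close>, and the decomposable bars span \<open>H\<^sub>e\<close>, so each such equation holds on a Lebesgue null set of
  parameters. By Fubini the exceptional parameters form a null set, and its locally Lipschitz image is
  a null set of the Hausdorff measure in the dimension of the parameter space.

  The spanning property fails if two rods \<open>U, U'\<close> of codimension 2 meet in codimension 3 and \<open>d \<ge> 3\<close>:
  the lines meeting both then form two families. This happens iff the wedge of the dual 2-forms of the
  rods vanishes. Since the rods themselves are dual to decomposable 2-forms, the same argument with
  this linear equation shows that such rod-configurations are exceptional.
\<close>

section \<open>Null sets of the Hausdorff measure\<close>

text \<open>Two constraints shape the set-up. Fubini needs a Borel exceptional set, and a point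
  lying in a span that misses part of its flat is not visibly a Borel condition. Hence dependence is
  expressed by coefficient vectors on the unit sphere, which makes it closed, and a flat is tested
  only on a finite basis of bars: exceptional means that some subfamily is dependent but becomes
  independent when one bar is replaced by a basis element, a difference of two closed sets.
  Moreover, the number of parameters depends on how many ends of an edge are rods, while a product
  indexed by edges needs one parameter type. For \<open>d = 2\<close> the criterion by 4-forms is
  void, as a 3-dimensional space carries none. Rods are then points of a projective plane, and
  distinctness suffices, because a single line joins two of them.\<close>

lemma hausdorff_measure_eq_0D:
  fixes S :: "'a::metric_space set"
  assumes "hausdorff_measure s S = 0" "\<delta> > 0" "\<epsilon> > (0::real)"
  shows "\<exists>U::nat \<Rightarrow> 'a set. S \<subseteq> (\<Union>i. U i) \<and>
    (\<forall>i. bounded (U i) \<and> diameter (U i) \<le> \<delta>) \<and>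
    (\<Sum>i. if U i = {} then 0 else ennreal (diameter (U i) ^ s)) \<le> ennreal \<epsilon>"
proof -
  have "hausdorff_delta \<delta> s S \<le> hausdorff_measure s S"
    unfolding hausdorff_measure_def using \<open>\<delta> > 0\<close> by (intro SUP_upper) auto
  then have "hausdorff_delta \<delta> s S < ennreal \<epsilon>"
    using assms by simp
  then show ?thesis
    unfolding hausdorff_delta_def INF_less_iff by (auto dest!: less_imp_le)
qed

lemma hausdorff_measure_eq_0I:
  fixes S :: "'a::metric_space set"
  assumes "\<And>\<delta> \<epsilon>. \<delta> > 0 \<Longrightarrow> \<epsilon> > (0::real) \<Longrightarrow> \<exists>U::nat \<Rightarrow> 'a set. S \<subseteq> (\<Union>i. U i) \<and>
    (\<forall>i. bounded (U i) \<and> diameter (U i) \<le> \<delta>) \<and>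
    (\<Sum>i. if U i = {} then 0 else ennreal (diameter (U i) ^ s)) \<le> ennreal \<epsilon>"
  shows "hausdorff_measure s S = 0"
proof -
  have "hausdorff_delta \<delta> s S \<le> 0" if "\<delta> > 0" for \<delta>
  proof (rule ennreal_le_epsilon)
    fix e :: real assume "e > 0"
    with assms[OF \<open>\<delta> > 0\<close> this] obtain U :: "nat \<Rightarrow> 'a set" where U: "S \<subseteq> (\<Union>i. U i)"
      "\<forall>i. bounded (U i) \<and> diameter (U i) \<le> \<delta>"
      "(\<Sum>i. if U i = {} then 0 else ennreal (diameter (U i) ^ s)) \<le> ennreal e" by blast
    then have "hausdorff_delta \<delta> s S \<le> ennreal e"
      unfolding hausdorff_delta_def by (intro INF_lower2[of U]) auto
    then show "hausdorff_delta \<delta> s S \<le> 0 + ennreal e" by simp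
  qed
  then have "hausdorff_measure s S \<le> 0"
    unfolding hausdorff_measure_def by (intro SUP_least) auto
  then show ?thesis by simp
qed

lemma hausdorff_measure_eq_0_subset:
  assumes "hausdorff_measure s T = 0" "S \<subseteq> T"
  shows "hausdorff_measure s S = 0"
proof (rule hausdorff_measure_eq_0I)
  fix \<delta> \<epsilon> :: real assume *: "\<delta> > 0" "\<epsilon> > 0"
  from hausdorff_measure_eq_0D[OF assms(1) this] obtain U where
    "T \<subseteq> (\<Union>i. U i)" "\<forall>i. bounded (U i) \<and> diameter (U i) \<le> \<delta>"
    "(\<Sum>i. if U i = {} then 0 else ennreal (diameter (U i) ^ s)) \<le> \<epsilon>" by blast
  then show "\<exists>U. S \<subseteq> (\<Union>i. U i) \<and> (\<forall>i. bounded (U i) \<and> diameter (U i) \<le> \<delta>) \<and>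
    (\<Sum>i. if U i = {} then 0 else ennreal (diameter (U i) ^ s)) \<le> ennreal \<epsilon>"
    using assms(2) by (intro exI[of _ U]) auto
qed

lemma suminf_geometric_half: "(\<Sum>m. ennreal (\<epsilon> * (1/2) ^ Suc m)) = ennreal \<epsilon>" if "\<epsilon> \<ge> 0"
proof -
  have "(\<lambda>m. \<epsilon> * (1/2) ^ Suc m) sums (\<epsilon> * 1)"
    by (intro sums_mult power_half_series)
  then show ?thesis
    using that by (subst suminf_ennreal2) (auto simp: sums_iff)
qed

lemma hausdorff_measure_eq_0_UN:
  fixes S :: "nat \<Rightarrow> 'a::metric_space set"
  assumes "\<And>m. hausdorff_measure s (S m) = 0"
  shows "hausdorff_measure s (\<Union>m. S m) = 0"
proof (rule hausdorff_measure_eq_0I)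
  fix \<delta> \<epsilon> :: real assume *: "\<delta> > 0" "\<epsilon> > 0"
  have "\<exists>U. \<forall>m. S m \<subseteq> (\<Union>i. U m i) \<and> (\<forall>i. bounded (U m i) \<and> diameter (U m i) \<le> \<delta>) \<and>
    (\<Sum>i. if U m i = {} then 0 else ennreal (diameter (U m i) ^ s)) \<le> ennreal (\<epsilon> * (1/2) ^ Suc m)"
    using * by (intro choice allI hausdorff_measure_eq_0D assms) auto
  then obtain U where U: "\<And>m. S m \<subseteq> (\<Union>i. U m i)" "\<And>m i. bounded (U m i) \<and> diameter (U m i) \<le> \<delta>"
    "\<And>m. (\<Sum>i. if U m i = {} then 0 else ennreal (diameter (U m i) ^ s)) \<le> ennreal (\<epsilon> * (1/2) ^ Suc m)"
    by blast
  define f where "f = (\<lambda>(m, i). if U m i = {} then 0 else ennreal (diameter (U m i) ^ s))"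
  define V where "V j = (case prod_decode j of (m, i) \<Rightarrow> U m i)" for j
  have V: "V (prod_encode (m, i)) = U m i" for m i by (simp add: V_def)
  have "(\<Sum>j. if V j = {} then 0 else ennreal (diameter (V j) ^ s)) = (\<Sum>j. f (prod_decode j))"
    by (intro suminf_cong) (auto simp: f_def V_def split: prod.split)
  also have "\<dots> = (\<Sum>m. \<Sum>i. f (m, i))"
    by (rule suminf_ennreal_2dimen) simp
  also have "\<dots> \<le> (\<Sum>m. ennreal (\<epsilon> * (1/2) ^ Suc m))"
    using U(3) by (intro suminf_le) (auto simp: f_def)
  also have "\<dots> = ennreal \<epsilon>" using * by (intro suminf_geometric_half) auto
  finally have le: "(\<Sum>j. if V j = {} then 0 else ennreal (diameter (V j) ^ s)) \<le> ennreal \<epsilon>" .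
  have sub: "(\<Union>m. S m) \<subseteq> (\<Union>j. V j)"
  proof
    fix x assume "x \<in> (\<Union>m. S m)"
    then obtain m i where "x \<in> U m i" using U(1) by blast
    then show "x \<in> (\<Union>j. V j)" by (metis UN_I UNIV_I V)
  qed
  have "\<forall>i. bounded (V i) \<and> diameter (V i) \<le> \<delta>"
    using U(2) by (auto simp: V_def split: prod.split)
  then show "\<exists>U. (\<Union>m. S m) \<subseteq> (\<Union>i. U i) \<and> (\<forall>i. bounded (U i) \<and> diameter (U i) \<le> \<delta>) \<and>
    (\<Sum>i. if U i = {} then 0 else ennreal (diameter (U i) ^ s)) \<le> ennreal \<epsilon>"
    using le sub by blast
qed

lemma hausdorff_measure_empty: "hausdorff_measure s {} = 0"
  by (rule hausdorff_measure_eq_0I, rule exI[of _ "\<lambda>_. {}"]) auto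

lemma hausdorff_measure_eq_0_finite_UN:
  fixes S :: "'i \<Rightarrow> 'a::metric_space set"
  assumes "finite I" "\<And>i. i \<in> I \<Longrightarrow> hausdorff_measure s (S i) = 0"
  shows "hausdorff_measure s (\<Union>i\<in>I. S i) = 0"
proof (cases "I = {}")
  case True
  then show ?thesis by (simp add: hausdorff_measure_empty)
next
  case False
  have "(\<Union>i\<in>I. S i) = (\<Union>m. S (from_nat_into I m))"
    using range_from_nat_into[OF False countable_finite[OF assms(1)]]
    by (metis image_image)
  moreover have "hausdorff_measure s (S (from_nat_into I m)) = 0" for m
    using from_nat_into[OF False] assms(2) by blast
  ultimately show ?thesis using hausdorff_measure_eq_0_UN by metis
qed

text \<open>Outer regularity puts \<open>A\<close> into an open set \<open>T\<close> of measure
  below \<epsilon>. The dyadic cubes of \<open>covering_lemma\<close> stay inside \<open>T\<close>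
  and have disjoint interiors, so their volumes add up to at most that measure. Cubes rather than
  arbitrary boxes are needed because the volume has to control the diameter. The family may be
  finite, hence the index set \<open>J\<close>.\<close>

lemma negligible_cube_cover:
  fixes A :: "'a::euclidean_space set"
  assumes "negligible A" "A \<subseteq> cbox (- m *\<^sub>R One) (m *\<^sub>R One)" "m > 0" "\<eta> > 0" "\<epsilon> > 0"
  obtains J :: "nat set" and u v :: "nat \<Rightarrow> 'a" and s :: "nat \<Rightarrow> real"
  where "\<And>i b. i \<in> J \<Longrightarrow> b \<in> Basis \<Longrightarrow> (v i - u i) \<bullet> b = s i"
    "\<And>i. i \<in> J \<Longrightarrow> 0 \<le> s i \<and> s i \<le> \<eta>"
    "A \<subseteq> (\<Union>i\<in>J. cbox (u i) (v i))"
    "(\<Sum>i. if i \<in> J then ennreal (s i ^ DIM('a)) else 0) \<le> ennreal \<epsilon>"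
proof -
  have "A \<in> sets lebesgue" using assms(1) by (simp add: negligible_imp_sets)
  then obtain T where T: "open T" "A \<subseteq> T" "T - A \<in> lmeasurable"
    "emeasure lebesgue (T - A) < ennreal \<epsilon>"
    using \<open>\<epsilon> > 0\<close> by (rule sets_lebesgue_outer_open)
  have "emeasure lebesgue T = emeasure lebesgue (T - A)"
    using assms(1) lborelD[OF borel_open[OF T(1)]]
    by (intro emeasure_Diff_null_set[symmetric])
       (auto simp: negligible_iff_null_sets[symmetric])
  with T have emT: "emeasure lborel T < ennreal \<epsilon>" by simp
  \<comment> \<open>Each cube will lie in such a ball: being inside \<open>T\<close> keeps the total
    volume small, and a radius of at most \<open>\<eta> / 2\<close> keeps the side at most
    \<eta>.\<close>
  have "\<exists>r. (x \<in> T \<longrightarrow> ball x r \<subseteq> T) \<and> 0 < r \<and> r \<le> \<eta> / 2" for x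
  proof (cases "x \<in> T")
    case True
    then obtain r where "r > 0" "ball x r \<subseteq> T" using T(1) open_contains_ball by blast
    then show ?thesis using \<open>\<eta> > 0\<close> by (intro exI[of _ "min r (\<eta>/2)"]) auto
  qed (use \<open>\<eta> > 0\<close> in \<open>auto intro: exI[of _ "\<eta>/2"]\<close>)
  then obtain r where r: "\<And>x. x \<in> T \<Longrightarrow> ball x (r x) \<subseteq> T" "\<And>x. 0 < r x" "\<And>x. r x \<le> \<eta> / 2" by metis
  have ne: "box (- m *\<^sub>R One) (m *\<^sub>R One :: 'a) \<noteq> {}"
    using \<open>m > 0\<close> by (simp add: box_ne_empty)
  have g: "gauge (\<lambda>x. ball x (r x))" using r by (simp add: gauge_def)
  obtain D where D: "countable D" "\<And>K. K \<in> D \<Longrightarrow> interior K \<noteq> {} \<and> (\<exists>c d. K = cbox c d)"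
    "pairwise (\<lambda>A B. interior A \<inter> interior B = {}) D"
    "\<And>K. K \<in> D \<Longrightarrow> \<exists>x \<in> A \<inter> K. K \<subseteq> ball x (r x)"
    "\<And>u v. cbox u v \<in> D \<Longrightarrow> \<exists>n. \<forall>i \<in> Basis. v \<bullet> i - u \<bullet> i = (m *\<^sub>R One \<bullet> i - (- m *\<^sub>R One) \<bullet> i) / 2^n"
    "A \<subseteq> \<Union>D"
    using covering_lemma[OF assms(2) ne g] by metis
  define J where "J = to_nat_on D ` D"
  define K where "K = from_nat_into D"
  have KD: "K i \<in> D" if "i \<in> J" for i
    using that D(1) by (auto simp: J_def K_def)
  have "\<forall>i\<in>J. \<exists>c d. K i = cbox c d" using KD D(2) by blast
  then obtain u v where K: "\<And>i. i \<in> J \<Longrightarrow> K i = cbox (u i) (v i)" by metis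
  \<comment> \<open>The side lengths in \<open>D(5)\<close> are \<open>2 * m / 2 ^ n\<close> in
    every coordinate, so the boxes are cubes.\<close>
  have "\<forall>i\<in>J. \<exists>s. \<forall>b\<in>Basis. v i \<bullet> b - u i \<bullet> b = s"
  proof
    fix i assume "i \<in> J"
    then have "cbox (u i) (v i) \<in> D" using KD K by metis
    from D(5)[OF this] show "\<exists>s. \<forall>b\<in>Basis. v i \<bullet> b - u i \<bullet> b = s" by auto
  qed
  then obtain s where s: "\<And>i b. i \<in> J \<Longrightarrow> b \<in> Basis \<Longrightarrow> v i \<bullet> b - u i \<bullet> b = s i" by metis
  have pos: "0 < s i" if "i \<in> J" for i
  proof -
    have "box (u i) (v i) \<noteq> {}" using D(2)[OF KD[OF that]] K[OF that] by (simp add: interior_cbox)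
    moreover obtain b :: 'a where "b \<in> Basis" using nonempty_Basis by blast
    ultimately show ?thesis using s[OF that] by (force simp: box_ne_empty)
  qed
  have sub: "cbox (u i) (v i) \<subseteq> T" "s i \<le> \<eta>" if "i \<in> J" for i
  proof -
    from D(4)[OF KD[OF that]] K[OF that] obtain x where x: "x \<in> A" "cbox (u i) (v i) \<subseteq> ball x (r x)" by auto
    with r T show "cbox (u i) (v i) \<subseteq> T" by blast
    obtain b :: 'a where b: "b \<in> Basis" using nonempty_Basis by blast
    have "\<forall>b\<in>Basis. u i \<bullet> b \<le> v i \<bullet> b" using s[OF that] pos[OF that]
      by (metis diff_gt_0_iff_gt less_imp_le)
    then have "u i \<in> ball x (r x)" "v i \<in> ball x (r x)" using x(2) by (auto simp: subset_iff mem_box)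
    then have "dist (u i) (v i) < r x + r x"
      by (metis dist_triangle_less_add mem_ball dist_commute)
    moreover have "\<bar>(v i - u i) \<bullet> b\<bar> \<le> dist (u i) (v i)"
      using Basis_le_norm[OF b, of "v i - u i"] by (simp add: dist_norm norm_minus_commute)
    ultimately show "s i \<le> \<eta>" using r(3)[of x] s[OF that b] pos[OF that] by (simp add: inner_diff_left)
  qed
  \<comment> \<open>The closed cubes may share faces; the open ones are disjoint and have the same
    volume.\<close>
  define Q where "Q i = (if i \<in> J then box (u i) (v i) else {})" for i
  have "disjoint_family Q"
  proof (clarsimp simp: disjoint_family_on_def)
    fix i j :: nat assume "i \<noteq> j"
    show "Q i \<inter> Q j = {}"
    proof (cases "i \<in> J \<and> j \<in> J")
      case True
      then have "K i \<noteq> K j" using \<open>i \<noteq> j\<close> D(1) by (auto simp: K_def J_def)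
      then have "interior (K i) \<inter> interior (K j) = {}"
        using D(3) KD True by (auto simp: pairwise_def)
      then show ?thesis using True K by (auto simp: Q_def interior_cbox)
    qed (auto simp: Q_def)
  qed
  moreover have "Q i \<in> sets lborel" for i by (simp add: Q_def)
  ultimately have "(\<Sum>i. emeasure lborel (Q i)) = emeasure lborel (\<Union>i. Q i)"
    by (intro suminf_emeasure) auto
  also have "\<dots> \<le> emeasure lborel T"
    using sub T(1) by (intro emeasure_mono) (fastforce simp: Q_def dest: box_subset_cbox[THEN subsetD] split: if_splits)+
  finally have *: "(\<Sum>i. emeasure lborel (Q i)) \<le> ennreal \<epsilon>" using emT by simp
  have "emeasure lborel (Q i) = (if i \<in> J then ennreal (s i ^ DIM('a)) else 0)" for i
  proof (cases "i \<in> J")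
    case True
    then have "\<forall>b\<in>Basis. u i \<bullet> b \<le> v i \<bullet> b" using s[OF True] pos[OF True]
      by (metis diff_gt_0_iff_gt less_imp_le)
    then show ?thesis using s[OF True] True by (simp add: Q_def emeasure_lborel_box_eq inner_diff_left)
  qed (simp add: Q_def)
  with * have "(\<Sum>i. if i \<in> J then ennreal (s i ^ DIM('a)) else 0) \<le> ennreal \<epsilon>" by simp
  moreover have "A \<subseteq> (\<Union>i\<in>J. cbox (u i) (v i))"
  proof
    fix x assume "x \<in> A"
    then obtain C where "C \<in> D" "x \<in> C" using D(6) by blast
    then have "to_nat_on D C \<in> J" "K (to_nat_on D C) = C" using D(1) by (auto simp: J_def K_def)
    with \<open>x \<in> C\<close> K show "x \<in> (\<Union>i\<in>J. cbox (u i) (v i))" by blast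
  qed
  ultimately show ?thesis
    using that[of J v u s] s pos sub by (auto simp: inner_diff_left less_imp_le)
qed

text \<open>The charts are quadratic in their parameters, hence not globally Lipschitz, but a
  constant for each bounded set is enough since null sets are treated box by box.\<close>

definition lipschitz_on_bounded :: "('a::metric_space \<Rightarrow> 'b::metric_space) \<Rightarrow> bool" where
  "lipschitz_on_bounded f \<longleftrightarrow> (\<forall>S. bounded S \<longrightarrow> (\<exists>L. L-lipschitz_on S f))"

text \<open>
  The cubes covering \<open>A\<close> have dimension \<open>DIM('a)\<close>, not \<open>card I\<close>. Averaging over the irrelevant
  coordinates yields one value of these for which the sides of the cubes that are hit have a small
  sum of \<open>card I\<close>-th powers.
\<close>

lemma hausdorff_measure_image_cylinder_bounded:
  fixes f :: "'a::euclidean_space \<Rightarrow> 'b::metric_space"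
  assumes "lipschitz_on_bounded f" "I \<subseteq> Basis" "negligible A"
    and cyl: "\<And>x y. (\<forall>b\<in>I. x \<bullet> b = y \<bullet> b) \<Longrightarrow> f x = f y \<and> (x \<in> A \<longleftrightarrow> y \<in> A)"
    and m: "m > 0"
  shows "hausdorff_measure (card I) (f ` (A \<inter> cbox (- m *\<^sub>R One) (m *\<^sub>R One))) = 0"
proof (rule hausdorff_measure_eq_0I)
  fix \<delta> \<epsilon> :: real assume "\<delta> > 0" "\<epsilon> > 0"
  let ?M = "DIM('a)" and ?n = "card I"
  define Y where "Y = cbox (- m *\<^sub>R One) (m *\<^sub>R One :: 'a)"
  have finI: "finite I" using assms(2) finite_subset finite_Basis by blast
  obtain L0 where "L0-lipschitz_on Y f"
    using assms(1) bounded_cbox unfolding lipschitz_on_bounded_def Y_def by blast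
  \<comment> \<open>The factor \<open>DIM('a)\<close> compares distances within a cube with its side
    via the l1 norm; the maximum with 1 keeps \<open>L\<close> positive, so that one can divide by
    it.\<close>
  define L where "L = max L0 1 * real ?M"
  have M: "real ?M \<ge> 1" using DIM_ge_Suc0[where 'a='a] by linarith
  then have L: "L > 0" by (auto simp: L_def)
  define c where "c = \<epsilon> / L ^ ?n"
  have c: "c > 0" using L \<open>\<epsilon> > 0\<close> by (simp add: c_def)
  \<comment> \<open>Chosen so that the integral over \<open>y\<close> of the cost of the cubes
    selected by \<open>y\<close> is at most half of \<open>c\<close> times the volume of
    \<open>Y\<close>. Hence some \<open>y\<close> in \<open>Y\<close> has cost at most
    \<open>c\<close>.\<close>
  define \<epsilon>' where "\<epsilon>' = c * (2 * m) ^ ?M / (2 * (2 * m) ^ ?n)"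
  have e': "\<epsilon>' > 0" using c m by (simp add: \<epsilon>'_def)
  obtain J u v s where *: "\<And>i b. i \<in> J \<Longrightarrow> b \<in> Basis \<Longrightarrow> (v i - u i) \<bullet> b = s i"
    "\<And>i. i \<in> J \<Longrightarrow> 0 \<le> s i \<and> s i \<le> \<delta> / L"
    "A \<inter> Y \<subseteq> (\<Union>i\<in>J. cbox (u i) (v i))"
    "(\<Sum>i. if i \<in> J then ennreal (s i ^ ?M) else 0) \<le> ennreal \<epsilon>'"
  proof (rule negligible_cube_cover[of "A \<inter> Y" m "\<delta> / L" \<epsilon>'])
    show "negligible (A \<inter> Y)" using assms(3) by (simp add: negligible_Int)
  qed (use m L \<open>\<delta> > 0\<close> e' in \<open>auto simp: Y_def\<close>)
  \<comment> \<open>\<open>C i\<close> consists of the \<open>y\<close> whose coordinates outside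
    \<open>I\<close> are those of a point of cube \<open>i\<close>; the coordinates in
    \<open>I\<close> range over the box, which keeps the volume finite. The weight
    \<open>s i ^ card I\<close> turns the volume of \<open>C i\<close> into a fixed multiple of the
    volume of the cube.\<close>
  define C where "C i = cbox (\<Sum>b\<in>Basis. (if b \<in> I then - m else u i \<bullet> b) *\<^sub>R b)
     (\<Sum>b\<in>Basis. (if b \<in> I then m else v i \<bullet> b) *\<^sub>R b)" for i
  define g where "g i y = (if i \<in> J then indicator (C i) y * ennreal (s i ^ ?n) else 0)" for i y
  have emC: "emeasure lborel (C i) = ennreal ((2 * m) ^ ?n * s i ^ (?M - ?n))" if "i \<in> J" for i
  proof -
    have "emeasure lborel (C i) = ennreal (\<Prod>b\<in>Basis. (if b \<in> I then 2 * m else s i))"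
      unfolding C_def emeasure_lborel_cbox_eq using *(1,2)[OF that] m
      by (auto simp: inner_diff_left intro!: arg_cong[where f=ennreal] prod.cong)
         (smt (verit, best))
    also have "(\<Prod>b\<in>Basis. (if b \<in> I then 2 * m else s i)) = (2 * m) ^ ?n * s i ^ (?M - ?n)"
      using assms(2) finI by (subst prod.If_cases) (auto simp: Int_absorb1 card_Diff_subset Diff_eq[symmetric])
    finally show ?thesis .
  qed
  have [measurable]: "C i \<in> sets borel" for i by (simp add: C_def)
  have nM: "?n \<le> ?M" using assms(2) by (intro card_mono) auto
  have "(\<integral>\<^sup>+y. (\<Sum>i. g i y) \<partial>lborel) = (\<Sum>i. \<integral>\<^sup>+y. g i y \<partial>lborel)"
    by (rule nn_integral_suminf) (simp add: g_def C_def)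
  also have "\<dots> = (\<Sum>i. ennreal ((2 * m) ^ ?n) * (if i \<in> J then ennreal (s i ^ ?M) else 0))"
  proof (intro suminf_cong)
    fix i
    show "(\<integral>\<^sup>+y. g i y \<partial>lborel) = ennreal ((2 * m) ^ ?n) * (if i \<in> J then ennreal (s i ^ ?M) else 0)"
    proof (cases "i \<in> J")
      case True
      have "(\<integral>\<^sup>+y. g i y \<partial>lborel) = emeasure lborel (C i) * ennreal (s i ^ ?n)"
        using True by (simp add: g_def nn_integral_multc C_def)
      also have "\<dots> = ennreal ((2 * m) ^ ?n * s i ^ (?M - ?n) * s i ^ ?n)"
        using emC[OF True] *(2)[OF True] m by (simp add: ennreal_mult)
      also have "\<dots> = ennreal ((2 * m) ^ ?n) * ennreal (s i ^ ?M)"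
        using *(2)[OF True] m nM by (simp add: ennreal_mult[symmetric] mult.assoc power_add[symmetric])
      finally show ?thesis using True by simp
    qed (simp add: g_def)
  qed
  also have "\<dots> = ennreal ((2 * m) ^ ?n) * (\<Sum>i. if i \<in> J then ennreal (s i ^ ?M) else 0)"
    by (rule ennreal_suminf_cmult)
  also have "\<dots> \<le> ennreal ((2 * m) ^ ?n) * ennreal \<epsilon>'"
    by (intro mult_left_mono *) auto
  also have "\<dots> = ennreal (c * (2 * m) ^ ?M / 2)"
    using m e' by (simp add: ennreal_mult[symmetric] \<epsilon>'_def)
  also have "\<dots> < ennreal (c * (2 * m) ^ ?M)"
    using m c by (intro ennreal_lessI) auto
  finally have int: "(\<integral>\<^sup>+y. (\<Sum>i. g i y) \<partial>lborel) < ennreal (c * (2 * m) ^ ?M)" .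
  obtain y where y: "y \<in> Y" "(\<Sum>i. g i y) \<le> ennreal c"
  proof (rule ccontr)
    assume "\<not> thesis"
    with that have big: "\<And>y. y \<in> Y \<Longrightarrow> (\<Sum>i. g i y) \<ge> ennreal c" by force
    have "emeasure lborel Y = ennreal ((2 * m) ^ ?M)"
      using m by (simp add: Y_def emeasure_lborel_cbox_eq inner_simps flip: mult_2)
    then have "ennreal (c * (2 * m) ^ ?M) = ennreal c * emeasure lborel Y"
      using c m by (simp add: ennreal_mult)
    also have "\<dots> = (\<integral>\<^sup>+y. ennreal c * indicator Y y \<partial>lborel)"
      by (subst nn_integral_cmult_indicator) (auto simp: Y_def)
    also have "\<dots> \<le> (\<integral>\<^sup>+y. (\<Sum>i. g i y) \<partial>lborel)"
      using big by (intro nn_integral_mono) (auto simp: indicator_def)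
    finally show False using int by simp
  qed
  define U where "U i = (if i \<in> J \<and> y \<in> C i then f ` (cbox (u i) (v i) \<inter> Y) else {})" for i
  have lip: "dist (f p) (f q) \<le> L * s i" if i: "i \<in> J" and pq: "p \<in> cbox (u i) (v i) \<inter> Y" "q \<in> cbox (u i) (v i) \<inter> Y" for i p q
  proof -
    have "dist (f p) (f q) \<le> L0 * dist p q"
      using \<open>L0-lipschitz_on Y f\<close> pq by (auto dest: lipschitz_onD)
    also have "\<dots> \<le> max L0 1 * dist p q" by (intro mult_right_mono) auto
    finally have 1: "dist (f p) (f q) \<le> max L0 1 * dist p q" .
    have "dist p q \<le> (\<Sum>b\<in>Basis. \<bar>(p - q) \<bullet> b\<bar>)" unfolding dist_norm by (rule norm_le_l1)
    also have "\<dots> \<le> (\<Sum>b\<in>(Basis::'a set). s i)"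
    proof (intro sum_mono)
      fix b :: 'a assume b: "b \<in> Basis"
      then have "u i \<bullet> b \<le> p \<bullet> b" "p \<bullet> b \<le> v i \<bullet> b" "u i \<bullet> b \<le> q \<bullet> b" "q \<bullet> b \<le> v i \<bullet> b"
        using pq by (auto simp: mem_box)
      then show "\<bar>(p - q) \<bullet> b\<bar> \<le> s i" using *(1)[OF i b] by (simp add: inner_diff_left)
    qed
    finally have "max L0 1 * dist p q \<le> max L0 1 * (real ?M * s i)" by (intro mult_left_mono) auto
    with 1 show ?thesis by (simp add: L_def mult.assoc)
  qed
  have dU: "diameter (U i) \<le> L * s i \<and> bounded (U i)" if "i \<in> J" for i
  proof
    have bd: "\<forall>x\<in>U i. \<forall>y\<in>U i. dist x y \<le> L * s i" using lip[OF that] by (auto simp: U_def)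
    show "diameter (U i) \<le> L * s i"
    proof (cases "U i = {}")
      case False
      then show ?thesis unfolding diameter_def using bd by (auto intro!: cSUP_least)
    qed (use L *(2)[OF that] in simp)
    show "bounded (U i)" using bd unfolding bounded_two_points by blast
  qed
  have "(\<Sum>i. if U i = {} then 0 else ennreal (diameter (U i) ^ ?n)) \<le> (\<Sum>i. ennreal (L ^ ?n) * g i y)"
  proof (intro suminf_le)
    fix i
    show "(if U i = {} then 0 else ennreal (diameter (U i) ^ ?n)) \<le> ennreal (L ^ ?n) * g i y"
    proof (cases "i \<in> J \<and> y \<in> C i")
      case True
      then have "diameter (U i) ^ ?n \<le> (L * s i) ^ ?n"
        using dU[of i] diameter_ge_0[of "U i"] by (intro power_mono) auto
      then show ?thesis using True L *(2)[of i]
        by (auto simp: g_def power_mult_distrib ennreal_mult[symmetric])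
    qed (auto simp: U_def)
  qed auto
  also have "\<dots> = ennreal (L ^ ?n) * (\<Sum>i. g i y)" by (rule ennreal_suminf_cmult)
  also have "\<dots> \<le> ennreal (L ^ ?n) * ennreal c" by (intro mult_left_mono y) auto
  also have "\<dots> = ennreal \<epsilon>" using L c by (simp add: ennreal_mult[symmetric] c_def)
  finally have le: "(\<Sum>i. if U i = {} then 0 else ennreal (diameter (U i) ^ ?n)) \<le> ennreal \<epsilon>" .
  have "bounded (U i) \<and> diameter (U i) \<le> \<delta>" for i
  proof (cases "i \<in> J")
    case True
    then have "L * s i \<le> \<delta>" using *(2)[OF True] L by (simp add: field_simps)
    then show ?thesis using dU[OF True] by auto
  qed (use \<open>\<delta> > 0\<close> in \<open>auto simp: U_def\<close>)
  moreover have "f ` (A \<inter> Y) \<subseteq> (\<Union>i. U i)"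
  proof clarify
    fix x assume x: "x \<in> A" "x \<in> Y"
    \<comment> \<open>Outside \<open>I\<close> the coordinates of \<open>x\<close> may be exchanged
      for those of \<open>y\<close>. This changes neither \<open>f x\<close> nor membership in
      \<open>A\<close>, and a cube containing \<open>z\<close> is one that \<open>y\<close>
      selects.\<close>
    define z where "z = (\<Sum>b\<in>Basis. (if b \<in> I then x \<bullet> b else y \<bullet> b) *\<^sub>R b)"
    have zb: "z \<bullet> b = (if b \<in> I then x \<bullet> b else y \<bullet> b)" if "b \<in> Basis" for b
      using that by (simp add: z_def)
    then have "\<forall>b\<in>I. z \<bullet> b = x \<bullet> b" using assms(2) by auto
    from cyl[OF this] x have z: "z \<in> A" "f x = f z" by auto
    have zY: "z \<in> Y" using x y(1) by (auto simp: Y_def mem_box zb)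
    with z *(3) obtain i where i: "i \<in> J" "z \<in> cbox (u i) (v i)" by blast
    have "y \<in> C i" using i(2) y(1) by (auto simp: C_def mem_box zb Y_def)
    then show "f x \<in> (\<Union>i. U i)" using i z zY by (auto simp: U_def)
  qed
  ultimately show "\<exists>U. f ` (A \<inter> cbox (- m *\<^sub>R One) (m *\<^sub>R One)) \<subseteq> (\<Union>i. U i) \<and>
       (\<forall>i. bounded (U i) \<and> diameter (U i) \<le> \<delta>) \<and>
       (\<Sum>i. if U i = {} then 0 else ennreal (diameter (U i) ^ ?n)) \<le> ennreal \<epsilon>"
    using le unfolding Y_def by blast
qed

lemma hausdorff_measure_image_cylinder:
  fixes f :: "'a::euclidean_space \<Rightarrow> 'b::metric_space"
  assumes "lipschitz_on_bounded f" "I \<subseteq> Basis" "negligible A"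
    and cyl: "\<And>x y. (\<forall>b\<in>I. x \<bullet> b = y \<bullet> b) \<Longrightarrow> f x = f y \<and> (x \<in> A \<longleftrightarrow> y \<in> A)"
  shows "hausdorff_measure (card I) (f ` A) = 0"
proof (rule hausdorff_measure_eq_0_subset)
  let ?Y = "\<lambda>k. cbox (- real (Suc k) *\<^sub>R One) (real (Suc k) *\<^sub>R One :: 'a)"
  show "hausdorff_measure (card I) (\<Union>k. f ` (A \<inter> ?Y k)) = 0"
    by (intro hausdorff_measure_eq_0_UN hausdorff_measure_image_cylinder_bounded assms(1-3)) (use cyl in auto)
  show "f ` A \<subseteq> (\<Union>k. f ` (A \<inter> ?Y k))"
  proof clarify
    fix x assume x: "x \<in> A"
    obtain k where k: "norm x \<le> real k" using real_arch_simple by blast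
    have "x \<in> ?Y k" unfolding mem_box
    proof
      fix b :: 'a assume "b \<in> Basis"
      then show "(- real (Suc k) *\<^sub>R One) \<bullet> b \<le> x \<bullet> b \<and> x \<bullet> b \<le> (real (Suc k) *\<^sub>R One) \<bullet> b"
        using Basis_le_norm[of b x] k by (auto simp: inner_simps)
    qed
    with x show "f x \<in> (\<Union>k. f ` (A \<inter> ?Y k))" by blast
  qed
qed

section \<open>Slicing Borel sets along translates\<close>

lemma negligible_borel_iff: "S \<in> sets borel \<Longrightarrow> negligible S \<longleftrightarrow> emeasure lborel S = 0"
  by (subst negligible_iff_emeasure0) auto

text \<open>
  Fubini in a form that needs no product decomposition: average over the translates \<open>x + g z\<close>.
\<close>

lemma negligible_by_translates:
  fixes T :: "'a::euclidean_space set" and g :: "'b::euclidean_space \<Rightarrow> 'a"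
  assumes T: "T \<in> sets borel" and g: "g \<in> borel_measurable borel"
    and null: "\<And>x. negligible {z. x + g z \<in> T}"
  shows "negligible T"
proof -
  have [measurable]: "T \<in> sets borel" "g \<in> borel_measurable borel" by fact+
  let ?h = "\<lambda>x z. indicator T (x + g z) :: ennreal"
  have shift: "(\<integral>\<^sup>+x. ?h x z \<partial>lborel) = emeasure lborel T" for z
  proof -
    have "(\<integral>\<^sup>+x. ?h x z \<partial>lborel) = (\<integral>\<^sup>+x. indicator T (g z + x) \<partial>lborel)"
      by (simp add: add.commute)
    also have "\<dots> = (\<integral>\<^sup>+x. indicator T x \<partial>distr lborel borel ((+) (g z)))"
      by (subst nn_integral_distr) auto
    also have "\<dots> = emeasure lborel T" by (simp add: lborel_distr_plus)
    finally show ?thesis .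
  qed
  have "(\<integral>\<^sup>+z. \<integral>\<^sup>+x. ?h x z \<partial>lborel \<partial>(lborel::'b measure)) = (\<integral>\<^sup>+x. \<integral>\<^sup>+z. ?h x z \<partial>lborel \<partial>lborel)"
    by (rule lborel_pair.Fubini') measurable
  also have "\<dots> = (\<integral>\<^sup>+x. 0 \<partial>(lborel::'a measure))"
  proof (intro nn_integral_cong)
    fix x
    have [measurable]: "{z. x + g z \<in> T} \<in> sets borel" by measurable
    then have "emeasure lborel {z. x + g z \<in> T} = 0"
      using null[of x] by (simp add: negligible_borel_iff)
    moreover have "(\<integral>\<^sup>+z. ?h x z \<partial>lborel) = emeasure lborel {z. x + g z \<in> T}"
    proof -
      have "?h x = indicator {z. x + g z \<in> T}" by (auto simp: indicator_def)
      then show ?thesis by simp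
    qed
    ultimately show "(\<integral>\<^sup>+z. ?h x z \<partial>lborel) = 0" by simp
  qed
  \<comment> \<open>Integrating over \<open>x\<close> first gives the measure of \<open>T\<close>
    for each \<open>z\<close>, so the double integral is this measure times the infinite volume of
    the space of \<open>z\<close>.\<close>
  finally have "emeasure lborel T * emeasure lborel (UNIV :: 'b set) = 0"
    by (simp add: shift)
  then have "emeasure lborel T = 0"
    by (simp add: emeasure_lborel_UNIV)
  then show ?thesis by (simp add: negligible_borel_iff)
qed

section \<open>Exterior algebra\<close>

lemma shuffle_sign_Un_right:
  fixes I J M :: "'n::{finite,linorder} set"
  assumes "J \<inter> M = {}"
  shows "shuffle_sign I (J \<union> M) = shuffle_sign I J * shuffle_sign I M"
proof -
  have "{(i, j). i \<in> I \<and> j \<in> J \<union> M \<and> j < i} =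
    {(i, j). i \<in> I \<and> j \<in> J \<and> j < i} \<union> {(i, j). i \<in> I \<and> j \<in> M \<and> j < i}" by auto
  moreover have "{(i, j). i \<in> I \<and> j \<in> J \<and> j < i} \<inter> {(i, j). i \<in> I \<and> j \<in> M \<and> j < i} = {}"
    using assms by auto
  ultimately show ?thesis
    by (simp add: shuffle_sign_def card_Un_disjoint power_add)
qed

lemma shuffle_sign_Un_left:
  fixes I J M :: "'n::{finite,linorder} set"
  assumes "I \<inter> J = {}"
  shows "shuffle_sign (I \<union> J) M = shuffle_sign I M * shuffle_sign J M"
proof -
  have "{(i, j). i \<in> I \<union> J \<and> j \<in> M \<and> j < i} =
    {(i, j). i \<in> I \<and> j \<in> M \<and> j < i} \<union> {(i, j). i \<in> J \<and> j \<in> M \<and> j < i}" by auto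
  moreover have "{(i, j). i \<in> I \<and> j \<in> M \<and> j < i} \<inter> {(i, j). i \<in> J \<and> j \<in> M \<and> j < i} = {}"
    using assms by auto
  ultimately show ?thesis
    by (simp add: shuffle_sign_def card_Un_disjoint power_add)
qed

lemma shuffle_sign_square: "shuffle_sign I J * shuffle_sign I J = 1"
  by (simp add: shuffle_sign_def power_mult_distrib[symmetric])

lemma shuffle_sign_nonzero: "shuffle_sign I J \<noteq> 0"
  by (simp add: shuffle_sign_def)

lemma shuffle_sign_empty [simp]: "shuffle_sign {} J = 1" "shuffle_sign I {} = 1"
  by (simp_all add: shuffle_sign_def)

lemma shuffle_sign_singletons:
  "shuffle_sign {i} {j} = (if j < i then -1 else 1)"
proof -
  have "{(a, b). a \<in> {i} \<and> b \<in> {j} \<and> b < a} = (if j < i then {(i, j)} else {})" by auto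
  then show ?thesis unfolding shuffle_sign_def by simp
qed

text \<open>Both sides sum over the ordered partitions of \<open>K\<close> into \<open>I\<close>,
  \<open>J\<close> and a remainder \<open>M\<close>; on the left they are reached through
  \<open>P = I \<union> J\<close>. The signs agree because the inversions of a threefold
  concatenation are those of its three pairs of blocks.\<close>

lemma wedge_assoc: "wedge (wedge x y) z = wedge x (wedge y z)"
proof (rule vec_eq_iff[THEN iffD2, OF allI])
  fix K
  let ?t = "\<lambda>I J. shuffle_sign I (K - I) * shuffle_sign J (K - I - J) * x $ I * y $ J * z $ (K - I - J)"
  have "wedge (wedge x y) z $ K = (\<Sum>P\<in>Pow K. \<Sum>I\<in>Pow P.
      shuffle_sign P (K - P) * shuffle_sign I (P - I) * x $ I * y $ (P - I) * z $ (K - P))"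
    by (simp add: wedge_def sum_distrib_left sum_distrib_right mult.assoc)
  also have "\<dots> = (\<Sum>(P, I)\<in>Sigma (Pow K) Pow.
      shuffle_sign P (K - P) * shuffle_sign I (P - I) * x $ I * y $ (P - I) * z $ (K - P))"
    by (rule sum.Sigma) auto
  also have "\<dots> = (\<Sum>(I, J)\<in>Sigma (Pow K) (\<lambda>I. Pow (K - I)). ?t I J)"
  proof (rule sum.reindex_bij_witness[of _ "\<lambda>(I, J). (I \<union> J, I)" "\<lambda>(P, I). (I, P - I)"], goal_cases)
    case (5 a)
    obtain P I where a: "a = (P, I)" "I \<subseteq> P" "P \<subseteq> K" using 5 by auto
    define J where "J = P - I"
    define M where "M = K - P"
    have *: "P = I \<union> J" "K - I = J \<union> M" "I \<inter> J = {}" "J \<inter> M = {}" "K - I - J = M"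
      using a by (auto simp: J_def M_def)
    have "shuffle_sign P M = shuffle_sign I M * shuffle_sign J M"
      unfolding *(1) by (rule shuffle_sign_Un_left[OF *(3)])
    moreover have "shuffle_sign I (K - I) = shuffle_sign I J * shuffle_sign I M"
      unfolding *(2) by (rule shuffle_sign_Un_right[OF *(4)])
    ultimately show ?case using *(5) by (simp add: a J_def[symmetric] M_def[symmetric])
  qed auto
  also have "\<dots> = (\<Sum>I\<in>Pow K. \<Sum>J\<in>Pow (K - I). ?t I J)"
    by (rule sum.Sigma[symmetric]) auto
  also have "\<dots> = wedge x (wedge y z) $ K"
    by (simp add: wedge_def sum_distrib_left sum_distrib_right mult.assoc mult.left_commute)
  finally show "wedge (wedge x y) z $ K = wedge x (wedge y z) $ K" .
qed

lemma bilinear_wedge: "bilinear wedge"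
  unfolding bilinear_def
  by (auto intro!: linearI simp: wedge_def vec_eq_iff sum.distrib[symmetric] sum_distrib_left algebra_simps)

lemma linear_ext_of_vec: "linear ext_of_vec"
  unfolding ext_of_vec_def
  by (intro linearI) (simp_all add: sum.distrib scaleR_add_left scaleR_sum_right)

lemma ext_of_vec_nth: "ext_of_vec a $ {i} = a $ i"
  unfolding ext_of_vec_def by (simp add: axis_def if_distrib[where f="\<lambda>x. _ * x"] cong: if_cong)

lemma ext_of_vec_nth_0: "card K \<noteq> 1 \<Longrightarrow> ext_of_vec a $ K = 0"
  unfolding ext_of_vec_def by (auto simp: axis_def intro!: sum.neutral)

lemma ext_power_wedge:
  assumes "x \<in> ext_power j" "y \<in> ext_power k"
  shows "wedge x y \<in> ext_power (j + k)"
  unfolding ext_power_def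
proof clarify
  fix K :: "'a set" assume K: "card K \<noteq> j + k"
  have "shuffle_sign I (K - I) * x $ I * y $ (K - I) = 0" if "I \<subseteq> K" for I
  proof (cases "card I = j")
    case True
    then have "card (K - I) \<noteq> k" using that K card_mono[OF _ that]
      by (simp add: card_Diff_subset finite_subset[OF that])
    then show ?thesis using assms(2) by (simp add: ext_power_def)
  qed (use assms(1) in \<open>simp add: ext_power_def\<close>)
  then show "wedge x y $ K = 0" by (auto simp: wedge_def intro!: sum.neutral)
qed

lemma subspace_ext_power: "subspace (ext_power k)"
  by (auto simp: subspace_def ext_power_def)

lemma ext_of_vec_in_ext_power: "ext_of_vec a \<in> ext_power 1"
  by (simp add: ext_power_def ext_of_vec_nth_0)

lemma wedge_list_in_ext_power: "wedge_list as \<in> ext_power (length as)"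
proof (induction as)
  case Nil
  then show ?case by (auto simp: wedge_list_def ext_power_def axis_def)
next
  case (Cons a as)
  then show ?case
    using ext_power_wedge[OF ext_of_vec_in_ext_power Cons] by (simp add: wedge_list_def)
qed

lemma wedge_one_right: "wedge x (axis {} 1) = x"
proof (rule vec_eq_iff[THEN iffD2, OF allI])
  fix K
  have "wedge x (axis {} 1) $ K = (\<Sum>I\<in>Pow K. if I = K then x $ K else 0)"
    unfolding wedge_def vec_lambda_beta
  proof (intro sum.cong refl)
    fix I assume "I \<in> Pow K"
    then have "K - I = {} \<longleftrightarrow> I = K" by auto
    then show "shuffle_sign I (K - I) * x $ I * axis {} 1 $ (K - I) = (if I = K then x $ K else 0)"
      by (auto simp: axis_def)
  qed
  also have "\<dots> = x $ K" by simp
  finally show "wedge x (axis {} 1) $ K = x $ K" .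
qed

section \<open>Bivectors and vanishing products\<close>

definition bivec ::
    "real ^ ('n::{finite,linorder}) \<Rightarrow> real ^ ('n::{finite,linorder}) \<Rightarrow> 'n ext" where
  "bivec x y = wedge (ext_of_vec x) (ext_of_vec y)"

lemma wedge_list_pair: "wedge_list [x, y] = bivec x y"
  by (simp add: wedge_list_def bivec_def wedge_one_right)

lemma wedge_list_Cons: "wedge_list (a # as) = wedge (ext_of_vec a) (wedge_list as)"
  by (simp add: wedge_list_def)

lemma bivec_in_ext_power: "bivec x y \<in> ext_power 2"
  using wedge_list_in_ext_power[of "[x, y]"] by (simp add: wedge_list_pair numeral_2_eq_2)

text \<open>The Pluecker coordinates of a line. Only the splittings of \<open>{i, j}\<close> into
  singletons contribute, and the second of them carries one inversion.\<close>

lemma bivec_nth: "i < j \<Longrightarrow> bivec x y $ {i, j} = x $ i * y $ j - x $ j * y $ i"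
proof -
  assume "i < j"
  then have "i \<noteq> j" by simp
  have P: "Pow {i, j} = {{}, {i}, {j}, {i, j}}" by auto
  have D: "{i, j} - {i} = {j}" "{i, j} - {j} = {i}" using \<open>i \<noteq> j\<close> by auto
  have "bivec x y $ {i, j} = (\<Sum>I\<in>{{}, {i}, {j}, {i, j}}.
      shuffle_sign I ({i, j} - I) * ext_of_vec x $ I * ext_of_vec y $ ({i, j} - I))"
    by (simp add: bivec_def wedge_def P)
  also have "\<dots> = x $ i * y $ j - x $ j * y $ i"
    using \<open>i < j\<close> \<open>i \<noteq> j\<close> D
    by (simp add: ext_of_vec_nth ext_of_vec_nth_0 shuffle_sign_singletons doubleton_eq_iff)
  finally show ?thesis .
qed

lemma card_2_less:
  fixes K :: "'n::linorder set"
  assumes "card K = 2"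
  obtains i j where "i < j" "K = {i, j}"
proof -
  obtain i j where "K = {i, j}" "i \<noteq> j" using assms by (auto simp: card_2_iff)
  then show ?thesis using that[of i j] that[of j i] by (cases "i < j") (auto simp: insert_commute)
qed

lemma ext_power_2_eqI:
  fixes p q :: "'n::{finite,linorder} ext"
  assumes "p \<in> ext_power 2" "q \<in> ext_power 2" "\<And>i j. i < j \<Longrightarrow> p $ {i, j} = q $ {i, j}"
  shows "p = q"
proof (rule vec_eq_iff[THEN iffD2, OF allI])
  fix K :: "'n set"
  show "p $ K = q $ K"
  proof (cases "card K = 2")
    case True
    then show ?thesis using assms(3) by (elim card_2_less) auto
  qed (use assms(1,2) in \<open>simp add: ext_power_def\<close>)
qed

lemma bilinear_bivec: "bilinear bivec"
  using bilinear_wedge linear_ext_of_vec unfolding bivec_def bilinear_def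
  by (auto intro: linear_compose[unfolded o_def])

lemma bivec_commute: "bivec y x = - bivec x y"
  by (intro ext_power_2_eqI bivec_in_ext_power subspace_neg[OF subspace_ext_power])
     (simp add: bivec_nth)

lemma bivec_self [simp]: "bivec x x = 0"
  by (intro ext_power_2_eqI bivec_in_ext_power subspace_0[OF subspace_ext_power])
     (simp add: bivec_nth)

lemmas bivec_simps = bilinear_ladd[OF bilinear_bivec] bilinear_radd[OF bilinear_bivec]
  bilinear_lsub[OF bilinear_bivec] bilinear_rsub[OF bilinear_bivec]
  bilinear_lmul[OF bilinear_bivec] bilinear_rmul[OF bilinear_bivec]
  bilinear_lzero[OF bilinear_bivec] bilinear_rzero[OF bilinear_bivec]
  bilinear_lneg[OF bilinear_bivec] bilinear_rneg[OF bilinear_bivec]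

lemma bivec_axis: "i < j \<Longrightarrow> bivec (axis i 1) (axis j 1) = axis {i, j} 1"
  by (rule ext_power_2_eqI[OF bivec_in_ext_power])
     (auto simp: ext_power_def bivec_nth axis_def doubleton_eq_iff)

lemma wedge_vec_commute:
  "wedge (ext_of_vec a) (wedge (ext_of_vec b) w) = - wedge (ext_of_vec b) (wedge (ext_of_vec a) w)"
  unfolding wedge_assoc[symmetric] bivec_def[symmetric]
  by (subst bivec_commute) (simp add: bilinear_lneg[OF bilinear_wedge])

lemma wedge_vec_self: "wedge (ext_of_vec a) (wedge (ext_of_vec a) w) = 0"
  unfolding wedge_assoc[symmetric] bivec_def[symmetric]
  by (simp add: bilinear_lzero[OF bilinear_wedge])

lemma wedge_list_mem: "a \<in> set as \<Longrightarrow> wedge (ext_of_vec a) (wedge_list as) = 0"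
proof (induction as)
  case (Cons b as)
  show ?case
  proof (cases "a = b")
    case False
    then have "wedge (ext_of_vec a) (wedge_list as) = 0" using Cons by simp
    then show ?thesis unfolding wedge_list_Cons
      by (subst wedge_vec_commute) (simp add: bilinear_rzero[OF bilinear_wedge])
  qed (simp add: wedge_list_Cons wedge_vec_self)
qed simp

lemma linear_wedge_vec_left: "linear (\<lambda>a. wedge (ext_of_vec a) w)"
  using bilinear_wedge linear_ext_of_vec unfolding bilinear_def
  by (auto intro: linear_compose[unfolded o_def])

lemma wedge_list_span: "a \<in> span (set as) \<Longrightarrow> wedge (ext_of_vec a) (wedge_list as) = 0"
  using linear_eq_0_on_span[OF linear_wedge_vec_left, of "set as"] wedge_list_mem by blast

text \<open>A vector in the span of the later ones annihilates their product, so each head of the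
  list lies outside the span of its tail.\<close>

lemma wedge_list_independent:
  "wedge_list as \<noteq> 0 \<Longrightarrow> independent (set as) \<and> distinct as"
proof (induction as)
  case (Cons a as)
  then have "wedge_list as \<noteq> 0"
    by (auto simp: wedge_list_Cons bilinear_rzero[OF bilinear_wedge])
  moreover have "a \<notin> span (set as)"
    using Cons.prems wedge_list_span by (auto simp: wedge_list_Cons)
  ultimately show ?case using Cons.IH span_base[of a "set as"]
    by (auto simp: independent_insert)
qed (simp add: independent_empty)

text \<open>The Hodge dual, up to sign conventions; it turns \<^const>\<open>ext_dot\<close> into the inner product.\<close>

definition hodge :: "'n::{finite,linorder} ext \<Rightarrow> 'n ext" where
  "hodge r = (\<chi> I. shuffle_sign I (- I) * r $ (- I))"

definition hodge_inv :: "'n::{finite,linorder} ext \<Rightarrow> 'n ext" where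
  "hodge_inv p = (\<chi> K. shuffle_sign (- K) K * p $ (- K))"

lemma linear_hodge: "linear hodge"
  by (intro linearI) (simp_all add: hodge_def vec_eq_iff algebra_simps)

lemma linear_hodge_inv: "linear hodge_inv"
  by (intro linearI) (simp_all add: hodge_inv_def vec_eq_iff algebra_simps)

lemma hodge_inv_hodge: "hodge_inv (hodge r) = r"
  by (simp add: hodge_def hodge_inv_def vec_eq_iff mult.assoc[symmetric] shuffle_sign_square)

lemma hodge_hodge_inv: "hodge (hodge_inv r) = r"
  by (simp add: hodge_def hodge_inv_def vec_eq_iff mult.assoc[symmetric] shuffle_sign_square)

lemma ext_dot_hodge: "ext_dot q r = q \<bullet> hodge r"
  by (simp add: ext_dot_def wedge_def hodge_def inner_vec_def Compl_eq_Diff_UNIV mult_ac)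

lemma hodge_in_ext_power:
  fixes r :: "'n::{finite,linorder} ext"
  assumes "r \<in> ext_power k" "k + l = CARD('n)"
  shows "hodge r \<in> ext_power l"
  unfolding ext_power_def
proof clarify
  fix I :: "'n set" assume "card I \<noteq> l"
  then have "card (- I) \<noteq> k"
    using assms(2) card_mono[of UNIV I] by (simp add: Compl_eq_Diff_UNIV card_Diff_subset)
  then show "hodge r $ I = 0" using assms(1) by (simp add: hodge_def ext_power_def)
qed

section \<open>Alternating forms and the dual description of rods\<close>

lemma bilinear_inner_bivec: "bilinear (\<lambda>x y. bivec x y \<bullet> m)"
  by (auto simp: bilinear_def bivec_simps inner_add_left intro!: linearI)

text \<open>This is the Gram determinant. Both sides are bilinear in \<open>x\<close> and
  \<open>y\<close>, which reduces the identity to basis vectors, where it is the formula for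
  Pluecker coordinates.\<close>

lemma inner_bivec: "bivec x y \<bullet> bivec a b = (x \<bullet> a) * (y \<bullet> b) - (x \<bullet> b) * (y \<bullet> a)"
proof -
  have bl: "bilinear (\<lambda>x y. (x \<bullet> a) * (y \<bullet> b) - (x \<bullet> b) * (y \<bullet> a))"
    by (auto simp: bilinear_def algebra_simps inner_add_left intro!: linearI)
  have lt: "bivec (axis i 1) (axis j 1) \<bullet> bivec a b = a $ i * b $ j - a $ j * b $ i" if "i < j" for i j
    using that by (simp add: bivec_axis bivec_nth inner_axis')
  have "bivec (axis i 1) (axis j 1) \<bullet> bivec a b = a $ i * b $ j - b $ i * a $ j" for i j
  proof (cases i j rule: linorder_cases)
    case greater
    then show ?thesis using lt[of j i] bivec_commute[of "axis i 1" "axis j 1"] by (simp add: mult.commute)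
  qed (use lt in \<open>auto simp: mult.commute\<close>)
  then have "(\<lambda>x y. bivec x y \<bullet> bivec a b) = (\<lambda>x y. (x \<bullet> a) * (y \<bullet> b) - (x \<bullet> b) * (y \<bullet> a))"
    by (intro bilinear_eq_stdbasis bilinear_inner_bivec bl) (auto simp: Basis_vec_def inner_axis')
  then show ?thesis by metis
qed

lemma ext_power_2_inner_eq_0:
  assumes "\<And>i j. i \<noteq> j \<Longrightarrow> bivec (axis i 1) (axis j 1) \<bullet> m = 0" "p \<in> ext_power 2"
  shows "p \<bullet> m = 0"
proof -
  have "p $ K * m $ K = 0" for K
  proof (cases "card K = 2")
    case True
    then obtain i j where "i < j" "K = {i, j}" by (rule card_2_less)
    then show ?thesis using assms(1)[of i j] by (auto simp: bivec_axis inner_axis')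
  qed (use assms(2) in \<open>simp add: ext_power_def\<close>)
  then show ?thesis unfolding inner_vec_def by (simp only: inner_real_def sum.neutral_const)
qed

text \<open>Read \<open>m\<close> as the alternating form sending \<open>(x, y)\<close> to
  \<open>bivec x y \<bullet> m\<close>. If its radical contains the orthogonal complement of
  \<open>a\<close> and \<open>b\<close>, the form only sees the projections to their plane, and an
  alternating form on a plane is a multiple of the determinant. By orthonormality the entries of
  that determinant are the inner products with \<open>a\<close> and \<open>b\<close>.\<close>

lemma form_with_kernel:
  fixes a b :: "real ^ ('n::{finite,linorder})"
  assumes ab: "a \<bullet> a = 1" "b \<bullet> b = 1" "a \<bullet> b = 0"
    and ker: "\<And>u y. u \<bullet> a = 0 \<Longrightarrow> u \<bullet> b = 0 \<Longrightarrow> bivec u y \<bullet> m = 0"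
  shows "bivec x y \<bullet> m = (bivec x y \<bullet> bivec a b) * (bivec a b \<bullet> m)"
proof -
  define u where "u = x - (x \<bullet> a) *\<^sub>R a - (x \<bullet> b) *\<^sub>R b"
  define v where "v = y - (y \<bullet> a) *\<^sub>R a - (y \<bullet> b) *\<^sub>R b"
  have uv: "u \<bullet> a = 0" "u \<bullet> b = 0" "v \<bullet> a = 0" "v \<bullet> b = 0"
    using ab by (simp_all add: u_def v_def inner_simps inner_commute[of b a])
  have ker': "bivec y u \<bullet> m = 0" if "u \<bullet> a = 0" "u \<bullet> b = 0" for u y
    using ker[OF that, of y] bivec_commute[of y u] by simp
  have x: "x = (x \<bullet> a) *\<^sub>R a + (x \<bullet> b) *\<^sub>R b + u" by (simp add: u_def)
  have y: "y = (y \<bullet> a) *\<^sub>R a + (y \<bullet> b) *\<^sub>R b + v" by (simp add: v_def)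
  have "bivec x y \<bullet> m = ((x \<bullet> a) * (y \<bullet> b) - (x \<bullet> b) * (y \<bullet> a)) * (bivec a b \<bullet> m)"
    apply (subst x, subst y)
    using ker[OF uv(1,2)] ker'[OF uv(3,4)] bivec_commute[of b a]
    by (simp add: bivec_simps inner_add_left algebra_simps)
  then show ?thesis by (simp add: inner_bivec)
qed

text \<open>Elements of the second exterior power are combinations of bivectors, so the identity
  extends linearly. It serves to recognise the dual of a rod as a decomposable bivector, and to show
  that the lines meeting one rod span the hyperplane of that rod.\<close>

lemma form_with_kernel_on_ext_power:
  fixes a b :: "real ^ ('n::{finite,linorder})"
  assumes "a \<bullet> a = 1" "b \<bullet> b = 1" "a \<bullet> b = 0"
    and "\<And>u y. u \<bullet> a = 0 \<Longrightarrow> u \<bullet> b = 0 \<Longrightarrow> bivec u y \<bullet> m = 0" and p: "p \<in> ext_power 2"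
  shows "p \<bullet> m = (p \<bullet> bivec a b) * (bivec a b \<bullet> m)"
proof -
  have "bivec x y \<bullet> (m - (bivec a b \<bullet> m) *\<^sub>R bivec a b) = 0" for x y
  proof -
    have "bivec x y \<bullet> m = (bivec x y \<bullet> bivec a b) * (bivec a b \<bullet> m)"
      by (rule form_with_kernel[OF assms(1-3)]) (rule assms(4))
    then show ?thesis by (simp only: inner_diff_right inner_scaleR_right mult.commute diff_self)
  qed
  then have "p \<bullet> (m - (bivec a b \<bullet> m) *\<^sub>R bivec a b) = 0"
    by (rule ext_power_2_inner_eq_0[OF _ p])
  then show ?thesis by (simp only: inner_diff_right inner_scaleR_right mult.commute right_minus_eq)
qed

lemma orthonormal_pair_of_codim_2:
  fixes S :: "(real ^ 'n::finite) set"
  assumes "subspace S" "dim S + 2 = CARD('n)"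
  obtains a b where "a \<bullet> a = 1" "b \<bullet> b = 1" "a \<bullet> b = 0" "S = {x. x \<bullet> a = 0 \<and> x \<bullet> b = 0}"
proof -
  define T where "T = {y \<in> UNIV. \<forall>x\<in>S. orthogonal x y}"
  have "dim T + dim S = dim (UNIV :: (real ^ 'n) set)"
    unfolding T_def by (rule dim_subspace_orthogonal_to_vectors[OF assms(1) subspace_UNIV subset_UNIV])
  then have "dim T = 2" using assms(2) by simp
  have "subspace T" unfolding T_def by (auto simp: subspace_def orthogonal_def inner_simps)
  from orthonormal_basis_subspace[OF this] obtain B where B: "B \<subseteq> T" "pairwise orthogonal B"
    "\<And>x. x \<in> B \<Longrightarrow> norm x = 1" "card B = dim T" "span B = T" by metis
  then obtain a b where ab: "B = {a, b}" "a \<noteq> b" using \<open>dim T = 2\<close> by (auto simp: card_2_iff)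
  have "a \<bullet> a = 1" "b \<bullet> b = 1" "a \<bullet> b = 0"
    using B(2,3) ab by (auto simp: pairwise_def orthogonal_def dot_square_norm)
  moreover have "S = {x. x \<bullet> a = 0 \<and> x \<bullet> b = 0}"
  proof
    show "S \<subseteq> {x. x \<bullet> a = 0 \<and> x \<bullet> b = 0}"
      using B(1) ab by (auto simp: T_def orthogonal_def)
    show "{x. x \<bullet> a = 0 \<and> x \<bullet> b = 0} \<subseteq> S"
    proof clarify
      fix x assume x: "x \<bullet> a = 0" "x \<bullet> b = 0"
      obtain y z where yz: "y \<in> span S" "\<And>w. w \<in> span S \<Longrightarrow> orthogonal z w" "x = y + z"
        using orthogonal_subspace_decomp_exists by blast
      have "z \<in> T" using yz(2) span_base by (auto simp: T_def orthogonal_commute)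
      then have "z \<in> span {a, b}" using B(5) ab by simp
      moreover have "orthogonal x w" if "w \<in> span {a, b}" for w
        using x by (intro orthogonal_to_span[OF that]) (auto simp: orthogonal_def)
      ultimately have "x \<bullet> z = 0" by (simp add: orthogonal_def)
      moreover have "y \<bullet> z = 0" using yz(1,2) by (auto simp: orthogonal_def inner_commute)
      ultimately have "z = 0" using yz(3) by (simp add: inner_add_left)
      then show "x \<in> S" using yz(1,3) assms(1) by (simp add: span_eq_iff[THEN iffD2])
    qed
  qed
  ultimately show ?thesis using that by blast
qed

text \<open>Let \<open>S\<close> be the span of the factors of \<open>r\<close>. The product of
  \<open>r\<close> with a vector of \<open>S\<close> vanishes, so \<open>S\<close> lies in the
  radical of the form \<open>hodge r\<close>. As \<open>S\<close> has codimension 2, that form is a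
  multiple of the determinant on the plane orthogonal to \<open>S\<close>. The rod condition on a
  bar thereby becomes orthogonality to \<open>bivec a b\<close>.\<close>

lemma hodge_grassmann:
  fixes r :: "'n::{finite,linorder} ext"
  assumes "r \<in> grassmann k" "k + 2 = CARD('n)"
  obtains a b c where "a \<bullet> a = 1" "b \<bullet> b = 1" "a \<bullet> b = 0" "c \<noteq> 0" "hodge r = c *\<^sub>R bivec a b"
proof -
  obtain as where as: "r \<noteq> 0" "length as = k" "r = wedge_list as"
    using assms(1) by (auto simp: grassmann_def)
  then have "independent (set as)" "distinct as" using wedge_list_independent by auto
  then have "dim (span (set as)) = k"
    using as(2) by (simp add: dim_eq_card_independent distinct_card)
  then obtain a b where ab: "a \<bullet> a = 1" "b \<bullet> b = 1" "a \<bullet> b = 0"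
    and S: "span (set as) = {x. x \<bullet> a = 0 \<and> x \<bullet> b = 0}"
    using assms(2) orthonormal_pair_of_codim_2[of "span (set as)"] by auto
  have ker: "bivec u y \<bullet> hodge r = 0" if "u \<bullet> a = 0" "u \<bullet> b = 0" for u y
  proof -
    have "u \<in> span (set as)" using S that by auto
    then have 0: "wedge (ext_of_vec u) r = 0" using wedge_list_span as(3) by auto
    have "wedge (bivec u y) r = - wedge (ext_of_vec y) (wedge (ext_of_vec u) r)"
      unfolding bivec_def wedge_assoc by (rule wedge_vec_commute)
    then show ?thesis using 0
      by (simp add: ext_dot_hodge[symmetric] ext_dot_def bilinear_rzero[OF bilinear_wedge])
  qed
  define c where "c = bivec a b \<bullet> hodge r"
  define p where "p = hodge r - c *\<^sub>R bivec a b"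
  have "hodge r \<in> ext_power 2"
    using hodge_in_ext_power[OF wedge_list_in_ext_power, of as 2] as assms(2) by simp
  then have p: "p \<in> ext_power 2"
    unfolding p_def by (intro subspace_diff subspace_scale subspace_ext_power bivec_in_ext_power)
  \<comment> \<open>Applied to the difference \<open>p\<close> itself, the formula gives
    \<open>p \<bullet> hodge r = c * (p \<bullet> bivec a b)\<close>, so \<open>p\<close> is
    orthogonal to itself.\<close>
  have "p \<bullet> p = 0"
    using form_with_kernel_on_ext_power[OF ab ker p] by (simp add: p_def inner_diff_right c_def)
  then have "hodge r = c *\<^sub>R bivec a b" by (simp add: p_def)
  moreover have "hodge r \<noteq> 0"
    using as(1) hodge_inv_hodge[of r] linear_0[OF linear_hodge_inv] by metis
  ultimately show ?thesis using that[OF ab, of c] by auto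
qed

lemma grassmann_2_iff: "p \<in> grassmann 2 \<longleftrightarrow> p \<noteq> 0 \<and> (\<exists>x y. p = bivec x y)"
  by (force simp: grassmann_def wedge_list_pair length_Suc_conv numeral_2_eq_2)

section \<open>Products of charts\<close>

lemma lipschitz_on_bounded_continuous:
  assumes "lipschitz_on_bounded f"
  shows "continuous_on UNIV f"
proof (rule continuous_at_imp_continuous_on, rule)
  fix x
  obtain L where "L-lipschitz_on (ball x 1) f"
    using assms bounded_ball unfolding lipschitz_on_bounded_def by blast
  then have "continuous_on (ball x 1) f" by (rule lipschitz_on_continuous_on)
  then show "isCont f x" by (simp add: continuous_on_eq_continuous_at)
qed

lemma lipschitz_on_bounded_vec:
  fixes \<phi> :: "'j::finite \<Rightarrow> 'a::real_normed_vector \<Rightarrow> 'b::real_normed_vector"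
  assumes "\<And>e. e \<in> K \<Longrightarrow> lipschitz_on_bounded (\<phi> e)"
  shows "lipschitz_on_bounded (\<lambda>z. \<chi> e. if e \<in> K then \<phi> e (z $ e) else 0)"
  unfolding lipschitz_on_bounded_def
proof (intro allI impI)
  fix S :: "('a ^ 'j) set" assume S: "bounded S"
  let ?f = "\<lambda>z. \<chi> e. if e \<in> K then \<phi> e (z $ e) else 0"
  have "\<exists>L. L-lipschitz_on ((\<lambda>z. z $ e) ` S) (\<lambda>w. if e \<in> K then \<phi> e w else 0)" for e
  proof (cases "e \<in> K")
    case True
    have "bounded ((\<lambda>z. z $ e) ` S)" using S by (rule bounded_component_cart)
    then show ?thesis using assms[OF True] True by (auto simp: lipschitz_on_bounded_def)
  next
    case False
    have "0-lipschitz_on ((\<lambda>z. z $ e) ` S) (\<lambda>w. 0 :: 'b)" by (rule lipschitz_onI) auto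
    then show ?thesis using False by auto
  qed
  then obtain L where L: "\<And>e. (L e)-lipschitz_on ((\<lambda>z. z $ e) ` S) (\<lambda>w. if e \<in> K then \<phi> e w else 0)"
    by metis
  have "(\<Sum>e\<in>UNIV. L e)-lipschitz_on S ?f"
  proof (rule lipschitz_onI)
    fix x y assume xy: "x \<in> S" "y \<in> S"
    have "dist (?f x) (?f y) \<le> (\<Sum>e\<in>UNIV. dist (?f x $ e) (?f y $ e))"
      unfolding dist_vec_def by (rule L2_set_le_sum) simp
    also have "\<dots> \<le> (\<Sum>e\<in>UNIV. L e * dist x y)"
    proof (rule sum_mono)
      fix e
      have "dist (?f x $ e) (?f y $ e) \<le> L e * dist (x $ e) (y $ e)"
        using lipschitz_onD[OF L[of e], of "x $ e" "y $ e"] xy by simp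
      also have "\<dots> \<le> L e * dist x y"
        using lipschitz_on_nonneg[OF L[of e]] by (intro mult_left_mono dist_vec_nth_le)
      finally show "dist (?f x $ e) (?f y $ e) \<le> L e * dist x y" .
    qed
    finally show "dist (?f x) (?f y) \<le> (\<Sum>e\<in>UNIV. L e) * dist x y" by (simp add: sum_distrib_right)
  qed (use L lipschitz_on_nonneg in \<open>blast intro: sum_nonneg\<close>)
  then show "\<exists>L. L-lipschitz_on S ?f" by blast
qed

text \<open>
  A parametrisation by \<open>n\<close> of the coordinates of the parameter space. The last clause says that,
  up to null sets, it does not meet a linear hyperplane that does not contain \<open>H\<close>. The domain \<open>S\<close>
  is allowed to be null, so that lower-dimensional pieces count as charts too.
\<close>

definition chart :: "nat \<Rightarrow> 'b::euclidean_space set \<Rightarrow> ('p::euclidean_space \<Rightarrow> 'b) \<Rightarrow> 'p set \<Rightarrow> bool" where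
  "chart n H \<phi> S \<longleftrightarrow> lipschitz_on_bounded \<phi> \<and> closed S \<and>
     (\<exists>I\<subseteq>Basis. card I = n \<and>
        (\<forall>x y. (\<forall>b\<in>I. x \<bullet> b = y \<bullet> b) \<longrightarrow> \<phi> x = \<phi> y \<and> (x \<in> S \<longleftrightarrow> y \<in> S))) \<and>
     (\<forall>m. (\<exists>p\<in>H. p \<bullet> m \<noteq> 0) \<longrightarrow> negligible {x \<in> S. \<phi> x \<bullet> m = 0})"

text \<open>A cover is enough: images of charts may contain points outside \<open>Z\<close>, such as
  0, since only null sets are transported.\<close>

definition charted ::
    "nat \<Rightarrow> 'b::euclidean_space set \<Rightarrow> 'b set \<Rightarrow> (('p::euclidean_space \<Rightarrow> 'b) \<times> 'p set) set \<Rightarrow> bool" where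
  "charted n H Z C \<longleftrightarrow> finite C \<and> (\<forall>(\<phi>, S)\<in>C. chart n H \<phi> S) \<and> Z \<subseteq> (\<Union>(\<phi>, S)\<in>C. \<phi> ` S)"

text \<open>Hold all factors but \<open>e0\<close> fixed. By \<open>lin\<close>, the points of such
  a slice that lie in \<open>Bad\<close> satisfy one linear equation in the factor
  \<open>e0\<close>, whose coefficients may depend on the slice, so the chart property makes the
  slice of parameters null. These slices are translates along \<open>axis e0\<close>, whence the
  whole parameter set is null.\<close>

lemma hausdorff_null_chart_product:
  fixes \<phi> :: "'j::finite \<Rightarrow> 'p::euclidean_space \<Rightarrow> 'b::euclidean_space"
  assumes ch: "\<And>e. e \<in> K \<Longrightarrow> chart (n e) (H e) (\<phi> e) (S e)"
    and e0: "e0 \<in> K" and Bad: "Bad \<in> sets borel"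
    and lin: "\<And>x. \<exists>m. (\<exists>p\<in>H e0. p \<bullet> m \<noteq> 0) \<and> (\<forall>y. (\<chi> e. if e = e0 then y else x $ e) \<in> Bad \<longrightarrow> y \<bullet> m = 0)"
  shows "hausdorff_measure (\<Sum>e\<in>K. n e)
    ({\<chi> e. if e \<in> K then \<phi> e (z $ e) else 0 | z. \<forall>e\<in>K. z $ e \<in> S e} \<inter> Bad) = 0"
proof -
  define f where "f z = (\<chi> e. if e \<in> K then \<phi> e (z $ e) else 0)" for z
  define T where "T = {z. (\<forall>e\<in>K. z $ e \<in> S e) \<and> f z \<in> Bad}"
  have "\<forall>e\<in>K. \<exists>I\<subseteq>Basis. card I = n e \<and>
        (\<forall>x y. (\<forall>b\<in>I. x \<bullet> b = y \<bullet> b) \<longrightarrow> \<phi> e x = \<phi> e y \<and> (x \<in> S e \<longleftrightarrow> y \<in> S e))"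
    using ch unfolding chart_def by blast
  then obtain I where I: "\<forall>e\<in>K. I e \<subseteq> Basis \<and> card (I e) = n e \<and>
        (\<forall>x y. (\<forall>b\<in>I e. x \<bullet> b = y \<bullet> b) \<longrightarrow> \<phi> e x = \<phi> e y \<and> (x \<in> S e \<longleftrightarrow> y \<in> S e))"
    by (auto dest!: bchoice)
  \<comment> \<open>All factors share one parameter type, so the coordinates that matter are
    collected here; their number, not the dimension of the ambient space, is the exponent of the
    measure.\<close>
  define J where "J = (\<Union>e\<in>K. axis e ` I e)"
  have J: "J \<subseteq> Basis" using I by (fastforce simp: J_def Basis_vec_def)
  have fin: "finite (I e)" if "e \<in> K" for e
    using I that finite_subset[OF _ finite_Basis] by blast
  have "card J = (\<Sum>e\<in>K. card (axis e ` I e))" unfolding J_def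
  proof (rule card_UN_disjoint)
    show "\<forall>i\<in>K. \<forall>j\<in>K. i \<noteq> j \<longrightarrow> axis i ` I i \<inter> axis j ` I j = {}"
    proof (intro ballI impI)
      fix i j assume ij: "i \<in> K" "j \<in> K" "i \<noteq> j"
      \<comment> \<open>Distinct axes meet only in 0, which is not a basis vector.\<close>
      have "0 \<notin> I i" using I ij nonzero_Basis by blast
      then show "axis i ` I i \<inter> axis j ` I j = {}" using ij(3) by (auto simp: axis_eq_axis)
    qed
  qed (use fin in auto)
  also have "\<dots> = (\<Sum>e\<in>K. n e)"
    using I by (intro sum.cong refl) (auto simp: card_image inj_on_def axis_eq_axis)
  finally have cardJ: "card J = (\<Sum>e\<in>K. n e)" .
  have lip: "lipschitz_on_bounded f"
    unfolding f_def using ch by (intro lipschitz_on_bounded_vec) (auto simp: chart_def)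
  have cont: "continuous_on UNIV f" by (rule lipschitz_on_bounded_continuous[OF lip])
  have "closed {z. \<forall>e\<in>K. z $ e \<in> S e}"
  proof -
    have "closed ((\<lambda>z. z $ e) -` S e)" if "e \<in> K" for e
      using ch[OF that] by (intro closed_vimage continuous_intros) (auto simp: chart_def)
    then have "closed (\<Inter>e\<in>K. (\<lambda>z. z $ e) -` S e)" by blast
    moreover have "(\<Inter>e\<in>K. (\<lambda>z. z $ e) -` S e) = {z. \<forall>e\<in>K. z $ e \<in> S e}" by auto
    ultimately show ?thesis by simp
  qed
  moreover have "f -` Bad \<in> sets borel"
    using measurable_sets[OF borel_measurable_continuous_onI[OF cont] Bad] by simp
  ultimately have T: "T \<in> sets borel"
    unfolding T_def Collect_conj_eq by (auto simp: vimage_def)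
  have "negligible T"
  proof (rule negligible_by_translates[OF T, of "axis e0"])
    have "linear (axis e0 :: 'p \<Rightarrow> 'p ^ 'j)" by (rule linearI) (auto simp: axis_def vec_eq_iff)
    then show "(axis e0 :: 'p \<Rightarrow> 'p ^ 'j) \<in> borel_measurable borel"
      by (intro borel_measurable_continuous_onI linear_continuous_on linear_conv_bounded_linear[THEN iffD1])
    fix x
    obtain m where m: "\<exists>p\<in>H e0. p \<bullet> m \<noteq> 0"
      "\<And>y. (\<chi> e. if e = e0 then y else f x $ e) \<in> Bad \<Longrightarrow> y \<bullet> m = 0"
      using lin[of "f x"] by blast
    define N where "N = {w \<in> S e0. \<phi> e0 w \<bullet> m = 0}"
    have "negligible N" using ch[OF e0] m(1) by (auto simp: chart_def N_def)
    then have "negligible ((+) (- (x $ e0)) ` N)" by (rule negligible_translation)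
    moreover have "{z. x + axis e0 z \<in> T} \<subseteq> (+) (- (x $ e0)) ` N"
    proof
      fix z assume "z \<in> {z. x + axis e0 z \<in> T}"
      then have z: "f (x + axis e0 z) \<in> Bad" "(x + axis e0 z) $ e0 \<in> S e0" using e0 by (auto simp: T_def)
      have "f (x + axis e0 z) = (\<chi> e. if e = e0 then \<phi> e0 (x $ e0 + z) else f x $ e)"
        using e0 by (auto simp: f_def vec_eq_iff axis_def)
      with z m(2) have "x $ e0 + z \<in> N" by (auto simp: N_def)
      then show "z \<in> (+) (- (x $ e0)) ` N" by (intro image_eqI[of _ _ "x $ e0 + z"]) auto
    qed
    ultimately show "negligible {z. x + axis e0 z \<in> T}" by (rule negligible_subset)
  qed
  have "hausdorff_measure (card J) (f ` T) = 0"
  proof (rule hausdorff_measure_image_cylinder[OF lip J \<open>negligible T\<close>])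
    fix x y :: "'p ^ 'j" assume xy: "\<forall>b\<in>J. x \<bullet> b = y \<bullet> b"
    have "\<phi> e (x $ e) = \<phi> e (y $ e) \<and> (x $ e \<in> S e \<longleftrightarrow> y $ e \<in> S e)" if "e \<in> K" for e
    proof -
      have "\<forall>b\<in>I e. x $ e \<bullet> b = y $ e \<bullet> b"
        using xy that by (auto simp: J_def inner_axis)
      then show ?thesis using I that by blast
    qed
    moreover from this have "f x = f y" by (auto simp: f_def vec_eq_iff)
    ultimately show "f x = f y \<and> (x \<in> T \<longleftrightarrow> y \<in> T)" by (auto simp: T_def)
  qed
  moreover have "f ` T = {f z | z. \<forall>e\<in>K. z $ e \<in> S e} \<inter> Bad" by (auto simp: T_def)
  ultimately show ?thesis by (simp add: cardJ f_def)
qed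

text \<open>Choosing a chart for each factor covers the configurations by finitely many pieces, one
  for every \<open>c\<close> in \<open>PiE K C\<close>.\<close>

lemma hausdorff_null_product:
  fixes Z :: "'j::finite \<Rightarrow> 'b::euclidean_space set"
    and C :: "'j \<Rightarrow> (('p::euclidean_space \<Rightarrow> 'b) \<times> 'p set) set"
  assumes ch: "\<And>e. e \<in> K \<Longrightarrow> charted (n e) (H e) (Z e) (C e)"
    and e0: "e0 \<in> K" and Bad: "Bad \<in> sets borel"
    and lin: "\<And>x. \<exists>m. (\<exists>p\<in>H e0. p \<bullet> m \<noteq> 0) \<and> (\<forall>y. (\<chi> e. if e = e0 then y else x $ e) \<in> Bad \<longrightarrow> y \<bullet> m = 0)"
  shows "hausdorff_measure (\<Sum>e\<in>K. n e) ({q. (\<forall>e\<in>K. q $ e \<in> Z e) \<and> (\<forall>e. e \<notin> K \<longrightarrow> q $ e = 0)} \<inter> Bad) = 0"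
proof (rule hausdorff_measure_eq_0_subset)
  let ?W = "\<lambda>c. {\<chi> e. if e \<in> K then fst (c e) (z $ e) else 0 | z. \<forall>e\<in>K. z $ e \<in> snd (c e)} \<inter> Bad"
  show "hausdorff_measure (\<Sum>e\<in>K. n e) (\<Union>c\<in>PiE K C. ?W c) = 0"
  proof (rule hausdorff_measure_eq_0_finite_UN)
    show "finite (PiE K C)" using ch by (intro finite_PiE) (auto simp: charted_def)
    fix c assume "c \<in> PiE K C"
    then have "chart (n e) (H e) (fst (c e)) (snd (c e))" if "e \<in> K" for e
      using ch[OF that] PiE_mem[OF _ that, of c C] by (auto simp: charted_def split_beta)
    then show "hausdorff_measure (\<Sum>e\<in>K. n e) (?W c) = 0"
      by (intro hausdorff_null_chart_product[where H=H, OF _ e0 Bad lin])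
  qed
  show "{q. (\<forall>e\<in>K. q $ e \<in> Z e) \<and> (\<forall>e. e \<notin> K \<longrightarrow> q $ e = 0)} \<inter> Bad \<subseteq> (\<Union>c\<in>PiE K C. ?W c)"
  proof clarify
    fix q assume q: "q \<in> Bad" "\<forall>e\<in>K. q $ e \<in> Z e" "\<forall>e. e \<notin> K \<longrightarrow> q $ e = 0"
    have "\<forall>e\<in>K. \<exists>cz. fst cz \<in> C e \<and> snd cz \<in> snd (fst cz) \<and> q $ e = fst (fst cz) (snd cz)"
    proof
      fix e assume "e \<in> K"
      then have "Z e \<subseteq> (\<Union>(\<phi>, S)\<in>C e. \<phi> ` S)" "q $ e \<in> Z e" using ch q(2) by (auto simp: charted_def)
      then have "q $ e \<in> (\<Union>(\<phi>, S)\<in>C e. \<phi> ` S)" by (rule subsetD)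
      then show "\<exists>cz. fst cz \<in> C e \<and> snd cz \<in> snd (fst cz) \<and> q $ e = fst (fst cz) (snd cz)" by auto
    qed
    from bchoice[OF this] obtain h where
      h: "\<forall>e\<in>K. fst (h e) \<in> C e \<and> snd (h e) \<in> snd (fst (h e)) \<and> q $ e = fst (fst (h e)) (snd (h e))"
      by blast
    define c where "c = restrict (fst \<circ> h) K"
    define z where "z = (\<chi> e. snd (h e))"
    have "c \<in> PiE K C" using h by (auto simp: c_def)
    moreover have "q = (\<chi> e. if e \<in> K then fst (c e) (z $ e) else 0)"
      using h q(3) by (auto simp: c_def z_def vec_eq_iff)
    moreover have "\<forall>e\<in>K. z $ e \<in> snd (c e)" using h by (auto simp: c_def z_def)
    ultimately show "q \<in> (\<Union>c\<in>PiE K C. ?W c)" using q(1) by blast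
  qed
qed

section \<open>Generic position and dependent families\<close>

text \<open>Induction on \<open>F\<close>. If some \<open>x e\<close> is independent of the others,
  deleting \<open>e\<close> lowers the right side by exactly one and the left side by at most one.
  Otherwise genericity puts every flat \<open>A e\<close> with \<open>e\<close> in \<open>F\<close>,
  and thus every \<open>y e\<close>, into the span of the points of \<open>x\<close> on
  \<open>F\<close>.\<close>

lemma dim_image_le_of_generic_position:
  fixes x y :: "'e \<Rightarrow> 'a::euclidean_space"
  assumes gen: "generic_position E A x" and y: "\<And>e. e \<in> E \<Longrightarrow> y e \<in> A e" and "finite F" "F \<subseteq> E"
  shows "dim (y ` F) \<le> dim (x ` F)"
  using assms(3,4)
proof (induction "card F" arbitrary: F rule: less_induct)
  case less
  show ?case
  proof (cases "\<exists>e\<in>F. x e \<notin> span (x ` (F - {e}))")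
    case True
    then obtain e where e: "e \<in> F" "x e \<notin> span (x ` (F - {e}))" by blast
    have F: "x ` F = insert (x e) (x ` (F - {e}))" "y ` F = insert (y e) (y ` (F - {e}))" using e(1) by auto
    have "dim (y ` (F - {e})) \<le> dim (x ` (F - {e}))"
      using less.prems e(1) by (intro less.hyps card_Diff1_less) auto
    then show ?thesis using e(2) unfolding F by (simp add: dim_insert)
  next
    case False
    then have "y e \<in> span (x ` F)" if "e \<in> F" for e
    proof -
      have "A e \<subseteq> span (x ` (F - {e}))"
        using gen False that less.prems unfolding generic_position_def by blast
      also have "\<dots> \<subseteq> span (x ` F)" by (intro span_mono) auto
      finally show ?thesis using y that less.prems by blast
    qed
    then have "y ` F \<subseteq> span (x ` F)" by auto
    then show ?thesis by (rule dim_subset[THEN order_trans]) simp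
  qed
qed

text \<open>Two generic positions bound each other's ranks, so all of them define one rank function
  and the definite description is justified.\<close>

lemma generic_matroid_eq:
  fixes x :: "'e \<Rightarrow> 'a::euclidean_space"
  assumes "generic_position E A x" "finite E"
  shows "generic_matroid E A = linear_matroid E x"
  unfolding generic_matroid_def
proof (rule the_equality)
  fix \<rho> assume "\<exists>x. generic_position E A x \<and> \<rho> = linear_matroid E x"
  then obtain y where y: "generic_position E A y" "\<rho> = linear_matroid E y" by blast
  have "dim (y ` F) = dim (x ` F)" if "F \<subseteq> E" for F
  proof (rule antisym)
    have "finite F" using that assms(2) finite_subset by blast
    then show "dim (y ` F) \<le> dim (x ` F)" "dim (x ` F) \<le> dim (y ` F)"
      using dim_image_le_of_generic_position[OF assms(1), of y F]
        dim_image_le_of_generic_position[OF y(1), of x F] that y(1) assms(1)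
      by (auto simp: generic_position_def)
  qed
  then show "\<rho> = linear_matroid E x"
    unfolding y(2) linear_matroid_def by (intro restrict_ext) auto
qed (use assms in blast)

text \<open>Norm 1 instead of nonzero coefficients: compactness of the sphere makes dependence a
  closed condition. Coefficients are indexed by \<open>'e\<close>, so equal vectors at different
  indices of \<open>F\<close> count as dependent.\<close>

definition family_dependent :: "'e::finite set \<Rightarrow> 'a::real_vector ^ 'e \<Rightarrow> bool" where
  "family_dependent F x \<longleftrightarrow> (\<exists>c :: real ^ 'e. norm c = 1 \<and> (\<forall>f. f \<notin> F \<longrightarrow> c $ f = 0) \<and>
     (\<Sum>f\<in>UNIV. c $ f *\<^sub>R x $ f) = 0)"

lemma family_dependentI:
  fixes c :: "real ^ 'e::finite"
  assumes "c \<noteq> 0" "\<And>f. f \<notin> F \<Longrightarrow> c $ f = 0" "(\<Sum>f\<in>UNIV. c $ f *\<^sub>R x $ f) = 0"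
  shows "family_dependent F x"
proof -
  have "(\<Sum>f\<in>UNIV. (inverse (norm c) *\<^sub>R c) $ f *\<^sub>R x $ f) = inverse (norm c) *\<^sub>R (\<Sum>f\<in>UNIV. c $ f *\<^sub>R x $ f)"
    by (simp add: scaleR_sum_right)
  then show ?thesis unfolding family_dependent_def
    using assms by (intro exI[of _ "inverse (norm c) *\<^sub>R c"]) auto
qed

lemma closed_family_dependent: "closed {x :: 'a::euclidean_space ^ 'e::finite. family_dependent F x}"
proof -
  define S where "S = {z :: (real ^ 'e) \<times> ('a ^ 'e). (\<forall>f. f \<notin> F \<longrightarrow> fst z $ f = 0) \<and>
     (\<Sum>f\<in>UNIV. fst z $ f *\<^sub>R snd z $ f) = 0}"
  have "closed S" unfolding S_def
    by (intro closed_Collect_conj closed_Collect_all closed_Collect_imp closed_Collect_eq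
        continuous_intros) auto
  have "closed {x. \<exists>c. c \<in> sphere 0 1 \<and> (c, x) \<in> S}"
    by (rule closed_compact_projection[OF compact_sphere \<open>closed S\<close>])
  moreover have "{x. \<exists>c. c \<in> sphere 0 1 \<and> (c, x) \<in> S} = {x. family_dependent F x}"
    by (auto simp: S_def family_dependent_def)
  ultimately show ?thesis by simp
qed

lemma family_dependent_cong:
  assumes "\<And>f. f \<in> F \<Longrightarrow> x $ f = y $ f"
  shows "family_dependent F x \<longleftrightarrow> family_dependent F y"
proof -
  have "(\<Sum>f\<in>UNIV. c $ f *\<^sub>R x $ f) = (\<Sum>f\<in>UNIV. c $ f *\<^sub>R y $ f)"
    if "\<forall>f. f \<notin> F \<longrightarrow> c $ f = 0" for c :: "real ^ 'a"
    using that assms by (intro sum.cong refl) (metis scale_zero_left)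
  then show ?thesis unfolding family_dependent_def by (intro ex_cong1) auto
qed

lemma family_dependent_insertD:
  fixes x :: "'a::real_vector ^ 'e::finite"
  assumes "family_dependent (insert f F) x" "\<not> family_dependent F x"
  shows "x $ f \<in> span (($) x ` F)"
proof -
  obtain c :: "real ^ 'e" where c: "norm c = 1" "\<forall>g. g \<notin> insert f F \<longrightarrow> c $ g = 0"
    "(\<Sum>g\<in>UNIV. c $ g *\<^sub>R x $ g) = 0"
    using assms(1) unfolding family_dependent_def by blast
  have cf: "c $ f \<noteq> 0 \<and> f \<notin> F"
  proof (rule ccontr)
    assume "\<not> (c $ f \<noteq> 0 \<and> f \<notin> F)"
    then have "\<forall>g. g \<notin> F \<longrightarrow> c $ g = 0" using c(2) by auto
    then show False using assms(2) c unfolding family_dependent_def by blast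
  qed
  have "(\<Sum>g\<in>UNIV. c $ g *\<^sub>R x $ g) = c $ f *\<^sub>R x $ f + (\<Sum>g\<in>UNIV - {f}. c $ g *\<^sub>R x $ g)"
    by (simp add: sum.remove[of UNIV f])
  also have "(\<Sum>g\<in>UNIV - {f}. c $ g *\<^sub>R x $ g) = (\<Sum>g\<in>F. c $ g *\<^sub>R x $ g)"
    using c(2) cf by (intro sum.mono_neutral_right) auto
  finally have "c $ f *\<^sub>R x $ f = - (\<Sum>g\<in>F. c $ g *\<^sub>R x $ g)"
    using c(3) by (simp add: eq_neg_iff_add_eq_0)
  moreover have "- (\<Sum>g\<in>F. c $ g *\<^sub>R x $ g) \<in> span (($) x ` F)"
    by (intro span_neg span_sum span_scale span_base imageI)
  ultimately have "inverse (c $ f) *\<^sub>R c $ f *\<^sub>R x $ f \<in> span (($) x ` F)"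
    by (metis span_scale)
  then show ?thesis using cf by simp
qed

lemma family_dependent_insertI:
  fixes x :: "'a::real_vector ^ 'e::finite"
  assumes "x $ f \<in> span (($) x ` F)" "f \<notin> F"
  shows "family_dependent (insert f F) x"
proof -
  \<comment> \<open>Combinations are indexed by \<open>F\<close> and not by the image, in which
    indices with equal vectors coincide.\<close>
  have "span (($) x ` F) \<subseteq> range (\<lambda>d. \<Sum>g\<in>F. d g *\<^sub>R x $ g)"
  proof (rule span_minimal)
    show "($) x ` F \<subseteq> range (\<lambda>d. \<Sum>g\<in>F. d g *\<^sub>R x $ g)"
    proof clarify
      fix g assume "g \<in> F"
      then have "x $ g = (\<Sum>h\<in>F. (if h = g then 1 else 0) *\<^sub>R x $ h)"
        by (simp add: if_distrib[where f="\<lambda>a. a *\<^sub>R _"] cong: if_cong)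
      then show "x $ g \<in> range (\<lambda>d. \<Sum>g\<in>F. d g *\<^sub>R x $ g)" by (rule image_eqI[where x="\<lambda>h. if h = g then 1 else 0"]) simp
    qed
    show "subspace (range (\<lambda>d. \<Sum>g\<in>F. d g *\<^sub>R x $ g))"
      unfolding subspace_def
    proof (intro conjI ballI allI)
      show "0 \<in> range (\<lambda>d. \<Sum>g\<in>F. d g *\<^sub>R x $ g)" by (rule image_eqI[of _ _ "\<lambda>_. 0"]) auto
    next
      fix p q assume "p \<in> range (\<lambda>d. \<Sum>g\<in>F. d g *\<^sub>R x $ g)" "q \<in> range (\<lambda>d. \<Sum>g\<in>F. d g *\<^sub>R x $ g)"
      then obtain d d' where "p = (\<Sum>g\<in>F. d g *\<^sub>R x $ g)" "q = (\<Sum>g\<in>F. d' g *\<^sub>R x $ g)" by blast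
      then have "p + q = (\<Sum>g\<in>F. (d g + d' g) *\<^sub>R x $ g)" by (simp add: scaleR_add_left sum.distrib)
      then show "p + q \<in> range (\<lambda>d. \<Sum>g\<in>F. d g *\<^sub>R x $ g)"
        by (rule image_eqI[where x="\<lambda>g. d g + d' g"]) simp
    next
      fix c :: real and p assume "p \<in> range (\<lambda>d. \<Sum>g\<in>F. d g *\<^sub>R x $ g)"
      then obtain d where "p = (\<Sum>g\<in>F. d g *\<^sub>R x $ g)" by blast
      then have "c *\<^sub>R p = (\<Sum>g\<in>F. (c * d g) *\<^sub>R x $ g)" by (simp add: scaleR_sum_right)
      then show "c *\<^sub>R p \<in> range (\<lambda>d. \<Sum>g\<in>F. d g *\<^sub>R x $ g)"
        by (rule image_eqI[where x="\<lambda>g. c * d g"]) simp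
    qed
  qed
  with assms(1) obtain d where d: "x $ f = (\<Sum>g\<in>F. d g *\<^sub>R x $ g)" by blast
  define c where "c = (\<chi> g. if g = f then - 1 else if g \<in> F then d g else 0)"
  have "(\<Sum>g\<in>UNIV. c $ g *\<^sub>R x $ g) = c $ f *\<^sub>R x $ f + (\<Sum>g\<in>UNIV - {f}. c $ g *\<^sub>R x $ g)"
    by (simp add: sum.remove[of UNIV f])
  also have "(\<Sum>g\<in>UNIV - {f}. c $ g *\<^sub>R x $ g) = (\<Sum>g\<in>F. d g *\<^sub>R x $ g)"
    using assms(2) by (intro sum.mono_neutral_cong_right) (auto simp: c_def)
  finally have "(\<Sum>g\<in>UNIV. c $ g *\<^sub>R x $ g) = 0" by (simp add: c_def d)
  moreover have "c $ f \<noteq> 0" by (simp add: c_def)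
  then have "c \<noteq> 0" by auto
  ultimately show ?thesis by (intro family_dependentI[of c]) (auto simp: c_def)
qed

lemma family_basis_exists:
  fixes x :: "'a::real_vector ^ 'e::finite"
  obtains F' where "F' \<subseteq> F" "\<not> family_dependent F' x" "($) x ` F \<subseteq> span (($) x ` F')"
proof -
  let ?P = "\<lambda>F'. F' \<subseteq> F \<and> \<not> family_dependent F' x"
  have "c = 0" if "\<forall>f. c $ f = 0" for c :: "real ^ 'e" using that by (simp add: vec_eq_iff)
  then have "?P {}" by (force simp: family_dependent_def)
  moreover have "\<forall>F'. ?P F' \<longrightarrow> card F' < Suc CARD('e)"
    by (auto intro!: le_imp_less_Suc card_mono)
  ultimately obtain F' where "?P F' \<and> (\<forall>F''. ?P F'' \<longrightarrow> card F'' \<le> card F')"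
    using ex_has_greatest_nat[of ?P "{}" card "Suc CARD('e)"] by blast
  then have F': "?P F'" "\<And>F''. ?P F'' \<Longrightarrow> card F'' \<le> card F'" by blast+
  have "x $ f \<in> span (($) x ` F')" if "f \<in> F" for f
  proof (cases "f \<in> F'")
    case False
    then have "\<not> ?P (insert f F')" using F'(2)[of "insert f F'"] by auto
    then have "family_dependent (insert f F') x" using F'(1) that by blast
    then show ?thesis using F'(1) family_dependent_insertD by blast
  qed (auto intro: span_base)
  then show ?thesis using that F'(1) by blast
qed

text \<open>With a finite \<open>T\<close>, this makes the set of non-generic configurations a finite union.\<close>

lemma flat_subset_span_if_generic:
  fixes x :: "'a::real_vector ^ 'e::finite"
  assumes A: "A \<subseteq> span T" and e: "e \<in> F" and x: "x $ e \<in> span (($) x ` (F - {e}))"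
    and T: "\<And>F' a. F' \<subseteq> F \<Longrightarrow> e \<in> F' \<Longrightarrow> a \<in> T \<Longrightarrow> family_dependent F' x \<Longrightarrow>
      family_dependent F' (\<chi> f. if f = e then a else x $ f)"
  shows "A \<subseteq> span (($) x ` (F - {e}))"
proof -
  \<comment> \<open>A dependence of \<open>F\<close> itself need not involve \<open>e\<close>. For
    an independent subfamily \<open>F'\<close> with the same span as \<open>F - {e}\<close>, adding
    \<open>e\<close> creates a dependence exactly if the vector at \<open>e\<close> lies in that
    span.\<close>
  obtain F' where F': "F' \<subseteq> F - {e}" "\<not> family_dependent F' x" "($) x ` (F - {e}) \<subseteq> span (($) x ` F')"
    using family_basis_exists[of "F - {e}" x] by blast
  have "span (($) x ` (F - {e})) \<subseteq> span (($) x ` F')" using F'(3) by (simp add: span_minimal)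
  then have dep: "family_dependent (insert e F') x" using x F'(1) by (intro family_dependent_insertI) auto
  have "a \<in> span (($) x ` F')" if "a \<in> T" for a
  proof -
    let ?y = "\<chi> f. if f = e then a else x $ f"
    have "family_dependent (insert e F') ?y" using T[OF _ _ that dep] F'(1) e by auto
    moreover have "\<not> family_dependent F' ?y"
      using F'(1,2) by (subst family_dependent_cong[of _ _ x]) auto
    ultimately have "?y $ e \<in> span (($) ?y ` F')" by (rule family_dependent_insertD)
    moreover have "($) ?y ` F' = ($) x ` F'" using F'(1) by (intro image_cong) auto
    ultimately show ?thesis by simp
  qed
  then have "span T \<subseteq> span (($) x ` F')" by (intro span_minimal) auto
  also have "\<dots> \<subseteq> span (($) x ` (F - {e}))" using F'(1) by (intro span_mono) auto
  finally show ?thesis using A by blast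
qed

section \<open>Charts of Schubert varieties of lines\<close>

lemma negligible_affine_zero:
  fixes L :: "'a::euclidean_space \<Rightarrow> real"
  assumes "linear L" "L x0 + c \<noteq> 0"
  shows "negligible {x. L x + c = 0}"
proof -
  define v where "v = adjoint L 1"
  have L: "L x = v \<bullet> x" for x
    using adjoint_works[OF assms(1), of x 1] by (simp add: v_def inner_commute)
  have "v \<noteq> 0 \<or> - c \<noteq> 0" using assms(2) by (auto simp: L)
  from negligible_hyperplane[OF this] show ?thesis by (simp add: L eq_neg_iff_add_eq_0)
qed

text \<open>Split by whether \<open>h\<close> vanishes at \<open>(x, y0)\<close>. The
  \<open>x\<close> for which it does satisfy an affine equation that fails at \<open>x0\<close>,
  hence \<open>N1\<close> is null. For any other \<open>x\<close> the affine equation in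
  \<open>y\<close> fails at \<open>y0\<close>, so the slices of \<open>N2\<close> are null.\<close>

lemma negligible_biaffine_zero:
  fixes h :: "'a::euclidean_space \<Rightarrow> 'b::euclidean_space \<Rightarrow> real"
  assumes cont: "continuous_on UNIV (\<lambda>z. h (fst z) (snd z))"
    and left: "\<And>y. \<exists>L c. linear L \<and> (\<forall>x. h x y = L x + c)"
    and right: "\<And>x. \<exists>L c. linear L \<and> (\<forall>y. h x y = L y + c)"
    and nz: "h x0 y0 \<noteq> 0"
  shows "negligible {z. h (fst z) (snd z) = 0}"
proof -
  have negl: "negligible {x. h x y = 0}" if "h x' y \<noteq> 0" for x' y
  proof -
    obtain L c where "linear L" "\<forall>x. h x y = L x + c" using left by blast
    then show ?thesis using negligible_affine_zero[of L x' c] that by simp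
  qed
  have negr: "negligible {y. h x y = 0}" if "h x y' \<noteq> 0" for x y'
  proof -
    obtain L c where "linear L" "\<forall>y. h x y = L y + c" using right by blast
    then show ?thesis using negligible_affine_zero[of L y' c] that by simp
  qed
  have trans: "negligible {w. a + w \<in> N}" if "negligible N" for a :: "'c::euclidean_space" and N
  proof -
    have "{w. a + w \<in> N} = (+) (- a) ` N" by (force simp: image_iff)
    then show ?thesis using negligible_translation[OF that, of "- a"] by (simp only:)
  qed
  have c1: "continuous_on UNIV (\<lambda>z :: 'a \<times> 'b. h (fst z) y0)"
  proof -
    have "continuous_on UNIV ((\<lambda>z. h (fst z) (snd z)) \<circ> (\<lambda>z :: 'a \<times> 'b. (fst z, y0)))"
      by (intro continuous_on_compose continuous_intros continuous_on_subset[OF cont subset_UNIV])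
    then show ?thesis by (simp only: o_def fst_conv snd_conv)
  qed
  define N1 where "N1 = {z :: 'a \<times> 'b. h (fst z) y0 = 0}"
  define N2 where "N2 = {z. h (fst z) (snd z) = 0} \<inter> {z :: 'a \<times> 'b. h (fst z) y0 \<noteq> 0}"
  have "closed N1" unfolding N1_def by (intro closed_Collect_eq c1 continuous_intros)
  have "closed {z. h (fst z) (snd z) = 0}" by (intro closed_Collect_eq cont continuous_intros)
  moreover have "open {z :: 'a \<times> 'b. h (fst z) y0 \<noteq> 0}" by (intro open_Collect_neq c1 continuous_intros)
  ultimately have "N2 \<in> sets borel" by (auto simp: N2_def)
  then have "negligible N2"
  proof (rule negligible_by_translates)
    show "(\<lambda>y. (0, y) :: 'a \<times> 'b) \<in> borel_measurable borel"
      by (intro borel_measurable_continuous_onI continuous_intros)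
    fix z :: "'a \<times> 'b"
    show "negligible {y. z + (0, y) \<in> N2}"
    proof (cases "h (fst z) y0 = 0")
      case False
      have "negligible {w. snd z + w \<in> {y. h (fst z) y = 0}}" by (rule trans[OF negr[OF False]])
      then show ?thesis by (rule negligible_subset) (auto simp: N2_def)
    qed (simp add: N2_def)
  qed
  moreover have "negligible N1"
  proof (rule negligible_by_translates)
    show "N1 \<in> sets borel" using \<open>closed N1\<close> by simp
    show "(\<lambda>x. (x, 0) :: 'a \<times> 'b) \<in> borel_measurable borel"
      by (intro borel_measurable_continuous_onI continuous_intros)
    fix z :: "'a \<times> 'b"
    have "negligible {w. fst z + w \<in> {x. h x y0 = 0}}" by (rule trans[OF negl[OF nz]])
    then show "negligible {x. z + (x, 0) \<in> N1}" by (rule negligible_subset) (auto simp: N1_def)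
  qed
  ultimately have "negligible (N1 \<union> N2)" by (rule negligible_Un[rotated])
  then show ?thesis by (rule negligible_subset) (auto simp: N1_def N2_def)
qed

lemma lipschitz_on_bounded_bilinear:
  fixes h :: "'a::euclidean_space \<Rightarrow> 'b::euclidean_space \<Rightarrow> 'c::euclidean_space"
    and L :: "'p::euclidean_space \<Rightarrow> 'a"
  assumes h: "bilinear h" and L: "linear L" and M: "linear M"
  shows "lipschitz_on_bounded (\<lambda>z. h (a + L z) (M z))"
  unfolding lipschitz_on_bounded_def
proof (intro allI impI)
  fix S :: "'p set" assume "bounded S"
  then obtain b where b: "b > 0" "\<And>z. z \<in> S \<Longrightarrow> norm z \<le> b" by (auto simp: bounded_pos)
  obtain H where H: "H > 0" "\<And>x y. norm (h x y) \<le> H * norm x * norm y" using bilinear_bounded_pos[OF h] by blast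
  obtain l where l: "l > 0" "\<And>z. norm (L z) \<le> l * norm z" using linear_bounded_pos[OF L] by blast
  obtain m where m: "m > 0" "\<And>z. norm (M z) \<le> m * norm z" using linear_bounded_pos[OF M] by blast
  have "(H * l * (m * b) + H * (norm a + l * b) * m)-lipschitz_on S (\<lambda>z. h (a + L z) (M z))"
  proof (rule lipschitz_onI)
    fix x y assume xy: "x \<in> S" "y \<in> S"
    have "h (a + L x) (M x) - h (a + L y) (M y) = h (L (x - y)) (M x) + h (a + L y) (M (x - y))"
      by (simp add: linear_diff[OF L] linear_diff[OF M] bilinear_ladd[OF h] bilinear_lsub[OF h] bilinear_rsub[OF h])
    then have "dist (h (a + L x) (M x)) (h (a + L y) (M y)) \<le>
        norm (h (L (x - y)) (M x)) + norm (h (a + L y) (M (x - y)))"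
      unfolding dist_norm by (metis norm_triangle_ineq)
    also have "norm (h (L (x - y)) (M x)) \<le> H * norm (L (x - y)) * norm (M x)" by (rule H)
    also have "\<dots> \<le> H * (l * dist x y) * (m * b)"
    proof (intro mult_mono)
      show "norm (L (x - y)) \<le> l * dist x y" using l(2) by (simp add: dist_norm)
      show "norm (M x) \<le> m * b" using m(2)[of x] b(2)[OF xy(1)] m(1) by (smt (verit) mult_left_mono)
    qed (use H l in auto)
    also have "norm (h (a + L y) (M (x - y))) \<le> H * norm (a + L y) * norm (M (x - y))" by (rule H)
    also have "\<dots> \<le> H * (norm a + l * b) * (m * dist x y)"
    proof (intro mult_mono)
      have "norm (L y) \<le> l * b" using l(2)[of y] b(2)[OF xy(2)] l(1) by (smt (verit) mult_left_mono)
      then show "norm (a + L y) \<le> norm a + l * b" using norm_triangle_ineq[of a "L y"] by linarith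
      show "norm (M (x - y)) \<le> m * dist x y" using m(2) by (simp add: dist_norm)
    qed (use H l b in auto)
    finally show "dist (h (a + L x) (M x)) (h (a + L y) (M y)) \<le>
        (H * l * (m * b) + H * (norm a + l * b) * m) * dist x y"
      by (simp add: algebra_simps)
  qed (use H l m b in auto)
  then show "\<exists>C. C-lipschitz_on S (\<lambda>z. h (a + L z) (M z))" by blast
qed

section \<open>Charts joining two points in adapted coordinates\<close>

definition coord_proj :: "'n::finite set \<Rightarrow> real ^ 'n \<Rightarrow> real ^ 'n" where
  "coord_proj A x = (\<chi> i. if i \<in> A then x $ i else 0)"

lemma linear_coord_proj: "linear (coord_proj A)"
  by (intro linearI) (simp_all add: coord_proj_def vec_eq_iff)

lemma coord_proj_nth_nonzero:
  assumes "coord_proj A x $ k \<noteq> 0"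
  shows "k \<in> A"
  by (rule ccontr) (use assms in \<open>simp add: coord_proj_def\<close>)

lemma coord_proj_axis: "coord_proj A (axis i 1) = (if i \<in> A then axis i 1 else 0)"
  by (auto simp: coord_proj_def axis_def vec_eq_iff)

lemma coord_proj_eq: "(\<And>i. i \<notin> A \<Longrightarrow> x $ i = 0) \<Longrightarrow> coord_proj A x = x"
  by (auto simp: coord_proj_def vec_eq_iff)

lemma coord_proj_insert_eq:
  "k \<notin> A \<Longrightarrow> x $ k = 1 \<Longrightarrow> (\<And>i. i \<notin> insert k A \<Longrightarrow> x $ i = 0) \<Longrightarrow> axis k 1 + coord_proj A x = x"
  by (auto simp: coord_proj_def vec_eq_iff axis_def)

lemma bilinear_coord_proj_eq_0:
  assumes h: "bilinear h" and z: "\<And>i j. i \<in> A \<Longrightarrow> j \<in> B \<Longrightarrow> h (axis i 1) (axis j 1) = 0"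
  shows "h (coord_proj A x) (coord_proj B y) = 0"
proof -
  have e: "coord_proj A x = (\<Sum>i\<in>A. x $ i *\<^sub>R axis i 1)" for A :: "'k::finite set" and x
    by (auto simp: coord_proj_def vec_eq_iff axis_def if_distrib[where f="\<lambda>a. _ * a"] cong: if_cong)
  show ?thesis unfolding e bilinear_sum[OF h]
    using z by (intro sum.neutral) (auto simp: bilinear_lmul[OF h] bilinear_rmul[OF h])
qed

text \<open>The first point has coordinate 1 at \<open>k\<close> and free coordinates on
  \<open>A\<close>, the second is free on \<open>B\<close>; \<open>T\<close> and \<open>T'\<close>
  carry the coordinate subspaces to the subspaces that the line has to meet. The domain is all pairs
  of vectors, whatever \<open>A\<close> and \<open>B\<close> are, so that all charts have one
  type.\<close>

definition bivec_chart ::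
    "(real ^ ('n::{finite,linorder}) \<Rightarrow> real ^ ('n::{finite,linorder})) \<Rightarrow> 'n \<Rightarrow> 'n set \<Rightarrow>
     (real ^ ('n::{finite,linorder}) \<Rightarrow> real ^ ('n::{finite,linorder})) \<Rightarrow> 'n set \<Rightarrow>
     (real ^ ('n::{finite,linorder})) \<times> (real ^ ('n::{finite,linorder})) \<Rightarrow> 'n ext" where
  "bivec_chart T k A T' B z = bivec (T (axis k 1 + coord_proj A (fst z))) (T' (coord_proj B (snd z)))"

lemma bivec_chart_expand:
  assumes "linear T"
  shows "bivec_chart T k A T' B z =
    bivec (T (axis k 1) + T (coord_proj A (fst z))) (T' (coord_proj B (snd z)))"
  by (simp add: bivec_chart_def linear_add[OF assms])

lemma linear_T_proj_fst: "linear T \<Longrightarrow> linear (\<lambda>z. T (coord_proj A (fst z)))"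
  using linear_compose[OF linear_compose[OF linear_fst linear_coord_proj]] by (simp add: o_def)

lemma linear_T_proj_snd: "linear T \<Longrightarrow> linear (\<lambda>z. T (coord_proj A (snd z)))"
  using linear_compose[OF linear_compose[OF linear_snd linear_coord_proj]] by (simp add: o_def)

lemma lipschitz_on_bounded_bivec_chart:
  assumes "linear T" "linear T'"
  shows "lipschitz_on_bounded (bivec_chart T k A T' B)"
  using lipschitz_on_bounded_bilinear[OF bilinear_bivec linear_T_proj_fst[OF assms(1)] linear_T_proj_snd[OF assms(2)]]
  by (simp add: bivec_chart_expand[OF assms(1), abs_def])

definition coord_basis :: "'n::finite set \<Rightarrow> 'n set \<Rightarrow> ((real, 'n) vec \<times> (real, 'n) vec) set" where
  "coord_basis A B = (\<lambda>i. (axis i 1, 0)) ` A \<union> (\<lambda>i. (0, axis i 1)) ` B"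

lemma coord_basis_subset: "coord_basis A B \<subseteq> Basis"
  by (auto simp: coord_basis_def Basis_prod_def Basis_vec_def)

lemma card_coord_basis: "card (coord_basis A B) = card A + card B"
  unfolding coord_basis_def
  by (subst card_Un_disjoint) (auto simp: card_image inj_on_def axis_eq_axis)

lemma coord_basis_agree:
  assumes "\<forall>b\<in>coord_basis A B. x \<bullet> b = y \<bullet> b"
  shows "coord_proj A (fst x) = coord_proj A (fst y)" "coord_proj B (snd x) = coord_proj B (snd y)"
proof -
  have "fst x $ i = fst y $ i" if "i \<in> A" for i
    using assms that by (auto simp: coord_basis_def ball_Un inner_prod_def inner_axis)
  moreover have "snd x $ i = snd y $ i" if "i \<in> B" for i
    using assms that by (auto simp: coord_basis_def ball_Un inner_prod_def inner_axis)
  ultimately show "coord_proj A (fst x) = coord_proj A (fst y)" "coord_proj B (snd x) = coord_proj B (snd y)"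
    by (auto simp: coord_proj_def vec_eq_iff)
qed

type_synonym 'n bivec_charts =
  "(((real, 'n) vec \<times> (real, 'n) vec \<Rightarrow> 'n ext) \<times> ((real, 'n) vec \<times> (real, 'n) vec) set) set"

text \<open>The hypothesis on \<open>H\<close> says, dually, that the products of the basis vectors
  in use span at least \<open>H\<close>. An \<open>m\<close> that does not vanish on
  \<open>H\<close> then cannot kill the whole chart: the parameter 0 in the first factor isolates
  the products with \<open>k\<close>, and subtracting these isolates the others. As the function is
  biaffine, one nonzero value suffices.\<close>

lemma chart_bivec_chart:
  fixes T :: "real ^ ('n::{finite,linorder}) \<Rightarrow> real ^ ('n::{finite,linorder})"
  assumes T: "linear T" and T': "linear T'" and k: "k \<notin> A"
    and H: "\<And>m p. (\<And>i j. i \<in> insert k A \<Longrightarrow> j \<in> B \<Longrightarrow> bivec (T (axis i 1)) (T' (axis j 1)) \<bullet> m = 0) \<Longrightarrow>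
      p \<in> H \<Longrightarrow> p \<bullet> m = 0"
  shows "chart (card A + card B) H (bivec_chart T k A T' B) UNIV"
  unfolding chart_def
proof (intro conjI allI impI)
  show "lipschitz_on_bounded (bivec_chart T k A T' B)" by (rule lipschitz_on_bounded_bivec_chart[OF T T'])
  show "\<exists>I\<subseteq>Basis. card I = card A + card B \<and> (\<forall>x y. (\<forall>b\<in>I. x \<bullet> b = y \<bullet> b) \<longrightarrow>
     bivec_chart T k A T' B x = bivec_chart T k A T' B y \<and> (x \<in> UNIV \<longleftrightarrow> y \<in> UNIV))"
    using coord_basis_agree[of A B]
    by (intro exI[of _ "coord_basis A B"]) (auto simp: coord_basis_subset card_coord_basis bivec_chart_def)
  fix m assume m: "\<exists>p\<in>H. p \<bullet> m \<noteq> 0"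
  let ?h = "\<lambda>x y. bivec_chart T k A T' B (x, y) \<bullet> m"
  obtain x0 y0 where nz: "?h x0 y0 \<noteq> 0"
  proof (rule ccontr)
    assume "\<not> thesis"
    with that have 0: "?h x y = 0" for x y by blast
    have k0: "bivec (T (axis k 1)) (T' (axis j 1)) \<bullet> m = 0" if "j \<in> B" for j
      using 0[of 0 "axis j 1"] that
      by (simp add: bivec_chart_expand[OF T] coord_proj_axis linear_0[OF linear_coord_proj] linear_0[OF T])
    have "bivec (T (axis i 1)) (T' (axis j 1)) \<bullet> m = 0" if "i \<in> insert k A" "j \<in> B" for i j
    proof (cases "i = k")
      case False
      then show ?thesis using 0[of "axis i 1" "axis j 1"] k0 that
        by (simp add: bivec_chart_expand[OF T] coord_proj_axis bivec_simps inner_add_left)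
    qed (use k0 that in auto)
    then show False using m H by blast
  qed
  have "negligible {z. ?h (fst z) (snd z) = 0}"
  proof (rule negligible_biaffine_zero)
    show "continuous_on UNIV (\<lambda>z. ?h (fst z) (snd z))"
      using lipschitz_on_bounded_continuous[OF lipschitz_on_bounded_bivec_chart[OF T T', of k A B]]
      by (auto intro!: continuous_intros)
    show "?h x0 y0 \<noteq> 0" by (rule nz)
    show "\<exists>L c. linear L \<and> (\<forall>x. ?h x y = L x + c)" for y
    proof (intro exI conjI allI)
      show "linear (\<lambda>x. bivec (T (coord_proj A x)) (T' (coord_proj B y)) \<bullet> m)"
        using T linear_coord_proj[of A]
        by (intro linearI) (simp_all add: linear_add linear_scale bivec_simps inner_add_left)
      show "?h x y = bivec (T (coord_proj A x)) (T' (coord_proj B y)) \<bullet> m +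
        bivec (T (axis k 1)) (T' (coord_proj B y)) \<bullet> m" for x
        by (simp add: bivec_chart_expand[OF T] bivec_simps inner_add_left)
    qed
    show "\<exists>L c. linear L \<and> (\<forall>y. ?h x y = L y + c)" for x
    proof (intro exI conjI allI)
      show "linear (\<lambda>y. ?h x y)"
        using T' linear_coord_proj[of B]
        by (intro linearI) (simp_all add: bivec_chart_def linear_add linear_scale bivec_simps inner_add_left)
      show "?h x y = ?h x y + 0" for y by simp
    qed
  qed
  then show "negligible {x \<in> UNIV. bivec_chart T k A T' B x \<bullet> m = 0}" by simp
qed simp

text \<open>A family with one parameter too few gets the spare coordinate \<open>k\<close> as a
  dummy that has to be 0. This raises the count by one and makes the domain null, so the clause on
  linear equations holds for any \<open>H\<close>.\<close>

lemma chart_bivec_chart_null: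
  fixes T :: "real ^ ('n::{finite,linorder}) \<Rightarrow> real ^ ('n::{finite,linorder})"
  assumes T: "linear T" and T': "linear T'" and k: "k \<notin> A"
  shows "chart (card A + card B + 1) H (bivec_chart T k A T' B) {z. fst z $ k = 0}"
  unfolding chart_def
proof (intro conjI allI impI)
  show "lipschitz_on_bounded (bivec_chart T k A T' B)" by (rule lipschitz_on_bounded_bivec_chart[OF T T'])
  show "closed {z :: (real, 'n) vec \<times> (real, 'n) vec. fst z $ k = 0}"
    by (intro closed_Collect_eq continuous_intros)
  show "\<exists>I\<subseteq>Basis. card I = card A + card B + 1 \<and> (\<forall>x y. (\<forall>b\<in>I. x \<bullet> b = y \<bullet> b) \<longrightarrow>
     bivec_chart T k A T' B x = bivec_chart T k A T' B y \<and>
     (x \<in> {z. fst z $ k = 0} \<longleftrightarrow> y \<in> {z. fst z $ k = 0}))"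
  proof (intro exI[of _ "coord_basis (insert k A) B"] conjI allI impI)
    show "card (coord_basis (insert k A) B) = card A + card B + 1" using k by (simp add: card_coord_basis)
    fix x y :: "(real, 'n) vec \<times> (real, 'n) vec" assume *: "\<forall>b\<in>coord_basis (insert k A) B. x \<bullet> b = y \<bullet> b"
    then have "\<forall>b\<in>coord_basis A B. x \<bullet> b = y \<bullet> b" by (auto simp: coord_basis_def)
    from coord_basis_agree[OF this] show "bivec_chart T k A T' B x = bivec_chart T k A T' B y"
      by (simp add: bivec_chart_def)
    show "x \<in> {z. fst z $ k = 0} \<longleftrightarrow> y \<in> {z. fst z $ k = 0}"
      using * by (auto simp: coord_basis_def inner_prod_def inner_axis)
  qed (rule coord_basis_subset)
  fix m
  have "{z :: (real, 'n) vec \<times> (real, 'n) vec. fst z $ k = 0} = {z. z \<bullet> (axis k 1, 0) = 0}"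
    by (auto simp: inner_prod_def inner_axis)
  moreover have "negligible {z :: (real, 'n) vec \<times> (real, 'n) vec. (axis k 1, 0) \<bullet> z = 0}"
    by (rule negligible_hyperplane) (auto simp: prod_eq_iff axis_eq_0_iff)
  ultimately have "negligible {z :: (real, 'n) vec \<times> (real, 'n) vec. fst z $ k = 0}" by (simp add: inner_commute)
  then show "negligible {x \<in> {z. fst z $ k = 0}. bivec_chart T k A T' B x \<bullet> m = 0}"
    by (rule negligible_subset) auto
qed

text \<open>The normal form is a reduced basis of the line: the first point has coordinates 1 at
  \<open>a\<close> and 0 at \<open>a'\<close>, the second has 0 at \<open>a\<close>. This leaves
  \<open>CARD('n) - 2\<close> and \<open>CARD('n) - 1\<close> parameters; the scale of the
  representative is carried by the second point.\<close>

lemma charted_grassmann: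
  obtains C :: "'n::{finite,linorder} bivec_charts"
  where "charted (2 * CARD('n) - 3) (ext_power 2) (grassmann 2) C"
proof
  define C where "C = (\<lambda>(a, a'). (bivec_chart id a (- {a, a'}) id (- {a}), UNIV :: ((real, 'n) vec \<times> (real, 'n) vec) set)) `
    {(a, a' :: 'n). a \<noteq> a'}"
  show "charted (2 * CARD('n) - 3) (ext_power 2) (grassmann 2) C"
    unfolding charted_def
  proof (intro conjI)
    show "finite C" by (simp add: C_def)
    show "\<forall>(\<phi>, S)\<in>C. chart (2 * CARD('n) - 3) (ext_power 2) \<phi> S"
    proof (clarsimp simp: C_def)
      fix a a' :: 'n assume aa: "a \<noteq> a'"
      have ca: "card (- {a, a'}) = CARD('n) - 2" "card (- {a}) = CARD('n) - 1"
        using aa by (simp_all add: Compl_eq_Diff_UNIV card_Diff_subset)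
      have "card {a, a'} \<le> CARD('n)" by (intro card_mono) auto
      then have n2: "CARD('n) \<ge> 2" using aa by simp
      have "chart (card (- {a, a'}) + card (- {a})) (ext_power 2) (bivec_chart id a (- {a, a'}) id (- {a})) UNIV"
      proof (rule chart_bivec_chart)
        fix m p :: "'n ext"
        assume z: "\<And>i j. i \<in> insert a (- {a, a'}) \<Longrightarrow> j \<in> - {a} \<Longrightarrow> bivec (id (axis i 1)) (id (axis j 1)) \<bullet> m = 0"
          and p: "p \<in> ext_power 2"
        have z': "bivec (axis i 1) (axis j 1) \<bullet> m = 0" if "i \<noteq> a'" "j \<noteq> a" for i j using z[of i j] that by auto
        show "p \<bullet> m = 0"
        proof (rule ext_power_2_inner_eq_0[OF _ p])
          fix i j :: 'n assume "i \<noteq> j"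
          show "bivec (axis i 1) (axis j 1) \<bullet> m = 0"
          proof (cases "i \<noteq> a' \<and> j \<noteq> a")
            case False
            \<comment> \<open>The chart misses the ordered pairs with \<open>i = a'\<close> or
              \<open>j = a\<close>; reversing such a pair gives one that it contains.\<close>
            then have "j \<noteq> a' \<and> i \<noteq> a" using \<open>i \<noteq> j\<close> aa by auto
            then show ?thesis using z'[of j i] bivec_commute[of "axis i 1" "axis j 1"] by simp
          qed (use z' in auto)
        qed
      qed (auto simp: linear_id)
      then show "chart (2 * CARD('n) - 3) (ext_power 2) (bivec_chart id a (- {a, a'}) id (- {a})) UNIV"
        using n2 by (simp add: ca numeral_eq_Suc) 
    qed
    show "grassmann 2 \<subseteq> (\<Union>(\<phi>, S)\<in>C. \<phi> ` S)"
    proof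
      fix q :: "'n ext" assume "q \<in> grassmann 2"
      then obtain x y where q: "q = bivec x y" "q \<noteq> 0" by (auto simp: grassmann_2_iff)
      then have "x \<noteq> 0" by (auto simp: bivec_simps)
      then obtain a where a: "x $ a \<noteq> 0" by (auto simp: vec_eq_iff)
      \<comment> \<open>The factor \<open>x $ a\<close> compensates the scaling of \<open>x\<close>
        to coordinate 1, and removing a multiple of \<open>x\<close> does not change the
        bivector.\<close>
      define y' where "y' = x $ a *\<^sub>R y - y $ a *\<^sub>R x"
      define x' where "x' = inverse (x $ a) *\<^sub>R x"
      have q': "q = bivec x' y'" using a by (simp add: q(1) x'_def y'_def bivec_simps)
      have 1: "x' $ a = 1" "y' $ a = 0" using a by (simp_all add: x'_def y'_def)
      have "y' \<noteq> 0" using q' q(2) by (auto simp: bivec_simps)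
      then obtain a' where a': "y' $ a' \<noteq> 0" by (auto simp: vec_eq_iff)
      define x'' where "x'' = x' - (x' $ a' / y' $ a') *\<^sub>R y'"
      have q'': "q = bivec x'' y'" by (simp add: q' x''_def bivec_simps)
      have aa: "a \<noteq> a'" using 1 a' by auto
      have 2: "x'' $ a = 1" "x'' $ a' = 0" using 1 a' by (simp_all add: x''_def)
      have "axis a 1 + coord_proj (- {a, a'}) x'' = x''" using 2 by (intro coord_proj_insert_eq) auto
      moreover have "coord_proj (- {a}) y' = y'" using 1 by (intro coord_proj_eq) auto
      ultimately have "q = bivec_chart id a (- {a, a'}) id (- {a}) (x'', y')" by (simp add: q'' bivec_chart_def)
      then show "q \<in> (\<Union>(\<phi>, S)\<in>C. \<phi> ` S)" using aa by (auto simp: C_def)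
    qed
  qed
qed

text \<open>Extend a basis of \<open>U\<close> to one of the whole space and index it by
  \<open>'n\<close>. In these coordinates \<open>U\<close> is the coordinate subspace of
  \<open>A\<close>, so the normalisations can be done coordinatewise.\<close>

lemma adapted_basis:
  fixes U :: "(real ^ 'n::finite) set"
  assumes "subspace U"
  obtains A :: "'n set" and T :: "real ^ 'n \<Rightarrow> real ^ 'n" where "linear T" "surj T" "card A = dim U" "range (\<lambda>x. T (coord_proj A x)) = U"
proof -
  obtain b where b: "b \<subseteq> U" "independent b" "U \<subseteq> span b" "card b = dim U" using basis_exists by blast
  obtain b' where b': "b \<subseteq> b'" "independent b'" "UNIV \<subseteq> span b'"
    using maximal_independent_subset_extend[OF subset_UNIV b(2)] by metis
  have cb': "card b' = CARD('n)" using b' dim_eq_card_independent[OF b'(2)]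
    by (metis DIM_cart DIM_real dim_UNIV dim_span mult.right_neutral top.extremum_uniqueI)
  have "finite b'" using b'(2) by (rule independent_imp_finite)
  then obtain h :: "'n \<Rightarrow> real ^ 'n" where h: "bij_betw h UNIV b'"
    using cb' finite_same_card_bij[of "UNIV :: 'n set" b'] by auto
  define A where "A = {i. h i \<in> b}"
  have hA: "h ` A = b" using h b'(1) by (auto simp: A_def bij_betw_def)
  have inj: "inj_on h A" using h by (auto simp: bij_betw_def inj_on_def)
  define T where "T x = (\<Sum>i\<in>UNIV. x $ i *\<^sub>R h i)" for x
  have T: "linear T" unfolding T_def
    by (intro linearI) (simp_all add: sum.distrib scaleR_add_left scaleR_sum_right)
  have Tax: "T (axis i 1) = h i" for i
    by (simp add: T_def axis_def if_distrib[where f="\<lambda>a. a *\<^sub>R _"] cong: if_cong)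
  have "span b' \<subseteq> range T"
    by (rule span_minimal) (use h Tax linear_subspace_image[OF T subspace_UNIV] in \<open>auto simp: bij_betw_def\<close>, metis rangeI)
  then have "surj T" using b'(3) by auto
  moreover have "card A = dim U" using card_image[OF inj] hA b(4) by simp
  moreover have "range (\<lambda>x. T (coord_proj A x)) = U"
  proof
    have e: "T (coord_proj A x) = (\<Sum>i\<in>A. x $ i *\<^sub>R h i)" for x
      unfolding T_def coord_proj_def by (auto intro!: sum.mono_neutral_cong_right)
    show "range (\<lambda>x. T (coord_proj A x)) \<subseteq> U"
      using hA b(1) by (auto simp: e intro!: subspace_sum[OF assms] subspace_scale[OF assms])
    have lin: "linear (\<lambda>x. T (coord_proj A x))"
      using linear_compose[OF linear_coord_proj T] by (simp add: o_def)
    have "b \<subseteq> range (\<lambda>x. T (coord_proj A x))"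
    proof
      fix v assume "v \<in> b"
      then obtain i where "i \<in> A" "v = h i" using hA by auto
      then have "v = T (coord_proj A (axis i 1))" by (simp add: coord_proj_axis Tax)
      then show "v \<in> range (\<lambda>x. T (coord_proj A x))" by blast
    qed
    then have "span b \<subseteq> range (\<lambda>x. T (coord_proj A x))"
      by (rule span_minimal) (rule linear_subspace_image[OF lin subspace_UNIV])
    then show "U \<subseteq> range (\<lambda>x. T (coord_proj A x))" using b(3) by blast
  qed
  ultimately show ?thesis using that[OF T] by blast
qed

section \<open>Lines meeting subspaces of codimension 2\<close>

lemma dim_annihilator:
  fixes B :: "(real ^ 'n::finite) set"
  assumes "independent B"
  shows "dim {x. \<forall>v\<in>B. x \<bullet> v = 0} + card B = CARD('n)"
proof -
  have "dim {y \<in> UNIV. \<forall>x\<in>span B. orthogonal x y} + dim (span B) = dim (UNIV :: (real ^ 'n) set)"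
    by (rule dim_subspace_orthogonal_to_vectors) auto
  moreover have "{y \<in> UNIV. \<forall>x\<in>span B. orthogonal x y} = {x. \<forall>v\<in>B. x \<bullet> v = 0}"
  proof (intro set_eqI iffI)
    fix y assume "y \<in> {x. \<forall>v\<in>B. x \<bullet> v = 0}"
    then have "orthogonal y x" if "x \<in> span B" for x
      using that by (intro orthogonal_to_span[OF that]) (auto simp: orthogonal_def)
    then show "y \<in> {y \<in> UNIV. \<forall>x\<in>span B. orthogonal x y}" by (auto simp: orthogonal_commute)
  qed (auto simp: orthogonal_def inner_commute span_base)
  ultimately show ?thesis using dim_eq_card_independent[OF assms] by simp
qed

text \<open>Take the component of \<open>v\<close> orthogonal to the other vectors and rescale
  it.\<close>

lemma dual_vector:
  fixes B :: "'a::euclidean_space set"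
  assumes "independent B" "v \<in> B"
  shows "\<exists>w. w \<bullet> v = 1 \<and> (\<forall>u\<in>B - {v}. w \<bullet> u = 0)"
proof -
  obtain y z where yz: "y \<in> span (B - {v})" "\<And>w. w \<in> span (B - {v}) \<Longrightarrow> orthogonal z w" "v = y + z"
    using orthogonal_subspace_decomp_exists by blast
  have "z \<noteq> 0" using yz assms by (auto simp: dependent_def)
  moreover have "z \<bullet> v = z \<bullet> z" using yz(2)[OF yz(1)] by (simp add: yz(3) inner_add_right orthogonal_def)
  moreover have "z \<bullet> u = 0" if "u \<in> B" "u \<noteq> v" for u
    using yz(2)[of u] that by (auto simp: orthogonal_def span_base)
  ultimately show ?thesis by (intro exI[of _ "inverse (z \<bullet> z) *\<^sub>R z"]) simp
qed

text \<open>By \<open>inner_bivec\<close> a 2 by 2 determinant vanishes: its row for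
  \<open>x\<close> is zero or its row for \<open>y\<close> is a multiple of that row. So the line
  meets the common kernel of \<open>a\<close> and \<open>b\<close> in \<open>x\<close> or in a point
  \<open>y - t *\<^sub>R x\<close>.\<close>

lemma bivec_meets:
  assumes "bivec x y \<bullet> bivec a b = 0"
  shows "x \<bullet> a = 0 \<and> x \<bullet> b = 0 \<or> (\<exists>t. (y - t *\<^sub>R x) \<bullet> a = 0 \<and> (y - t *\<^sub>R x) \<bullet> b = 0)"
proof (cases "x \<bullet> a = 0")
  case False
  have "(y - ((y \<bullet> a) / (x \<bullet> a)) *\<^sub>R x) \<bullet> a = 0 \<and> (y - ((y \<bullet> a) / (x \<bullet> a)) *\<^sub>R x) \<bullet> b = 0"
    using assms False by (simp add: inner_bivec inner_diff_left field_simps)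
  then show ?thesis by blast
next
  case True
  show ?thesis
  proof (cases "x \<bullet> b = 0")
    case False
    have "(y - ((y \<bullet> b) / (x \<bullet> b)) *\<^sub>R x) \<bullet> a = 0 \<and> (y - ((y \<bullet> b) / (x \<bullet> b)) *\<^sub>R x) \<bullet> b = 0"
      using assms False True by (simp add: inner_bivec inner_diff_left field_simps)
    then show ?thesis by blast
  qed (use True in simp)
qed

lemma bivec_meets':
  assumes "bivec x y \<bullet> bivec a b = 0"
  obtains u v where "bivec x y = bivec u v" "u \<bullet> a = 0" "u \<bullet> b = 0"
proof -
  from bivec_meets[OF assms] consider "x \<bullet> a = 0" "x \<bullet> b = 0"
    | t where "(y - t *\<^sub>R x) \<bullet> a = 0" "(y - t *\<^sub>R x) \<bullet> b = 0" by blast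
  then show ?thesis
  proof cases
    case 1
    then show ?thesis using that by blast
  next
    case 2
    have "bivec x y = bivec (y - t *\<^sub>R x) (- x)" using bivec_commute[of x y] by (simp add: bivec_simps)
    then show ?thesis using that 2 by blast
  qed
qed

text \<open>Lines through a point of a subspace \<open>U\<close>: scale the point so that its \<open>k\<close>-th coordinate is 1,
  then eliminate that coordinate from the second point.\<close>

lemma bivec_chart_cover:
  assumes T: "linear T" "surj T" and U: "u \<in> range (\<lambda>x. T (coord_proj A x))" and nz: "bivec u y \<noteq> 0"
  obtains k z where "k \<in> A" "fst z $ k = 0" "bivec u y = bivec_chart T k (A - {k}) T (- {k}) z"
proof -
  obtain \<xi> where u: "u = T (coord_proj A \<xi>)" using U by blast
  obtain \<eta> where y: "y = T \<eta>" using T(2) by (metis surjD)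
  define \<zeta> where "\<zeta> = coord_proj A \<xi>"
  have "\<zeta> \<noteq> 0" using nz by (auto simp: u \<zeta>_def linear_0[OF T(1)] bivec_simps)
  then obtain k where k: "\<zeta> $ k \<noteq> 0" by (auto simp: vec_eq_iff)
  then have kA: "k \<in> A" unfolding \<zeta>_def by (rule coord_proj_nth_nonzero)
  define x' where "x' = inverse (\<zeta> $ k) *\<^sub>R \<zeta>"
  define y' where "y' = \<zeta> $ k *\<^sub>R \<eta> - \<eta> $ k *\<^sub>R \<zeta>"
  have "bivec u y = bivec (T x') (T y')"
    using k by (simp add: u y \<zeta>_def[symmetric] x'_def y'_def linear_scale[OF T(1)] linear_diff[OF T(1)] bivec_simps)
  \<comment> \<open>Shifting by \<open>axis k 1\<close> changes no free coordinate and makes the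
    \<open>k\<close>-th parameter 0, as the domains of the null charts require.\<close>
  moreover have "axis k 1 + coord_proj (A - {k}) (x' - axis k 1) = x'"
    using k kA by (auto simp: vec_eq_iff coord_proj_def axis_def x'_def \<zeta>_def)
  moreover have "coord_proj (- {k}) y' = y'" by (intro coord_proj_eq) (auto simp: y'_def)
  ultimately have "bivec u y = bivec_chart T k (A - {k}) T (- {k}) (x' - axis k 1, y')"
    by (simp add: bivec_chart_def)
  moreover have "fst (x' - axis k 1, y') $ k = 0" using k by (simp add: x'_def)
  ultimately show ?thesis using that kA by blast
qed

text \<open>The first point runs through the codimension 2 subspace \<open>U\<close>, normalised at
  \<open>k\<close>, which gives \<open>CARD('n) - 3\<close> parameters; the second contributes
  \<open>CARD('n) - 1\<close>. A form killing all these lines has \<open>U\<close> in its radical,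
  so it is a multiple of the rod form and vanishes on the hyperplane.\<close>

lemma charted_grassmann_one_rod:
  fixes a b :: "real ^ ('n::{finite,linorder})"
  assumes ab: "a \<bullet> a = 1" "b \<bullet> b = 1" "a \<bullet> b = 0"
  obtains C :: "'n::{finite,linorder} bivec_charts"
  where "charted (2 * CARD('n) - 4) {p \<in> ext_power 2. p \<bullet> bivec a b = 0}
    {p \<in> grassmann 2. p \<bullet> bivec a b = 0} C"
proof -
  define U where "U = {x. x \<bullet> a = 0 \<and> x \<bullet> b = 0}"
  have "subspace U" by (auto simp: U_def subspace_def inner_add_left)
  then obtain A :: "'n set" and T where T: "linear T" "surj T" and A: "card A = dim U"
    "range (\<lambda>x. T (coord_proj A x)) = U" by (rule adapted_basis)
  have "a \<noteq> b" using ab by auto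
  have "pairwise orthogonal {a, b}" using ab by (auto simp: pairwise_def orthogonal_def inner_commute)
  then have "independent {a, b}" by (rule pairwise_orthogonal_independent) (use ab in auto)
  from dim_annihilator[OF this] have dU: "card A + 2 = CARD('n)" using \<open>a \<noteq> b\<close> by (simp add: A U_def)
  define C where "C = (\<lambda>k. (bivec_chart T k (A - {k}) T (- {k}), UNIV :: ((real, 'n) vec \<times> (real, 'n) vec) set)) ` A"
  have "charted (2 * CARD('n) - 4) {p \<in> ext_power 2. p \<bullet> bivec a b = 0}
    {p \<in> grassmann 2. p \<bullet> bivec a b = 0} C"
    unfolding charted_def
  proof (intro conjI)
    show "finite C" by (simp add: C_def)
    show "\<forall>(\<phi>, S)\<in>C. chart (2 * CARD('n) - 4) {p \<in> ext_power 2. p \<bullet> bivec a b = 0} \<phi> S"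
    proof (clarsimp simp: C_def)
      fix k assume k: "k \<in> A"
      have "card A > 0" using k by (auto simp: card_gt_0_iff)
      then have card: "card (A - {k}) + card (- {k}) = 2 * CARD('n) - 4"
        using k dU by (simp add: Compl_eq_Diff_UNIV card_Diff_subset)
      have "chart (card (A - {k}) + card (- {k})) {p \<in> ext_power 2. p \<bullet> bivec a b = 0}
         (bivec_chart T k (A - {k}) T (- {k})) UNIV"
      proof (rule chart_bivec_chart[OF T(1) T(1)])
        fix m p :: "'n ext"
        assume z: "\<And>i j. i \<in> insert k (A - {k}) \<Longrightarrow> j \<in> - {k} \<Longrightarrow> bivec (T (axis i 1)) (T (axis j 1)) \<bullet> m = 0"
          and p: "p \<in> {p \<in> ext_power 2. p \<bullet> bivec a b = 0}"
        \<comment> \<open>The second point lacks the coordinate \<open>k\<close>, but the products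
          with the \<open>k\<close>-th vector are obtained by swapping the factors.\<close>
        have z': "bivec (T (axis i 1)) (T (axis j 1)) \<bullet> m = 0" if "i \<in> A" for i j
        proof (cases "j = k")
          case True
          then show ?thesis using z[of k i] that k bivec_commute[of "T (axis k 1)" "T (axis i 1)"]
            by (cases "i = k") auto
        qed (use z that in auto)
        have bl: "bilinear (\<lambda>x y. bivec (T x) (T y) \<bullet> m)"
          by (auto simp: bilinear_def bivec_simps inner_add_left linear_add[OF T(1)] linear_scale[OF T(1)] intro!: linearI)
        have "bivec u y \<bullet> m = 0" if u: "u \<bullet> a = 0" "u \<bullet> b = 0" for u y
        proof -
          have "u \<in> U" using u by (simp add: U_def)
          then obtain \<xi> where "u = T (coord_proj A \<xi>)" using A(2) by blast
          moreover obtain \<eta> where "y = T \<eta>" using T(2) by (metis surjD)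
          moreover have "coord_proj UNIV \<eta> = \<eta>" by (rule coord_proj_eq) simp
          ultimately show ?thesis using bilinear_coord_proj_eq_0[OF bl, of A UNIV \<xi> \<eta>] z' by simp
        qed
        from form_with_kernel_on_ext_power[OF ab this, of p] show "p \<bullet> m = 0" using p by simp
      qed simp
      then show "chart (2 * CARD('n) - 4) {p \<in> ext_power 2. p \<bullet> bivec a b = 0} (bivec_chart T k (A - {k}) T (- {k})) UNIV"
        by (simp only: card)
    qed
    show "{p \<in> grassmann 2. p \<bullet> bivec a b = 0} \<subseteq> (\<Union>(\<phi>, S)\<in>C. \<phi> ` S)"
    proof clarify
      fix q :: "'n ext" assume "q \<in> grassmann 2" and q0: "q \<bullet> bivec a b = 0"
      then obtain x y where q: "q = bivec x y" "q \<noteq> 0" by (auto simp: grassmann_2_iff)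
      with q0 obtain u v where uv: "q = bivec u v" "u \<bullet> a = 0" "u \<bullet> b = 0" using bivec_meets' by metis
      have "u \<in> range (\<lambda>x. T (coord_proj A x))" unfolding A(2) using uv by (simp add: U_def)
      moreover have "bivec u v \<noteq> 0" using q uv by simp
      ultimately obtain k z where "k \<in> A" "bivec u v = bivec_chart T k (A - {k}) T (- {k}) z"
        using bivec_chart_cover[OF T] by metis
      then show "q \<in> (\<Union>(\<phi>, S)\<in>C. \<phi> ` S)" by (auto simp: C_def uv(1))
    qed
  qed
  then show ?thesis using that by blast
qed

text \<open>
  A line meeting \<open>U = {a, b}\<^sup>\<bottom>\<close> and \<open>U' = {a', b'}\<^sup>\<bottom>\<close> joins a point of \<open>U\<close> to a point of \<open>U'\<close>,
  or else it passes through \<open>U \<inter> U'\<close>; the latter lines form a family of smaller dimension.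
\<close>

lemma charted_grassmann_two_rods:
  fixes a b a' b' :: "real ^ ('n::{finite,linorder})"
  assumes dU: "dim {x. x \<bullet> a = 0 \<and> x \<bullet> b = 0} + 2 = CARD('n)"
    and dU': "dim {x. x \<bullet> a' = 0 \<and> x \<bullet> b' = 0} + 2 = CARD('n)"
    and dI: "{x. x \<bullet> a = 0 \<and> x \<bullet> b = 0} \<inter> {x. x \<bullet> a' = 0 \<and> x \<bullet> b' = 0} \<subseteq> {0} \<or>
      dim ({x. x \<bullet> a = 0 \<and> x \<bullet> b = 0} \<inter> {x. x \<bullet> a' = 0 \<and> x \<bullet> b' = 0}) + 4 = CARD('n)"
    and sp: "\<And>m p. (\<And>u u'. u \<bullet> a = 0 \<Longrightarrow> u \<bullet> b = 0 \<Longrightarrow> u' \<bullet> a' = 0 \<Longrightarrow> u' \<bullet> b' = 0 \<Longrightarrow> bivec u u' \<bullet> m = 0) \<Longrightarrow>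
      p \<in> ext_power 2 \<Longrightarrow> p \<bullet> bivec a b = 0 \<Longrightarrow> p \<bullet> bivec a' b' = 0 \<Longrightarrow> p \<bullet> m = 0"
  obtains C :: "'n::{finite,linorder} bivec_charts"
  where "charted (2 * CARD('n) - 5) {p \<in> ext_power 2. p \<bullet> bivec a b = 0 \<and> p \<bullet> bivec a' b' = 0}
    {p \<in> grassmann 2. p \<bullet> bivec a b = 0 \<and> p \<bullet> bivec a' b' = 0} C"
proof -
  define U where "U = {x. x \<bullet> a = 0 \<and> x \<bullet> b = 0}"
  define U' where "U' = {x. x \<bullet> a' = 0 \<and> x \<bullet> b' = 0}"
  define H where "H = {p \<in> ext_power 2. p \<bullet> bivec a b = 0 \<and> p \<bullet> bivec a' b' = 0}"
  have U: "subspace U" by (auto simp: U_def subspace_def inner_add_left)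
  then obtain A :: "'n set" and T where T: "linear T" and A: "card A = dim U"
    "range (\<lambda>x. T (coord_proj A x)) = U" by (rule adapted_basis)
  have U': "subspace U'" by (auto simp: U'_def subspace_def inner_add_left)
  then obtain A' :: "'n set" and T' where T': "linear T'" and A': "card A' = dim U'"
    "range (\<lambda>x. T' (coord_proj A' x)) = U'" by (rule adapted_basis)
  have "subspace (U \<inter> U')" using U U' by (rule subspace_inter)
  then obtain A0 :: "'n set" and T0 where T0: "linear T0" "surj T0" and A0: "card A0 = dim (U \<inter> U')"
    "range (\<lambda>x. T0 (coord_proj A0 x)) = U \<inter> U'" by (rule adapted_basis)
  define C where "C = (\<lambda>k. (bivec_chart T k (A - {k}) T' A', UNIV :: ((real, 'n) vec \<times> (real, 'n) vec) set)) ` A \<union>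
    (\<lambda>k. (bivec_chart T0 k (A0 - {k}) T0 (- {k}), {z :: (real, 'n) vec \<times> (real, 'n) vec. fst z $ k = 0})) ` A0"
  have "charted (2 * CARD('n) - 5) H {p \<in> grassmann 2. p \<bullet> bivec a b = 0 \<and> p \<bullet> bivec a' b' = 0} C"
    unfolding charted_def
  proof (intro conjI)
    show "finite C" by (simp add: C_def)
    have "chart (2 * CARD('n) - 5) H (bivec_chart T k (A - {k}) T' A') UNIV" if k: "k \<in> A" for k
    proof -
      have "card A > 0" using k by (auto simp: card_gt_0_iff)
      then have card: "card (A - {k}) + card A' = 2 * CARD('n) - 5"
        using k dU dU' A(1) A'(1) by (simp add: U_def U'_def)
      have "chart (card (A - {k}) + card A') H (bivec_chart T k (A - {k}) T' A') UNIV"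
      proof (rule chart_bivec_chart[OF T T'])
        fix m p :: "'n ext"
        assume z: "\<And>i j. i \<in> insert k (A - {k}) \<Longrightarrow> j \<in> A' \<Longrightarrow> bivec (T (axis i 1)) (T' (axis j 1)) \<bullet> m = 0"
          and p: "p \<in> H"
        have bl: "bilinear (\<lambda>x y. bivec (T x) (T' y) \<bullet> m)"
          by (auto simp: bilinear_def bivec_simps inner_add_left linear_add[OF T] linear_scale[OF T]
              linear_add[OF T'] linear_scale[OF T'] intro!: linearI)
        have "bivec u u' \<bullet> m = 0" if u: "u \<bullet> a = 0" "u \<bullet> b = 0" "u' \<bullet> a' = 0" "u' \<bullet> b' = 0" for u u'
        proof -
          have "u \<in> U" "u' \<in> U'" using u by (auto simp: U_def U'_def)
          then obtain \<xi> \<eta> where "u = T (coord_proj A \<xi>)" "u' = T' (coord_proj A' \<eta>)" using A(2) A'(2) by blast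
          then show ?thesis using bilinear_coord_proj_eq_0[OF bl, of A A' \<xi> \<eta>] z k by auto
        qed
        moreover have "p \<in> ext_power 2" "p \<bullet> bivec a b = 0" "p \<bullet> bivec a' b' = 0" using p by (auto simp: H_def)
        ultimately show "p \<bullet> m = 0" by (rule sp)
      qed simp
      then show ?thesis by (simp only: card)
    qed
    moreover have "chart (2 * CARD('n) - 5) H (bivec_chart T0 k (A0 - {k}) T0 (- {k})) {z. fst z $ k = 0}"
      if k: "k \<in> A0" for k
    proof -
      have "card A0 > 0" using k by (auto simp: card_gt_0_iff)
      then have "\<not> U \<inter> U' \<subseteq> {0}" using A0(1) by (metis dim_eq_0 less_irrefl)
      moreover have "U \<inter> U' \<subseteq> {0} \<or> dim (U \<inter> U') + 4 = CARD('n)" using dI by (simp only: U_def U'_def)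
      ultimately have "card A0 + 4 = CARD('n)" using A0(1) by auto
      \<comment> \<open>Lines through a point of \<open>U \<inter> U'\<close> have
        \<open>CARD('n) - 5\<close> and \<open>CARD('n) - 1\<close> parameters, one short of the
        required number; the dummy coordinate makes up for it.\<close>
      then have card: "card (A0 - {k}) + card (- {k}) + 1 = 2 * CARD('n) - 5"
        using k \<open>card A0 > 0\<close> by (simp add: Compl_eq_Diff_UNIV card_Diff_subset)
      have "chart (card (A0 - {k}) + card (- {k}) + 1) H (bivec_chart T0 k (A0 - {k}) T0 (- {k})) {z. fst z $ k = 0}"
        by (rule chart_bivec_chart_null[OF T0(1) T0(1)]) simp
      then show ?thesis by (simp only: card)
    qed
    ultimately show "\<forall>(\<phi>, S)\<in>C. chart (2 * CARD('n) - 5) H \<phi> S" by (auto simp: C_def)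
    show "{p \<in> grassmann 2. p \<bullet> bivec a b = 0 \<and> p \<bullet> bivec a' b' = 0} \<subseteq> (\<Union>(\<phi>, S)\<in>C. \<phi> ` S)"
    proof clarify
      fix q :: "'n ext" assume "q \<in> grassmann 2" and q0: "q \<bullet> bivec a b = 0" "q \<bullet> bivec a' b' = 0"
      then obtain x y where q: "q = bivec x y" "q \<noteq> 0" by (auto simp: grassmann_2_iff)
      with q0 obtain u v where uv: "q = bivec u v" "u \<bullet> a = 0" "u \<bullet> b = 0" using bivec_meets' by metis
      have nz: "bivec u v \<noteq> 0" using q uv by simp
      have "bivec u v \<bullet> bivec a' b' = 0" using q0 uv by simp
      from bivec_meets[OF this] consider "u \<bullet> a' = 0" "u \<bullet> b' = 0"
        | t where "(v - t *\<^sub>R u) \<bullet> a' = 0" "(v - t *\<^sub>R u) \<bullet> b' = 0" by blast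
      then show "q \<in> (\<Union>(\<phi>, S)\<in>C. \<phi> ` S)"
      proof cases
        case 1
        have "u \<in> range (\<lambda>x. T0 (coord_proj A0 x))" unfolding A0(2) using uv 1 by (simp add: U_def U'_def)
        then obtain k z where "k \<in> A0" "fst z $ k = 0" "bivec u v = bivec_chart T0 k (A0 - {k}) T0 (- {k}) z"
          using bivec_chart_cover[OF T0 _ nz] by metis
        then show ?thesis by (auto simp: C_def uv(1))
      next
        case 2
        define w where "w = v - t *\<^sub>R u"
        have qw: "q = bivec u w" by (simp add: uv(1) w_def bivec_simps)
        have "u \<in> U" "w \<in> U'" using uv 2 by (auto simp: U_def U'_def w_def)
        then obtain \<xi> \<eta> where \<xi>: "u = T (coord_proj A \<xi>)" and \<eta>: "w = T' (coord_proj A' \<eta>)" using A(2) A'(2) by blast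
        define \<zeta> where "\<zeta> = coord_proj A \<xi>"
        have "\<zeta> \<noteq> 0" using nz by (auto simp: \<xi> \<zeta>_def linear_0[OF T] bivec_simps)
        then obtain k where k: "\<zeta> $ k \<noteq> 0" by (auto simp: vec_eq_iff)
        then have kA: "k \<in> A" unfolding \<zeta>_def by (rule coord_proj_nth_nonzero)
        define x' where "x' = inverse (\<zeta> $ k) *\<^sub>R \<zeta>"
        have "axis k 1 + coord_proj (A - {k}) x' = x'"
          using k kA by (intro coord_proj_insert_eq) (auto simp: x'_def \<zeta>_def coord_proj_def)
        \<comment> \<open>The scale removed from \<open>u\<close> is moved to \<open>w\<close>,
          whose coordinates on \<open>A'\<close> are all free.\<close>
        moreover have "q = bivec (T x') (T' (coord_proj A' (\<zeta> $ k *\<^sub>R \<eta>)))"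
          using k by (simp add: qw \<xi> \<eta> x'_def \<zeta>_def[symmetric] linear_scale[OF T] linear_scale[OF T']
              linear_scale[OF linear_coord_proj] bivec_simps)
        ultimately have "q = bivec_chart T k (A - {k}) T' A' (x', \<zeta> $ k *\<^sub>R \<eta>)" by (simp add: bivec_chart_def)
        then show ?thesis using kA by (auto simp: C_def)
      qed
    qed
  qed
  then show ?thesis using that by (simp add: H_def)
qed

section \<open>Bars at a pair of rods\<close>

text \<open>To see that certain lines span the space cut out by two rods it suffices, dually, that
  each form killing them is a combination of the two rod forms.\<close>

lemma ext_power_2_inner_eq_0_if_combination:
  fixes p s s' m :: "'n::{finite,linorder} ext"
  assumes "\<And>x y. bivec x y \<bullet> m = c * (bivec x y \<bullet> s) + c' * (bivec x y \<bullet> s')"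
    and p: "p \<in> ext_power 2" and "p \<bullet> s = 0" "p \<bullet> s' = 0"
  shows "p \<bullet> m = 0"
proof -
  have "p \<bullet> (m - c *\<^sub>R s - c' *\<^sub>R s') = 0"
    by (rule ext_power_2_inner_eq_0[OF _ p]) (simp add: inner_diff_right assms(1))
  then show ?thesis using assms(3,4) by (simp add: inner_diff_right)
qed

text \<open>With the four vectors independent, the two subspaces span the whole space and meet in
  codimension 4.\<close>

lemma charted_two_transversal_rods:
  fixes a b a' b' :: "real ^ ('n::{finite,linorder})"
  assumes ind: "independent {a, b, a', b'}" and dist: "distinct [a, b, a', b']"
  obtains C :: "'n::{finite,linorder} bivec_charts"
  where "charted (2 * CARD('n) - 5) {p \<in> ext_power 2. p \<bullet> bivec a b = 0 \<and> p \<bullet> bivec a' b' = 0}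
    {p \<in> grassmann 2. p \<bullet> bivec a b = 0 \<and> p \<bullet> bivec a' b' = 0} C"
proof (rule charted_grassmann_two_rods)
  have "independent {a, b}" "independent {a', b'}" using ind by (auto elim!: independent_mono)
  from this[THEN dim_annihilator]
  show "dim {x. x \<bullet> a = 0 \<and> x \<bullet> b = 0} + 2 = CARD('n)" "dim {x. x \<bullet> a' = 0 \<and> x \<bullet> b' = 0} + 2 = CARD('n)"
    using dist by simp_all
  have "{x. \<forall>v\<in>{a, b, a', b'}. x \<bullet> v = 0} = {x. x \<bullet> a = 0 \<and> x \<bullet> b = 0} \<inter> {x. x \<bullet> a' = 0 \<and> x \<bullet> b' = 0}" by auto
  then show "{x. x \<bullet> a = 0 \<and> x \<bullet> b = 0} \<inter> {x. x \<bullet> a' = 0 \<and> x \<bullet> b' = 0} \<subseteq> {0} \<or>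
      dim ({x. x \<bullet> a = 0 \<and> x \<bullet> b = 0} \<inter> {x. x \<bullet> a' = 0 \<and> x \<bullet> b' = 0}) + 4 = CARD('n)"
    using dim_annihilator[OF ind] dist by simp
  obtain w1 where w1: "w1 \<bullet> a = 1" "w1 \<bullet> b = 0" "w1 \<bullet> a' = 0" "w1 \<bullet> b' = 0"
    using dual_vector[OF ind, of a] dist by auto
  obtain w2 where w2: "w2 \<bullet> a = 0" "w2 \<bullet> b = 1" "w2 \<bullet> a' = 0" "w2 \<bullet> b' = 0"
    using dual_vector[OF ind, of b] dist by auto
  obtain w3 where w3: "w3 \<bullet> a = 0" "w3 \<bullet> b = 0" "w3 \<bullet> a' = 1" "w3 \<bullet> b' = 0"
    using dual_vector[OF ind, of a'] dist by auto
  obtain w4 where w4: "w4 \<bullet> a = 0" "w4 \<bullet> b = 0" "w4 \<bullet> a' = 0" "w4 \<bullet> b' = 1"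
    using dual_vector[OF ind, of b'] dist by auto
  fix m p :: "'n ext"
  assume z: "\<And>u u'. u \<bullet> a = 0 \<Longrightarrow> u \<bullet> b = 0 \<Longrightarrow> u' \<bullet> a' = 0 \<Longrightarrow> u' \<bullet> b' = 0 \<Longrightarrow> bivec u u' \<bullet> m = 0"
    and p: "p \<in> ext_power 2" "p \<bullet> bivec a b = 0" "p \<bullet> bivec a' b' = 0"
  have z': "bivec u' u \<bullet> m = 0" if "u \<bullet> a = 0" "u \<bullet> b = 0" "u' \<bullet> a' = 0" "u' \<bullet> b' = 0" for u u'
    using z[OF that] bivec_commute[of u' u] by simp
  \<comment> \<open>Split \<open>x\<close> into \<open>P x\<close> in the second subspace,
    \<open>Q x\<close> in the first and \<open>X x\<close> in both. In the expansion of
    \<open>bivec x y\<close>, every term but those of \<open>P\<close> with \<open>P\<close> and of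
    \<open>Q\<close> with \<open>Q\<close> joins a vector of the first subspace to one of the
    second, so \<open>m\<close> kills it; these two yield the determinants that are the rod
    forms.\<close>
  define P where "P x = (x \<bullet> a) *\<^sub>R w1 + (x \<bullet> b) *\<^sub>R w2" for x
  define Q where "Q x = (x \<bullet> a') *\<^sub>R w3 + (x \<bullet> b') *\<^sub>R w4" for x
  define X where "X x = x - P x - Q x" for x
  note ws = w1 w2 w3 w4
  have P: "P x \<bullet> a' = 0" "P x \<bullet> b' = 0" "P x \<bullet> a = x \<bullet> a" "P x \<bullet> b = x \<bullet> b" for x
    by (simp_all add: P_def inner_add_left ws)
  have Q: "Q x \<bullet> a = 0" "Q x \<bullet> b = 0" "Q x \<bullet> a' = x \<bullet> a'" "Q x \<bullet> b' = x \<bullet> b'" for x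
    by (simp_all add: Q_def inner_add_left ws)
  have X: "X x \<bullet> a = 0" "X x \<bullet> b = 0" "X x \<bullet> a' = 0" "X x \<bullet> b' = 0" for x
    by (simp_all add: X_def inner_diff_left P Q)
  have PP: "bivec (P x) (P y) \<bullet> m = (bivec w1 w2 \<bullet> m) * (bivec x y \<bullet> bivec a b)" for x y
    unfolding P_def using bivec_commute[of w2 w1] by (simp add: bivec_simps inner_add_left inner_bivec algebra_simps)
  have QQ: "bivec (Q x) (Q y) \<bullet> m = (bivec w3 w4 \<bullet> m) * (bivec x y \<bullet> bivec a' b')" for x y
    unfolding Q_def using bivec_commute[of w4 w3] by (simp add: bivec_simps inner_add_left inner_bivec algebra_simps)
  show "p \<bullet> m = 0"
  proof (rule ext_power_2_inner_eq_0_if_combination[OF _ p])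
    fix x y
    have dec: "x = P x + (X x + Q x)" for x by (simp add: X_def)
    have "bivec x y = bivec (P x) (P y) + bivec (P x) (X y + Q y) + bivec (X x + Q x) (P y) +
        bivec (X x) (X y + Q y) + bivec (Q x) (X y) + bivec (Q x) (Q y)"
      by (subst dec[of x], subst dec[of y]) (simp add: bivec_simps algebra_simps)
    moreover have "bivec (P x) (X y + Q y) \<bullet> m = 0" by (rule z') (simp_all add: inner_add_left P Q X)
    moreover have "bivec (X x + Q x) (P y) \<bullet> m = 0" by (rule z) (simp_all add: inner_add_left P Q X)
    moreover have "bivec (X x) (X y + Q y) \<bullet> m = 0" by (rule z') (simp_all add: inner_add_left P Q X)
    moreover have "bivec (Q x) (X y) \<bullet> m = 0" by (rule z) (simp_all add: inner_add_left P Q X)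
    ultimately show "bivec x y \<bullet> m = (bivec w1 w2 \<bullet> m) * (bivec x y \<bullet> bivec a b) +
        (bivec w3 w4 \<bullet> m) * (bivec x y \<bullet> bivec a' b')"
      by (simp add: inner_add_left PP QQ)
  qed
qed (use that in blast)

text \<open>The two subspaces are the lines spanned by \<open>w3\<close> and \<open>w2\<close>, i.e.
  points of the projective plane. Up to scale a single bar joins them, \<open>bivec w3 w2\<close>,
  and a form killing it is a combination of the other two coordinate forms, which are the rod
  forms.\<close>

lemma charted_two_rods_in_dim_3:
  fixes a b b' :: "real ^ ('n::{finite,linorder})"
  assumes ind: "independent {a, b, b'}" and dist: "distinct [a, b, b']" and n: "CARD('n) = 3"
  obtains C :: "'n::{finite,linorder} bivec_charts"
  where "charted (2 * CARD('n) - 5) {p \<in> ext_power 2. p \<bullet> bivec a b = 0 \<and> p \<bullet> bivec a b' = 0}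
    {p \<in> grassmann 2. p \<bullet> bivec a b = 0 \<and> p \<bullet> bivec a b' = 0} C"
proof (rule charted_grassmann_two_rods)
  have "independent {a, b}" "independent {a, b'}" using ind by (auto elim!: independent_mono)
  from this[THEN dim_annihilator]
  show "dim {x. x \<bullet> a = 0 \<and> x \<bullet> b = 0} + 2 = CARD('n)" "dim {x. x \<bullet> a = 0 \<and> x \<bullet> b' = 0} + 2 = CARD('n)"
    using dist by simp_all
  have "dim {x. \<forall>v\<in>{a, b, b'}. x \<bullet> v = 0} = 0" using dim_annihilator[OF ind] dist n by simp
  then have triv: "x = 0" if "x \<bullet> a = 0" "x \<bullet> b = 0" "x \<bullet> b' = 0" for x
    unfolding dim_eq_0 using that by auto
  then show "{x. x \<bullet> a = 0 \<and> x \<bullet> b = 0} \<inter> {x. x \<bullet> a = 0 \<and> x \<bullet> b' = 0} \<subseteq> {0} \<or>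
      dim ({x. x \<bullet> a = 0 \<and> x \<bullet> b = 0} \<inter> {x. x \<bullet> a = 0 \<and> x \<bullet> b' = 0}) + 4 = CARD('n)"
    by blast
  obtain w1 where w1: "w1 \<bullet> a = 1" "w1 \<bullet> b = 0" "w1 \<bullet> b' = 0"
    using dual_vector[OF ind, of a] dist by auto
  obtain w2 where w2: "w2 \<bullet> a = 0" "w2 \<bullet> b = 1" "w2 \<bullet> b' = 0"
    using dual_vector[OF ind, of b] dist by auto
  obtain w3 where w3: "w3 \<bullet> a = 0" "w3 \<bullet> b = 0" "w3 \<bullet> b' = 1"
    using dual_vector[OF ind, of b'] dist by auto
  fix m p :: "'n ext"
  assume z: "\<And>u u'. u \<bullet> a = 0 \<Longrightarrow> u \<bullet> b = 0 \<Longrightarrow> u' \<bullet> a = 0 \<Longrightarrow> u' \<bullet> b' = 0 \<Longrightarrow> bivec u u' \<bullet> m = 0"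
    and p: "p \<in> ext_power 2" "p \<bullet> bivec a b = 0" "p \<bullet> bivec a b' = 0"
  have dec: "x = (x \<bullet> a) *\<^sub>R w1 + (x \<bullet> b) *\<^sub>R w2 + (x \<bullet> b') *\<^sub>R w3" for x
  proof -
    have "x - ((x \<bullet> a) *\<^sub>R w1 + (x \<bullet> b) *\<^sub>R w2 + (x \<bullet> b') *\<^sub>R w3) = 0"
      by (rule triv) (simp_all add: inner_diff_left inner_add_left w1 w2 w3)
    then show ?thesis by simp
  qed
  have "bivec w3 w2 \<bullet> m = 0" by (rule z) (simp_all add: w2 w3)
  moreover from this have "bivec w2 w3 \<bullet> m = 0" using bivec_commute[of w2 w3] by simp
  ultimately have exp: "bivec (x1 *\<^sub>R w1 + x2 *\<^sub>R w2 + x3 *\<^sub>R w3) (y1 *\<^sub>R w1 + y2 *\<^sub>R w2 + y3 *\<^sub>R w3) \<bullet> m =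
      (bivec w1 w2 \<bullet> m) * (x1 * y2 - x2 * y1) + (bivec w1 w3 \<bullet> m) * (x1 * y3 - x3 * y1)" for x1 x2 x3 y1 y2 y3
    using bivec_commute[of w2 w1] bivec_commute[of w3 w1]
    by (simp add: bivec_simps inner_add_left algebra_simps)
  show "p \<bullet> m = 0"
  proof (rule ext_power_2_inner_eq_0_if_combination[OF _ p])
    fix x y
    show "bivec x y \<bullet> m = (bivec w1 w2 \<bullet> m) * (bivec x y \<bullet> bivec a b) + (bivec w1 w3 \<bullet> m) * (bivec x y \<bullet> bivec a b')"
      using exp[of "x \<bullet> a" "x \<bullet> b" "x \<bullet> b'" "y \<bullet> a" "y \<bullet> b" "y \<bullet> b'"]
      unfolding dec[of x, symmetric] dec[of y, symmetric] inner_bivec .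
  qed
qed (use that in blast)

lemma bivec_through:
  assumes "e \<in> span {a, b}" "e \<noteq> 0"
  obtains b1 where "bivec a b = bivec e b1"
proof -
  obtain k l where e: "e = k *\<^sub>R a + l *\<^sub>R b"
    using assms(1) by (auto simp: span_insert span_singleton algebra_simps)
  show ?thesis
  proof (cases "k = 0")
    case False
    then have "bivec a b = bivec e (inverse k *\<^sub>R b)" by (simp add: e bivec_simps)
    then show ?thesis by (rule that)
  next
    case True
    then have "l \<noteq> 0" using e assms(2) by auto
    then have "bivec a b = bivec e (- inverse l *\<^sub>R a)"
      using bivec_commute[of b a] by (simp add: e True bivec_simps)
    then show ?thesis by (rule that)
  qed
qed

text \<open>A nonzero fourfold product makes \<open>a\<close>, \<open>b\<close>, \<open>a'\<close>,
  \<open>b'\<close> independent. In dimension 3 the planes of \<open>a\<close>, \<open>b\<close> and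
  of \<open>a'\<close>, \<open>b'\<close> share a vector \<open>e\<close>; factoring both bivectors
  through \<open>e\<close> leaves second factors that are independent modulo \<open>e\<close>,
  because the bivectors are not proportional.\<close>

lemma charted_grassmann_two_rods':
  fixes a b a' b' :: "real ^ ('n::{finite,linorder})"
  assumes ab: "a \<bullet> a = 1" "b \<bullet> b = 1" "a \<bullet> b = 0" and ab': "a' \<bullet> a' = 1" "b' \<bullet> b' = 1" "a' \<bullet> b' = 0"
    and tr: "wedge (bivec a b) (bivec a' b') \<noteq> 0 \<or> CARD('n) = 3 \<and> (\<forall>t. bivec a' b' \<noteq> t *\<^sub>R bivec a b)"
  obtains C :: "'n::{finite,linorder} bivec_charts"
  where "charted (2 * CARD('n) - 5) {p \<in> ext_power 2. p \<bullet> bivec a b = 0 \<and> p \<bullet> bivec a' b' = 0}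
    {p \<in> grassmann 2. p \<bullet> bivec a b = 0 \<and> p \<bullet> bivec a' b' = 0} C"
  using tr
proof (elim disjE conjE)
  assume "wedge (bivec a b) (bivec a' b') \<noteq> 0"
  moreover have "wedge_list [a, b, a', b'] = wedge (bivec a b) (bivec a' b')"
  proof -
    have "wedge_list [a, b, a', b'] = wedge (ext_of_vec a) (wedge (ext_of_vec b) (wedge_list [a', b']))"
      by (simp only: wedge_list_Cons)
    then show ?thesis by (simp only: wedge_list_pair bivec_def wedge_assoc)
  qed
  ultimately have "independent (set [a, b, a', b']) \<and> distinct [a, b, a', b']"
    by (intro wedge_list_independent) simp
  then have "independent {a, b, a', b'}" "distinct [a, b, a', b']" by simp_all
  then show ?thesis by (rule charted_two_transversal_rods) (rule that)
next
  assume n: "CARD('n) = 3" and np: "\<forall>t. bivec a' b' \<noteq> t *\<^sub>R bivec a b"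
  have orth: "dim (span {c, d}) = 2" if "c \<bullet> c = 1" "d \<bullet> d = 1" "c \<bullet> d = 0" for c d :: "(real, 'n) vec"
  proof -
    have "c \<noteq> d" using that by auto
    have "pairwise orthogonal {c, d}" using that by (auto simp: pairwise_def orthogonal_def inner_commute)
    then have "independent {c, d}" by (rule pairwise_orthogonal_independent) (use that in auto)
    then show ?thesis using \<open>c \<noteq> d\<close> by (simp add: dim_eq_card_independent)
  qed
  have "dim {x + y |x y. x \<in> span {a, b} \<and> y \<in> span {a', b'}} + dim (span {a, b} \<inter> span {a', b'}) = 2 + 2"
    using dim_sums_Int[of "span {a, b}" "span {a', b'}"] orth[OF ab] orth[OF ab'] by simp
  moreover have "dim {x + y |x y. x \<in> span {a, b} \<and> y \<in> span {a', b'}} \<le> 3"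
    using dim_subset_UNIV[of "{x + y |x y. x \<in> span {a, b} \<and> y \<in> span {a', b'}}"] n by simp
  ultimately have "\<not> span {a, b} \<inter> span {a', b'} \<subseteq> {0}" unfolding dim_eq_0[symmetric] by linarith
  then obtain e where e: "e \<noteq> 0" "e \<in> span {a, b}" "e \<in> span {a', b'}" by auto
  obtain b1 where b1: "bivec a b = bivec e b1" using bivec_through[OF e(2,1)] by blast
  obtain b2 where b2: "bivec a' b' = bivec e b2" using bivec_through[OF e(3,1)] by blast
  have "bivec a b \<bullet> bivec a b = 1" using ab by (simp add: inner_bivec inner_commute)
  then have "bivec e b1 \<noteq> 0" using b1 by auto
  then have "wedge_list [e, b1] \<noteq> 0" by (simp add: wedge_list_pair)
  then have i: "independent {e, b1}" "e \<noteq> b1" using wedge_list_independent by fastforce+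
  have "b2 \<notin> span {e, b1}"
  proof
    assume "b2 \<in> span {e, b1}"
    then obtain k l where "b2 = k *\<^sub>R e + l *\<^sub>R b1"
      by (auto simp: span_insert span_singleton algebra_simps)
    then have "bivec e b2 = l *\<^sub>R bivec e b1" by (simp add: bivec_simps)
    then show False using np b1 b2 by auto
  qed
  then have "independent {b2, e, b1}" "b2 \<noteq> e" "b2 \<noteq> b1"
    using i span_base[of b2 "{e, b1}"] by (auto simp: independent_insert)
  moreover have "{b2, e, b1} = {e, b1, b2}" by auto
  ultimately have "independent {e, b1, b2}" "distinct [e, b1, b2]" using i by auto
  then show ?thesis unfolding b1 b2 using n
    by (rule charted_two_rods_in_dim_3) (rule that[unfolded b1 b2])
qed

section \<open>Transport of charts to rods and edges\<close>

lemma lipschitz_on_bounded_linear: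
  fixes L :: "'b::euclidean_space \<Rightarrow> 'c::euclidean_space" and f :: "'a::metric_space \<Rightarrow> 'b"
  assumes L: "linear L" and f: "lipschitz_on_bounded f"
  shows "lipschitz_on_bounded (\<lambda>z. L (f z))"
  unfolding lipschitz_on_bounded_def
proof (intro allI impI)
  fix S :: "'a set" assume "bounded S"
  then obtain C where C: "C-lipschitz_on S f" using f unfolding lipschitz_on_bounded_def by blast
  obtain B where B: "B > 0" "\<And>z. norm (L z) \<le> B * norm z" using linear_bounded_pos[OF L] by blast
  have "(B * C)-lipschitz_on S (\<lambda>z. L (f z))"
  proof (rule lipschitz_onI)
    fix x y assume xy: "x \<in> S" "y \<in> S"
    have "dist (L (f x)) (L (f y)) \<le> B * dist (f x) (f y)"
      using B(2)[of "f x - f y"] by (simp add: dist_norm linear_diff[OF L])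
    also have "\<dots> \<le> B * (C * dist x y)"
      using lipschitz_onD[OF C xy] B(1) by (intro mult_left_mono) auto
    finally show "dist (L (f x)) (L (f y)) \<le> B * C * dist x y" by (simp add: mult.assoc)
  qed (use B(1) lipschitz_on_nonneg[OF C] in simp)
  then show "\<exists>C. C-lipschitz_on S (\<lambda>z. L (f z))" by blast
qed

text \<open>Linear equations pull back along the adjoint. Applied to \<open>hodge_inv\<close>, this
  turns charts for lines into charts for rods.\<close>

lemma charted_linear_image:
  fixes L :: "'b::euclidean_space \<Rightarrow> 'c::euclidean_space"
    and C :: "(('p::euclidean_space \<Rightarrow> 'b) \<times> 'p set) set"
  assumes L: "linear L" and ch: "charted n H Z C"
  shows "charted n (L ` H) (L ` Z) ((\<lambda>(\<phi>, S). (\<lambda>z. L (\<phi> z), S)) ` C)"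
proof -
  have adj: "L x \<bullet> m = x \<bullet> adjoint L m" for x m by (rule adjoint_works[OF L, symmetric])
  have "chart n (L ` H) (\<lambda>z. L (\<phi> z)) S" if "chart n H \<phi> S" for \<phi> :: "'p \<Rightarrow> 'b" and S
  proof -
    have "\<exists>I\<subseteq>Basis. card I = n \<and>
        (\<forall>x y. (\<forall>b\<in>I. x \<bullet> b = y \<bullet> b) \<longrightarrow> \<phi> x = \<phi> y \<and> (x \<in> S \<longleftrightarrow> y \<in> S))"
      using that unfolding chart_def by (elim conjE)
    then obtain I where I: "I \<subseteq> Basis" "card I = n"
      "\<And>x y. (\<forall>b\<in>I. x \<bullet> b = y \<bullet> b) \<Longrightarrow> \<phi> x = \<phi> y \<and> (x \<in> S \<longleftrightarrow> y \<in> S)"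
      by blast
    have "\<exists>I\<subseteq>Basis. card I = n \<and>
        (\<forall>x y. (\<forall>b\<in>I. x \<bullet> b = y \<bullet> b) \<longrightarrow> L (\<phi> x) = L (\<phi> y) \<and> (x \<in> S \<longleftrightarrow> y \<in> S))"
      by (intro exI[of _ I] conjI allI impI I(1,2) arg_cong[of _ _ L]) (use I(3) in blast)+
    then show ?thesis
      using that unfolding chart_def by (simp add: adj lipschitz_on_bounded_linear[OF L])
  qed
  then show ?thesis using ch unfolding charted_def
  proof (intro conjI; elim conjE)
    assume "Z \<subseteq> (\<Union>(\<phi>, S)\<in>C. \<phi> ` S)"
    then have "L ` Z \<subseteq> L ` (\<Union>(\<phi>, S)\<in>C. \<phi> ` S)" by (rule image_mono)
    also have "\<dots> = (\<Union>(\<phi>, S)\<in>(\<lambda>(\<phi>, S). (\<lambda>z. L (\<phi> z), S)) ` C. \<phi> ` S)"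
      by (auto simp: image_UN image_image case_prod_unfold)
    finally show "L ` Z \<subseteq> (\<Union>(\<phi>, S)\<in>(\<lambda>(\<phi>, S). (\<lambda>z. L (\<phi> z), S)) ` C. \<phi> ` S)" .
  next
    assume "\<forall>(\<phi>, S)\<in>C. chart n H \<phi> S"
    then have "chart n H (fst c) (snd c)" if "c \<in> C" for c using that by (auto simp: split_beta)
    then show "\<forall>(\<phi>, S)\<in>(\<lambda>(\<phi>, S). (\<lambda>z. L (\<phi> z), S)) ` C. chart n (L ` H) \<phi> S"
      using \<open>\<And>S \<phi>. chart n H \<phi> S \<Longrightarrow> chart n (L ` H) (\<lambda>z. L (\<phi> z)) S\<close> by (simp add: split_beta)
  qed auto
qed

lemma charted_subset: "charted n H Z C \<Longrightarrow> Z' \<subseteq> Z \<Longrightarrow> charted n H Z' C"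
  by (auto simp: charted_def)

lemma linear_edge_vector: "linear (edge_vector G e)"
  by (intro linearI) (auto simp: edge_vector_def vec_eq_iff)

text \<open>The number of rods at \<open>e\<close> selects the family of charts. As
  \<open>CARD('n) = d + 1\<close>, the counts \<open>2 * CARD('n)\<close> minus 3, 4 or 5 are the
  dimension of the cone over the Grassmannian minus one for each rod.\<close>

lemma charted_bars:
  fixes r :: "'n::{finite,linorder} ext ^ 'v::finite"
  assumes n: "CARD('n) = d + 1" and d: "d \<ge> 2" and r: "r \<in> rod_configurations d R" and ne: "tail G e \<noteq> head G e"
    and tr: "\<And>u v. u \<in> R \<Longrightarrow> v \<in> R \<Longrightarrow> u \<noteq> v \<Longrightarrow> wedge (hodge (r $ u)) (hodge (r $ v)) \<noteq> 0 \<or> d = 2"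
  obtains C :: "'n::{finite,linorder} bivec_charts"
  where "charted (2 * (d - 1) - card (R \<inter> {tail G e, head G e}) + 1)
    (rod_hyperplane R r (tail G e) \<inter> rod_hyperplane R r (head G e))
    {q \<in> grassmann 2. \<forall>v \<in> R \<inter> {tail G e, head G e}. ext_dot q (r $ v) = 0} C"
proof -
  let ?t = "tail G e" and ?h = "head G e"
  let ?H = "rod_hyperplane R r ?t \<inter> rod_hyperplane R r ?h"
  let ?Z = "{q \<in> grassmann 2. \<forall>v \<in> R \<inter> {?t, ?h}. ext_dot q (r $ v) = 0}"
  have dec: "\<exists>a b c. a \<bullet> a = 1 \<and> b \<bullet> b = 1 \<and> a \<bullet> b = 0 \<and> c \<noteq> 0 \<and> hodge (r $ v) = c *\<^sub>R bivec a b" if "v \<in> R" for v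
  proof -
    have "r $ v \<in> grassmann (d - 1)" using r that by (auto simp: rod_configurations_def)
    moreover have "d - 1 + 2 = CARD('n)" using n d by simp
    ultimately obtain a b c where "a \<bullet> a = 1" "b \<bullet> b = 1" "a \<bullet> b = 0" "c \<noteq> 0" "hodge (r $ v) = c *\<^sub>R bivec a b"
      by (rule hodge_grassmann)
    then show ?thesis by blast
  qed
  consider (none) "?t \<notin> R" "?h \<notin> R" | (one) v where "v \<in> R" "R \<inter> {?t, ?h} = {v}" | (two) "?t \<in> R" "?h \<in> R"
    by (cases "?t \<in> R"; cases "?h \<in> R") auto
  then show ?thesis
  proof cases
    case none
    obtain C :: "'n bivec_charts"
      where C: "charted (2 * CARD('n) - 3) (ext_power 2) (grassmann 2) C"
      by (rule charted_grassmann)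
    have "?H = ext_power 2" "R \<inter> {?t, ?h} = {}" using none by (auto simp: rod_hyperplane_def)
    moreover have "2 * CARD('n) - 3 = 2 * (d - 1) + 1" using n d by simp
    ultimately show ?thesis using C that by simp
  next
    case one
    obtain a b c where ab: "a \<bullet> a = 1" "b \<bullet> b = 1" "a \<bullet> b = 0" and c: "c \<noteq> 0" "hodge (r $ v) = c *\<^sub>R bivec a b"
      using dec[OF one(1)] by blast
    obtain C :: "'n bivec_charts"
      where C: "charted (2 * CARD('n) - 4) {p \<in> ext_power 2. p \<bullet> bivec a b = 0}
      {p \<in> grassmann 2. p \<bullet> bivec a b = 0} C"
      by (rule charted_grassmann_one_rod[OF ab])
    have dot: "ext_dot q (r $ v) = 0 \<longleftrightarrow> q \<bullet> bivec a b = 0" for q by (simp add: ext_dot_hodge c)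
    have m: "x \<in> R \<and> (x = ?t \<or> x = ?h) \<longleftrightarrow> x = v" for x
      using one(2) by (simp add: set_eq_iff)
    have "?t = v \<and> ?h \<notin> R \<or> ?h = v \<and> ?t \<notin> R" using m[of v] m[of ?t] m[of ?h] ne by metis
    then have "?H = {p \<in> ext_power 2. p \<bullet> bivec a b = 0}"
      using one(1) dot by (auto simp: rod_hyperplane_def)
    moreover have "?Z = {p \<in> grassmann 2. p \<bullet> bivec a b = 0}" by (simp add: one(2) dot)
    moreover have "2 * CARD('n) - 4 = 2 * (d - 1) - card (R \<inter> {?t, ?h}) + 1" using n d by (simp add: one(2))
    ultimately show ?thesis using C that by simp
  next
    case two
    obtain a b c where ab: "a \<bullet> a = 1" "b \<bullet> b = 1" "a \<bullet> b = 0" and c: "c \<noteq> 0" "hodge (r $ ?t) = c *\<^sub>R bivec a b"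
      using dec[OF two(1)] by blast
    obtain a' b' c' where ab': "a' \<bullet> a' = 1" "b' \<bullet> b' = 1" "a' \<bullet> b' = 0" and c': "c' \<noteq> 0" "hodge (r $ ?h) = c' *\<^sub>R bivec a' b'"
      using dec[OF two(2)] by blast
    have "wedge (bivec a b) (bivec a' b') \<noteq> 0 \<or> CARD('n) = 3 \<and> (\<forall>t. bivec a' b' \<noteq> t *\<^sub>R bivec a b)"
    proof (cases "wedge (hodge (r $ ?t)) (hodge (r $ ?h)) = 0")
      case False
      then show ?thesis by (auto simp: c c' bilinear_lmul[OF bilinear_wedge] bilinear_rmul[OF bilinear_wedge])
    next
      case True
      then have "d = 2" using tr[OF two ne] by auto
      \<comment> \<open>Proportional duals would make the two rods coincide as projective
        points.\<close>
      moreover have "bivec a' b' \<noteq> t *\<^sub>R bivec a b" for t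
      proof
        assume "bivec a' b' = t *\<^sub>R bivec a b"
        then have "hodge (r $ ?h) = (c' * t / c) *\<^sub>R hodge (r $ ?t)" using c c' by simp
        then have "r $ ?h = (c' * t / c) *\<^sub>R r $ ?t"
          using linear_scale[OF linear_hodge_inv, of "c' * t / c" "hodge (r $ ?t)"] hodge_inv_hodge[of "r $ ?h"]
          by (simp only: hodge_inv_hodge)
        moreover have "r $ ?h \<noteq> 0" using r two by (auto simp: rod_configurations_def grassmann_def)
        ultimately have k: "r $ ?h = (c' * t / c) *\<^sub>R r $ ?t" "c' * t / c \<noteq> 0" by auto
        then have "r $ ?t = inverse (c' * t / c) *\<^sub>R r $ ?h" by simp
        then have "r $ ?t \<in> span {r $ ?h}" by (metis span_base span_scale singletonI)
        moreover have "r $ ?h \<in> span {r $ ?t}" using k(1) by (metis span_base span_scale singletonI)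
        ultimately have "span {r $ ?t} = span {r $ ?h}" by (simp add: span_eq)
        then show False using r two ne by (auto simp: rod_configurations_def)
      qed
      ultimately show ?thesis using n by simp
    qed
    with ab ab' obtain C :: "'n bivec_charts"
      where C: "charted (2 * CARD('n) - 5) {p \<in> ext_power 2. p \<bullet> bivec a b = 0 \<and> p \<bullet> bivec a' b' = 0}
      {p \<in> grassmann 2. p \<bullet> bivec a b = 0 \<and> p \<bullet> bivec a' b' = 0} C"
      by (rule charted_grassmann_two_rods')
    have R: "R \<inter> {?t, ?h} = {?t, ?h}" using two by auto
    have dot: "ext_dot q (r $ ?t) = 0 \<longleftrightarrow> q \<bullet> bivec a b = 0" "ext_dot q (r $ ?h) = 0 \<longleftrightarrow> q \<bullet> bivec a' b' = 0" for q
      by (simp_all add: ext_dot_hodge c c')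
    have "?H = {p \<in> ext_power 2. p \<bullet> bivec a b = 0 \<and> p \<bullet> bivec a' b' = 0}"
      using two by (auto simp: rod_hyperplane_def dot)
    moreover have "?Z = {p \<in> grassmann 2. p \<bullet> bivec a b = 0 \<and> p \<bullet> bivec a' b' = 0}" by (simp add: R dot)
    moreover have "2 * CARD('n) - 5 = 2 * (d - 1) - card (R \<inter> {?t, ?h}) + 1" using n d ne by (simp add: R)
    ultimately show ?thesis using C that by simp
  qed
qed

lemma family_dependent_mono: "family_dependent F x \<Longrightarrow> F \<subseteq> F' \<Longrightarrow> family_dependent F' x"
  unfolding family_dependent_def by (meson subset_iff)

section \<open>Almost all configurations are generic\<close>

lemma almost_all_bars_generic:
  fixes r :: "'n::{finite,linorder} ext ^ 'v::finite" and G :: "('v, 'e::finite) pre_digraph"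
  assumes n: "CARD('n) = d + 1" and d: "d \<ge> 2" and r: "r \<in> rod_configurations d R"
    and lf: "\<And>e. e \<in> arcs G \<Longrightarrow> tail G e \<noteq> head G e"
    and tr: "\<And>u v. u \<in> R \<Longrightarrow> v \<in> R \<Longrightarrow> u \<noteq> v \<Longrightarrow> wedge (hodge (r $ u)) (hodge (r $ v)) \<noteq> 0 \<or> d = 2"
  shows "almost_all (bar_dim d G R) (bar_configurations G R r) (\<lambda>q.
    generic_position (arcs G) (edge_flat G R r) (\<lambda>e. edge_vector G e (q $ e)))"
proof -
  define H where "H e = rod_hyperplane R r (tail G e) \<inter> rod_hyperplane R r (head G e)" for e
  define Z where "Z e = {q \<in> grassmann 2. \<forall>v \<in> R \<inter> {tail G e, head G e}. ext_dot q (r $ v) = 0}" for e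
  define N where "N e = 2 * (d - 1) - card (R \<inter> {tail G e, head G e}) + 1" for e
  have "\<forall>e\<in>arcs G. \<exists>C :: 'n bivec_charts.
     charted (N e) (H e) (Z e) C"
  proof
    fix e assume e: "e \<in> arcs G"
    obtain C :: "'n bivec_charts"
      where "charted (N e) (H e) (Z e) C"
      unfolding N_def H_def Z_def
    proof (rule charted_bars[OF n d r lf[OF e]])
      fix u v assume "u \<in> R" "v \<in> R" "u \<noteq> v"
      then show "wedge (hodge (r $ u)) (hodge (r $ v)) \<noteq> 0 \<or> d = 2" by (rule tr)
    qed
    then show "\<exists>C :: 'n bivec_charts.
      charted (N e) (H e) (Z e) C" by blast
  qed
  then obtain C :: "'e \<Rightarrow> 'n bivec_charts"
    where C: "\<forall>e\<in>arcs G. charted (N e) (H e) (Z e) (C e)"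
    using bchoice[of "arcs G" "\<lambda>e C. charted (N e) (H e) (Z e) C"] by blast
  have "\<exists>T. T \<subseteq> H e \<and> independent T \<and> H e \<subseteq> span T" for e using basis_exists[of "H e"] by metis
  then obtain T where T: "\<And>e. T e \<subseteq> H e" "\<And>e. independent (T e)" "\<And>e. H e \<subseteq> span (T e)" by metis
  have finT: "finite (T e)" for e using T(2) by (rule independent_imp_finite)
  define X where "X q = (\<chi> e. edge_vector G e (q $ e))" for q :: "'n ext ^ 'e"
  have linX: "linear X" unfolding X_def
    by (intro linearI) (simp_all add: vec_eq_iff linear_add[OF linear_edge_vector] linear_scale[OF linear_edge_vector])
  then have contX: "continuous_on UNIV X" by (simp add: linear_continuous_on linear_conv_bounded_linear)
  define upd where "upd q e a = (\<chi> f. if f = e then edge_vector G e a else X q $ f)" for q :: "'n ext ^ 'e" and e a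
  have contU: "continuous_on UNIV (\<lambda>q. upd q e a)" for e a
    unfolding upd_def
  proof (intro continuous_on_vec_lambda)
    fix f show "continuous_on UNIV (\<lambda>q. if f = e then edge_vector G e a else X q $ f)"
      by (cases "f = e") (simp_all add: continuous_on_component[OF contX])
  qed
  \<comment> \<open>The edge vectors of \<open>F\<close> are dependent, but would not be if the bar
    at \<open>e\<close> were \<open>a\<close>. By \<open>flat_subset_span_if_generic\<close>, a
    configuration outside all these sets is generic.\<close>
  define Bad where "Bad F e a = {q. family_dependent F (X q)} \<inter> - {q. family_dependent F (upd q e a)}" for F e a
  define Q where "Q = {q :: 'n ext ^ 'e. (\<forall>e\<in>arcs G. q $ e \<in> Z e) \<and> (\<forall>e. e \<notin> arcs G \<longrightarrow> q $ e = 0)}"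
  have null: "hausdorff_measure (\<Sum>e\<in>arcs G. N e) (Q \<inter> Bad F e a) = 0"
    if e: "e \<in> arcs G" "e \<in> F" and a: "a \<in> T e" for F e a
    unfolding Q_def
  proof (rule hausdorff_null_product[where H = H and C = C, OF _ e(1)])
    show "charted (N f) (H f) (Z f) (C f)" if "f \<in> arcs G" for f using C that by blast
    have "closed (X -` {x. family_dependent F x})"
      by (intro closed_vimage closed_family_dependent contX)
    moreover have "closed ((\<lambda>q. upd q e a) -` {x. family_dependent F x})"
      by (intro closed_vimage closed_family_dependent contU)
    ultimately show "Bad F e a \<in> sets borel" by (auto simp: Bad_def vimage_def)
    fix x :: "'n ext ^ 'e"
    have aH: "a \<in> H e" using T(1) a by blast
    have a0: "a \<noteq> 0" using T(2) a dependent_zero by blast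
    let ?x = "\<lambda>y. \<chi> f. if f = e then y else x $ f"
    have Xupd: "X (?x y) = upd x e y" "upd (?x y) e a = upd x e a" for y
      by (simp_all add: X_def upd_def vec_eq_iff)
    show "\<exists>m. (\<exists>p\<in>H e. p \<bullet> m \<noteq> 0) \<and> (\<forall>y. ?x y \<in> Bad F e a \<longrightarrow> y \<bullet> m = 0)"
    \<comment> \<open>If this holds, the slice avoids \<open>Bad F e a\<close>, and any
      \<open>m\<close> not vanishing on \<open>H e\<close> will do, such as
      \<open>a\<close>.\<close>
    proof (cases "family_dependent F (upd x e a)")
      case True
      then have "?x y \<notin> Bad F e a" for y by (simp add: Bad_def Xupd)
      moreover have "a \<bullet> a \<noteq> 0" using a0 by simp
      ultimately show ?thesis using aH by blast
    next
      case False
      define S where "S = span (($) (X x) ` (F - {e}))"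
      have F: "F = insert e (F - {e})" using e(2) by auto
      have im: "($) (upd x e y) ` (F - {e}) = ($) (X x) ` (F - {e})" for y
        by (intro image_cong) (auto simp: upd_def)
      \<comment> \<open>The exchange does not touch \<open>F - {e}\<close>, which is independent
        because \<open>F\<close> is when the bar at \<open>e\<close> is \<open>a\<close>.\<close>
      have nd: "\<not> family_dependent (F - {e}) (upd x e y)" for y
      proof -
        have "family_dependent (F - {e}) (upd x e y) \<longleftrightarrow> family_dependent (F - {e}) (upd x e a)"
          by (rule family_dependent_cong) (auto simp: upd_def)
        then show ?thesis using False family_dependent_mono by blast
      qed
      \<comment> \<open>The vector \<open>z\<close> is normal to the span \<open>S\<close> of the
        other edge vectors and pairs nontrivially with that of \<open>a\<close>. Pulled back to
        bars, it gives the linear equation that every bar with edge vector in \<open>S\<close>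
        satisfies.\<close>
      obtain y z where yz: "y \<in> S" "\<And>w. w \<in> S \<Longrightarrow> orthogonal z w" "edge_vector G e a = y + z"
        using orthogonal_subspace_decomp_exists unfolding S_def by metis
      have "edge_vector G e a \<notin> S"
      proof
        assume "edge_vector G e a \<in> S"
        then have "upd x e a $ e \<in> span (($) (upd x e a) ` (F - {e}))" unfolding im by (simp add: upd_def S_def)
        then have "family_dependent (insert e (F - {e})) (upd x e a)" by (rule family_dependent_insertI) simp
        then show False using False F by simp
      qed
      then have "z \<noteq> 0" using yz(1,3) by auto
      define m where "m = adjoint (edge_vector G e) z"
      have m: "w \<bullet> m = edge_vector G e w \<bullet> z" for w
        unfolding m_def by (rule adjoint_works[OF linear_edge_vector])
      have "a \<bullet> m = z \<bullet> z" using yz(2)[OF yz(1)] by (simp add: m yz(3) inner_add_left orthogonal_def inner_commute[of y z])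
      then have "a \<bullet> m \<noteq> 0" using \<open>z \<noteq> 0\<close> by simp
      moreover have "w \<bullet> m = 0" if "?x w \<in> Bad F e a" for w
      proof -
        have "family_dependent (insert e (F - {e})) (upd x e w)" using that F by (simp add: Bad_def Xupd)
        from family_dependent_insertD[OF this nd] have "edge_vector G e w \<in> S"
          unfolding im S_def by (simp add: upd_def)
        then have "orthogonal z (edge_vector G e w)" by (rule yz(2))
        then show ?thesis by (simp add: m orthogonal_def inner_commute[of z])
      qed
      ultimately show ?thesis using aH by blast
    qed
  qed
  define I where "I = {(F, e, a). e \<in> arcs G \<and> e \<in> F \<and> a \<in> T e}"
  have "finite (UNIV \<times> (SIGMA e:UNIV. T e) :: ('e set \<times> 'e \<times> 'n ext) set)" using finT by auto
  then have finI: "finite I" by (rule finite_subset[rotated]) (auto simp: I_def)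
  have "hausdorff_measure (\<Sum>e\<in>arcs G. N e) (\<Union>i\<in>I. Q \<inter> (case i of (F, e, a) \<Rightarrow> Bad F e a)) = 0"
    by (rule hausdorff_measure_eq_0_finite_UN[OF finI]) (auto simp: I_def intro: null)
  moreover have "{q \<in> bar_configurations G R r. \<not> generic_position (arcs G) (edge_flat G R r) (\<lambda>e. edge_vector G e (q $ e))}
     \<subseteq> (\<Union>i\<in>I. Q \<inter> (case i of (F, e, a) \<Rightarrow> Bad F e a))"
  proof (rule subsetI, rule ccontr)
    fix q assume q: "q \<in> {q \<in> bar_configurations G R r. \<not> generic_position (arcs G) (edge_flat G R r) (\<lambda>e. edge_vector G e (q $ e))}"
      and nb: "q \<notin> (\<Union>i\<in>I. Q \<inter> (case i of (F, e, a) \<Rightarrow> Bad F e a))"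
    have qQ: "q \<in> Q" using q by (auto simp: Q_def Z_def bar_configurations_def)
    have nbad: "q \<notin> Bad F e a" if "e \<in> arcs G" "e \<in> F" "a \<in> T e" for F e a
      using nb qQ that by (auto simp: I_def)
    have "generic_position (arcs G) (edge_flat G R r) (\<lambda>e. edge_vector G e (q $ e))"
      unfolding generic_position_def
    proof (intro conjI ballI allI impI)
      fix e assume e: "e \<in> arcs G"
      then have "q $ e \<in> Z e" using qQ by (simp add: Q_def)
      then have g: "q $ e \<in> grassmann 2" and dot: "\<And>v. v \<in> R \<inter> {tail G e, head G e} \<Longrightarrow> ext_dot (q $ e) (r $ v) = 0"
        by (auto simp: Z_def)
      have "q $ e \<in> ext_power 2" using g by (auto simp: grassmann_2_iff bivec_in_ext_power)
      then have "q $ e \<in> H e" using dot by (auto simp: H_def rod_hyperplane_def)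
      then show "edge_vector G e (q $ e) \<in> edge_flat G R r e" by (auto simp: edge_flat_def H_def)
      have "edge_vector G e (q $ e) $ tail G e = q $ e" by (simp add: edge_vector_def)
      then show "edge_vector G e (q $ e) \<noteq> 0" using g by (auto simp: grassmann_2_iff)
    next
      fix F e assume F: "F \<subseteq> arcs G" "e \<in> F"
        and sp: "edge_vector G e (q $ e) \<in> span ((\<lambda>e. edge_vector G e (q $ e)) ` (F - {e}))"
      have im: "(\<lambda>e. edge_vector G e (q $ e)) ` S = ($) (X q) ` S" for S by (simp add: X_def)
      show "edge_flat G R r e \<subseteq> span ((\<lambda>e. edge_vector G e (q $ e)) ` (F - {e}))"
        unfolding im
      proof (rule flat_subset_span_if_generic[OF _ F(2)])
        show "X q $ e \<in> span (($) (X q) ` (F - {e}))" using sp unfolding im by (simp add: X_def)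
        have "edge_vector G e ` H e \<subseteq> edge_vector G e ` span (T e)" using T(3) by blast
        also have "\<dots> = span (edge_vector G e ` T e)" by (rule linear_span_image[OF linear_edge_vector, symmetric])
        finally show "edge_flat G R r e \<subseteq> span (edge_vector G e ` T e)" by (simp add: edge_flat_def H_def)
        fix F' v assume F': "F' \<subseteq> F" "e \<in> F'" and v: "v \<in> edge_vector G e ` T e" and dep: "family_dependent F' (X q)"
        obtain a where a: "a \<in> T e" "v = edge_vector G e a" using v by blast
        have "q \<notin> Bad F' e a" using nbad F F' a by blast
        then have "family_dependent F' (upd q e a)" using dep by (simp add: Bad_def)
        then show "family_dependent F' (\<chi> f. if f = e then v else X q $ f)"
          unfolding upd_def a(2) .
      qed
    qed
    then show False using q by blast
  qed
  ultimately show ?thesis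
    unfolding almost_all_def bar_dim_def N_def by (rule hausdorff_measure_eq_0_subset)
qed

lemma almost_all_rods_transversal:
  fixes R :: "'v::finite set"
  assumes n: "CARD('n::{finite,linorder}) = d + 1" and d: "d \<ge> 3"
  shows "almost_all (rod_dim d R) (rod_configurations d R) (\<lambda>r :: 'n ext ^ 'v.
    \<forall>u\<in>R. \<forall>v\<in>R. u \<noteq> v \<longrightarrow> wedge (hodge (r $ u)) (hodge (r $ v)) \<noteq> 0)"
proof -
  obtain C0 :: "'n bivec_charts"
    where "charted (2 * CARD('n) - 3) (ext_power 2) (grassmann 2) C0"
    by (rule charted_grassmann)
  from charted_linear_image[OF linear_hodge_inv this]
  obtain C :: "'n bivec_charts"
    where C: "charted (2 * CARD('n) - 3) (hodge_inv ` ext_power 2) (hodge_inv ` grassmann 2) C"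
    by blast
  have gr: "grassmann (d - 1) \<subseteq> hodge_inv ` (grassmann 2 :: 'n ext set)"
  proof
    fix s :: "'n ext" assume s: "s \<in> grassmann (d - 1)"
    have "d - 1 + 2 = CARD('n)" using n d by simp
    from hodge_grassmann[OF s this] obtain a b c where "c \<noteq> 0" "hodge s = c *\<^sub>R bivec a b" by metis
    then have "hodge s = bivec (c *\<^sub>R a) b" by (simp add: bivec_simps)
    moreover have "s \<noteq> 0" using s by (simp add: grassmann_def)
    then have "hodge s \<noteq> 0" using hodge_inv_hodge[of s] linear_0[OF linear_hodge_inv] by metis
    ultimately have "hodge s \<in> grassmann 2" by (auto simp: grassmann_2_iff)
    then show "s \<in> hodge_inv ` grassmann 2" by (metis hodge_inv_hodge imageI)
  qed
  from C gr have C: "charted (2 * CARD('n) - 3) (hodge_inv ` ext_power 2) (grassmann (d - 1)) C"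
    by (rule charted_subset)
  \<comment> \<open>The null set lemma asks for a linear equation at every \<open>x\<close>, not
    only at configurations. The first condition excludes the \<open>x\<close> for which the product
    with \<open>hodge (x $ u)\<close> might vanish for trivial reasons.\<close>
  define Bad where "Bad u v = {r :: 'n ext ^ 'v. \<exists>K. card K = 2 \<and> hodge (r $ u) $ K \<noteq> 0} \<inter>
    {r. wedge (hodge (r $ u)) (hodge (r $ v)) = 0}" for u v
  define Q where "Q = {r :: 'n ext ^ 'v. (\<forall>v\<in>R. r $ v \<in> grassmann (d - 1)) \<and> (\<forall>v. v \<notin> R \<longrightarrow> r $ v = 0)}"
  have conth: "continuous_on UNIV (\<lambda>r :: 'n ext ^ 'v. hodge (r $ u))" for u
    by (rule linear_continuous_on_compose[OF _ linear_hodge]) (intro continuous_intros)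
  have null: "hausdorff_measure (\<Sum>v\<in>R. 2 * CARD('n) - 3) (Q \<inter> Bad u v) = 0"
    if uv: "u \<in> R" "v \<in> R" "u \<noteq> v" for u v
    unfolding Q_def
  proof (rule hausdorff_null_product[where H = "\<lambda>_. hodge_inv ` ext_power 2" and C = "\<lambda>_. C", OF _ uv(2)])
    show "charted (2 * CARD('n) - 3) (hodge_inv ` ext_power 2) (grassmann (d - 1)) C" by (rule C)
    have "open (\<Union>K\<in>{K. card K = 2}. {r :: 'n ext ^ 'v. hodge (r $ u) $ K \<noteq> 0})"
      by (intro open_UN ballI open_Collect_neq continuous_on_component conth continuous_on_const)
    moreover have "(\<Union>K\<in>{K. card K = 2}. {r :: 'n ext ^ 'v. hodge (r $ u) $ K \<noteq> 0}) =
      {r :: 'n ext ^ 'v. \<exists>K. card K = 2 \<and> hodge (r $ u) $ K \<noteq> 0}" by auto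
    ultimately have op: "open {r :: 'n ext ^ 'v. \<exists>K. card K = 2 \<and> hodge (r $ u) $ K \<noteq> 0}" by simp
    have cl: "closed {r :: 'n ext ^ 'v. wedge (hodge (r $ u)) (hodge (r $ v)) = 0}"
      by (intro closed_Collect_eq bilinear_continuous_on_compose[OF _ _ bilinear_wedge] conth continuous_on_const)
    show "Bad u v \<in> sets borel"
      unfolding Bad_def by (intro sets.Int borel_open[OF op] borel_closed[OF cl])
    fix x :: "'n ext ^ 'v"
    let ?H = "hodge_inv ` ext_power 2"
    let ?x = "\<lambda>y. \<chi> f. if f = v then y else x $ f"
    have K2: "axis K 1 \<in> ext_power 2" if "card K = 2" for K :: "'n set"
      using that by (auto simp: ext_power_def axis_def)
    show "\<exists>m. (\<exists>p\<in>?H. p \<bullet> m \<noteq> 0) \<and> (\<forall>y. ?x y \<in> Bad u v \<longrightarrow> y \<bullet> m = 0)"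
    proof (cases "\<exists>K. card K = 2 \<and> hodge (x $ u) $ K \<noteq> 0")
      case False
      \<comment> \<open>The slice avoids \<open>Bad u v\<close>, so any \<open>m\<close> that does
        not vanish on \<open>?H\<close> serves.\<close>
      then have "?x y \<notin> Bad u v" for y using uv(3) by (auto simp: Bad_def)
      moreover obtain K :: "'n set" where "card K = 2"
        using obtain_subset_with_card_n[of 2 "UNIV :: 'n set"] n d by auto
      then have "hodge_inv (axis K 1) \<in> ?H" using K2 by blast
      moreover have "hodge_inv (axis K 1 :: 'n ext) \<noteq> 0"
        by (metis axis_eq_0_iff hodge_hodge_inv linear_0 linear_hodge zero_neq_one)
      then have "hodge_inv (axis K 1) \<bullet> hodge_inv (axis K 1 :: 'n ext) \<noteq> 0" by simp
      ultimately show ?thesis by blast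
    next
      case True
      then obtain K where K: "card K = 2" "hodge (x $ u) $ K \<noteq> 0" by blast
      \<comment> \<open>Here \<open>d \<ge> 3\<close> enters: two indices outside \<open>K\<close>
        are required. The coordinate \<open>K \<union> M\<close> of the product is linear in the rod
        at \<open>v\<close>, and at \<open>hodge_inv (axis M 1)\<close> only the term of
        \<open>K\<close> survives.\<close>
      have "card (- K) \<ge> 2" using K(1) n d by (simp add: Compl_eq_Diff_UNIV card_Diff_subset)
      then obtain M where M: "M \<subseteq> - K" "card M = 2" by (metis obtain_subset_with_card_n)
      define f where "f y = wedge (hodge (x $ u)) (hodge y) $ (K \<union> M)" for y
      have f: "linear f" unfolding f_def
        by (intro linearI) (simp_all add: linear_add[OF linear_hodge] linear_scale[OF linear_hodge]
            bilinear_radd[OF bilinear_wedge] bilinear_rmul[OF bilinear_wedge])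
      have fm: "f y = y \<bullet> adjoint f 1" for y using adjoint_works[OF f, of y 1] by simp
      have "f (hodge_inv (axis M 1)) = (\<Sum>I\<in>Pow (K \<union> M). if I = K then shuffle_sign K M * hodge (x $ u) $ K else 0)"
        unfolding f_def hodge_hodge_inv wedge_def vec_lambda_beta
      proof (intro sum.cong refl)
        fix I assume "I \<in> Pow (K \<union> M)"
        then have "K \<union> M - I = M \<longleftrightarrow> I = K" using M(1) by auto
        then show "shuffle_sign I (K \<union> M - I) * hodge (x $ u) $ I * axis M 1 $ (K \<union> M - I) =
          (if I = K then shuffle_sign K M * hodge (x $ u) $ K else 0)"
          by (auto simp: axis_def)
      qed
      also have "\<dots> = shuffle_sign K M * hodge (x $ u) $ K" by simp
      finally have "hodge_inv (axis M 1) \<bullet> adjoint f 1 \<noteq> 0" using K(2) fm by (simp add: shuffle_sign_nonzero)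
      moreover have "hodge_inv (axis M 1) \<in> ?H" using K2[OF M(2)] by blast
      moreover have "y \<bullet> adjoint f 1 = 0" if "?x y \<in> Bad u v" for y
      proof -
        have "wedge (hodge (x $ u)) (hodge y) = 0" using that uv(3) by (simp add: Bad_def)
        then show ?thesis unfolding fm[symmetric] by (simp add: f_def)
      qed
      ultimately show ?thesis by blast
    qed
  qed
  define I where "I = {(u, v). u \<in> R \<and> v \<in> R \<and> u \<noteq> v}"
  have 1: "hausdorff_measure (\<Sum>v\<in>R. 2 * CARD('n) - 3) (\<Union>i\<in>I. Q \<inter> (case i of (u, v) \<Rightarrow> Bad u v)) = 0"
    by (rule hausdorff_measure_eq_0_finite_UN) (auto simp: I_def intro: null simp del: sum_constant)
  have 2: "(\<Sum>v\<in>R. 2 * CARD('n) - 3) = rod_dim d R"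
  proof -
    have "2 * CARD('n) - 3 = 2 * (d - 1) + 1" using n d by simp
    then show ?thesis by (simp only: rod_dim_def)
  qed
  have 3: "{r \<in> rod_configurations d R. \<not> (\<forall>u\<in>R. \<forall>v\<in>R. u \<noteq> v \<longrightarrow> wedge (hodge (r $ u)) (hodge (r $ v)) \<noteq> 0)}
      \<subseteq> (\<Union>i\<in>I. Q \<inter> (case i of (u, v) \<Rightarrow> Bad u v))"
  proof
    fix r :: "'n ext ^ 'v"
    assume "r \<in> {r \<in> rod_configurations d R. \<not> (\<forall>u\<in>R. \<forall>v\<in>R. u \<noteq> v \<longrightarrow> wedge (hodge (r $ u)) (hodge (r $ v)) \<noteq> 0)}"
    then obtain u v where r: "r \<in> rod_configurations d R"
      and uv: "u \<in> R" "v \<in> R" "u \<noteq> v" "wedge (hodge (r $ u)) (hodge (r $ v)) = 0" by auto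
    have "r $ u \<in> hodge_inv ` grassmann 2"
      using r uv(1) gr by (auto simp: rod_configurations_def)
    then have g: "hodge (r $ u) \<in> grassmann 2" by (auto simp: hodge_hodge_inv)
    have "\<exists>K. card K = 2 \<and> hodge (r $ u) $ K \<noteq> 0"
    proof (rule ccontr)
      assume "\<not> ?thesis"
      moreover have "hodge (r $ u) \<in> ext_power 2" using g by (auto simp: grassmann_2_iff bivec_in_ext_power)
      ultimately have "hodge (r $ u) = 0" by (auto simp: vec_eq_iff ext_power_def)
      then show False using g by (simp add: grassmann_2_iff)
    qed
    then have "r \<in> Bad u v" using uv by (simp add: Bad_def)
    moreover have "r \<in> Q" using r by (simp add: Q_def rod_configurations_def)
    ultimately show "r \<in> (\<Union>i\<in>I. Q \<inter> (case i of (u, v) \<Rightarrow> Bad u v))" using uv by (auto simp: I_def)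
  qed
  show ?thesis unfolding almost_all_def by (rule hausdorff_measure_eq_0_subset[OF 1[unfolded 2] 3])
qed

lemma almost_all_mono:
  assumes "almost_all s S P" "\<And>x. x \<in> S \<Longrightarrow> P x \<Longrightarrow> Q x"
  shows "almost_all s S Q"
  unfolding almost_all_def
  by (rule hausdorff_measure_eq_0_subset[OF assms(1)[unfolded almost_all_def]]) (use assms(2) in auto)

lemma almost_all_True: "(\<And>x. x \<in> S \<Longrightarrow> P x) \<Longrightarrow> almost_all s S P"
  by (simp add: almost_all_def hausdorff_measure_empty cong: conj_cong)

theorem theorem4p9:
  fixes d :: nat
    and G :: "('v::finite, 'e::finite) pre_digraph"
    and B R :: "'v set"
  assumes "d \<ge> 2" and "CARD('n::{finite,linorder}) = d + 1"
    and "loopfree_digraph G"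
    and "verts G = B \<union> R" and "B \<inter> R = {}"
  shows "almost_all (rod_dim d R) (rod_configurations d R) (\<lambda>r :: 'n ext ^ 'v.
           almost_all (bar_dim d G R) (bar_configurations G R r) (\<lambda>q.
             bar_rod_matroid G q = generic_matroid (arcs G) (edge_flat G R r)))"
proof -
  have lf: "tail G e \<noteq> head G e" if "e \<in> arcs G" for e
    using assms(3) that by (rule loopfree_digraph.no_loops)
  \<comment> \<open>In dimension 3 all these products vanish, so for \<open>d = 2\<close> the
    condition is made trivial; distinctness of the rods takes its place.\<close>
  have "almost_all (rod_dim d R) (rod_configurations d R) (\<lambda>r :: 'n ext ^ 'v.
    \<forall>u\<in>R. \<forall>v\<in>R. u \<noteq> v \<longrightarrow> wedge (hodge (r $ u)) (hodge (r $ v)) \<noteq> 0 \<or> d = 2)"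
  proof (cases "d = 2")
    case False
    then have "d \<ge> 3" using assms(1) by simp
    from almost_all_rods_transversal[OF assms(2) this, of R] show ?thesis
      by (rule almost_all_mono) blast
  qed (simp add: almost_all_True)
  then show ?thesis
  proof (rule almost_all_mono)
    fix r :: "'n ext ^ 'v"
    assume r: "r \<in> rod_configurations d R"
      and tr: "\<forall>u\<in>R. \<forall>v\<in>R. u \<noteq> v \<longrightarrow> wedge (hodge (r $ u)) (hodge (r $ v)) \<noteq> 0 \<or> d = 2"
    have "almost_all (bar_dim d G R) (bar_configurations G R r) (\<lambda>q.
      generic_position (arcs G) (edge_flat G R r) (\<lambda>e. edge_vector G e (q $ e)))"
      using tr by (intro almost_all_bars_generic[OF assms(2,1) r lf]) auto
    \<comment> \<open>The edge vectors of \<open>q\<close> are themselves the generic position, and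
      their linear matroid is the bar-rod matroid by definition.\<close>
    then show "almost_all (bar_dim d G R) (bar_configurations G R r) (\<lambda>q.
      bar_rod_matroid G q = generic_matroid (arcs G) (edge_flat G R r))"
      by (rule almost_all_mono) (simp add: bar_rod_matroid_def generic_matroid_eq)
  qed
qed

end
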